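(* Let $F$ be a graph with $\chi(F)=k+1>r$ and $\mathrm{biex}(n,F)=\Theta(1)$. Then $$\mathrm{ex}_r(n,F^{(r)+})=t_r(n,k)+\Theta(n^{r-1}).$$
   Context: An $r$-graph is an $r$-uniform hypergraph. Given a graph $F$, the $r$-uniform expansion $F^{(r)+}$ is the $r$-graph obtained from $F$ by adding $r-2$ new vertices to each edge of $F$, so that the $(r-2)|E(F)|$ new vertices are pairwise distinct and not in $V(F)$. $\mathrm{ex}_r(n,\mathcal{F})$ is the largest number of hyperedges in an $n$-vertex $r$-graph containing no copy of $\mathcal{F}$ as a (not necessarily induced) subhypergraph. $T_r(n,k)$ is the complete balanced $k$-partite $n$-vertex $r$-graph: the vertex set is partitioned into $k$ parts each of order $\lfloor n/k\rfloor$ or $\lceil n/k\rceil$, and the hyperedges are all $r$-sets containing at most one vertex from each part. $t_r(n,k)$ is its number of hyperedges. For a graph $F$ with $\chi(F)=k+1$, the decomposition family $\mathcal{D}(F)$ is the family of bipartite graphs obtained from $F$ by deleting $k-1$ color classes of a proper $(k+1)$-coloring of $F$. $\mathrm{biex}(n,F):=\mathrm{ex}(n,\mathcal{D}(F))$ is the largest number of edges in an $n$-vertex graph containing no member of $\mathcal{D}(F)$ as a subgraph. Asymptotic notation is for $n\to\infty$ with $F$ and $r$ fixed.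
   Formalization: The uniformity is assumed to satisfy r ≥ 3; for r = 2 the expansion is F itself and the claim fails, e.g. for two triangles sharing a vertex, where biex = 1 but ex(n,F) = ⌊n²/4⌋ + 1. *)

theory Defs
  imports Complex_Main "HOL-Library.Landau_Symbols" "HOL-Library.FuncSet"
begin

type_synonym 'a hypergraph = "'a set \<times> 'a set set"

abbreviation verts :: "'a hypergraph \<Rightarrow> 'a set" where "verts \<equiv> fst"
abbreviation edges :: "'a hypergraph \<Rightarrow> 'a set set" where "edges \<equiv> snd"

(* A finite simple graph is a 2-graph in this sense. *)
definition r_graph :: "nat \<Rightarrow> 'a hypergraph \<Rightarrow> bool" where
  "r_graph r H \<longleftrightarrow> finite (verts H) \<and> (\<forall>e\<in>edges H. e \<subseteq> verts H \<and> card e = r)"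

definition contains_copy :: "'b hypergraph \<Rightarrow> 'a hypergraph \<Rightarrow> bool" where
  "contains_copy G H \<longleftrightarrow>
     (\<exists>f. inj_on f (verts H) \<and> f ` verts H \<subseteq> verts G \<and> (\<forall>e\<in>edges H. f ` e \<in> edges G))"

(* Every n-vertex r-graph is isomorphic to one on {..<n}.  The set is nonempty (it contains 0)
   as soon as every member of the forbidden family has an edge. *)
definition ex :: "nat \<Rightarrow> nat \<Rightarrow> 'a hypergraph set \<Rightarrow> nat" where
  "ex r n \<F> = Max {card (edges G) | G :: nat hypergraph.
     r_graph r G \<and> verts G = {..<n} \<and> (\<forall>H\<in>\<F>. \<not> contains_copy G H)}"

(* The new vertices of the edge e are the Inr (e, j) with j < r - 2. *)
definition expansion :: "nat \<Rightarrow> 'a hypergraph \<Rightarrow> ('a + 'a set \<times> nat) hypergraph" where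
  "expansion r F =
     (Inl ` verts F \<union> Inr ` (edges F \<times> {..<r - 2}),
      {Inl ` e \<union> Inr ` ({e} \<times> {..<r - 2}) | e. e \<in> edges F})"

(* The parts are the residue classes modulo k; see card_turan_part below for balancedness. *)
definition turan_hypergraph :: "nat \<Rightarrow> nat \<Rightarrow> nat \<Rightarrow> nat hypergraph" where
  "turan_hypergraph r n k =
     ({..<n}, {e. e \<subseteq> {..<n} \<and> card e = r \<and> (\<forall>i<k. card {v \<in> e. v mod k = i} \<le> 1)})"

definition turan_number :: "nat \<Rightarrow> nat \<Rightarrow> nat \<Rightarrow> nat" where
  "turan_number r n k = card (edges (turan_hypergraph r n k))"

lemma card_residue_class:
  assumes "i < k"
  shows "card {v \<in> {..<n}. v mod k = i} = n div k + (if i < n mod k then 1 else 0)"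
proof (induction n)
  case 0
  then show ?case by simp
next
  case (Suc n)
  have "{v \<in> {..<Suc n}. v mod k = i} =
      (if n mod k = i then insert n {v \<in> {..<n}. v mod k = i} else {v \<in> {..<n}. v mod k = i})"
    by (auto simp: less_Suc_eq)
  then have "card {v \<in> {..<Suc n}. v mod k = i} =
      (if n mod k = i then 1 else 0) + card {v \<in> {..<n}. v mod k = i}"
    by simp
  then show ?case
    using Suc assms by (auto simp: mod_Suc div_Suc split: if_splits)
qed

lemma card_turan_part:
  assumes "i < k"
  shows "int (card {v \<in> {..<n}. v mod k = i}) \<in> {\<lfloor>real n / real k\<rfloor>, \<lceil>real n / real k\<rceil>}"
proof -
  have fl: "\<lfloor>real n / real k\<rfloor> = int (n div k)"
    by (simp add: floor_divide_of_nat_eq)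
  have "\<lceil>real n / real k\<rceil> = int (n div k) + 1" if "i < n mod k"
  proof -
    have "\<not> k dvd n" using that by (auto simp: dvd_eq_mod_eq_0)
    then have "real n / real k \<noteq> real_of_int (int (n div k))"
      using assms by (metis dvd_triv_right nonzero_eq_divide_eq not_less_zero of_int_of_nat_eq
          of_nat_eq_0_iff of_nat_eq_iff of_nat_mult)
    then show ?thesis using fl by (simp add: ceiling_altdef)
  qed
  then show ?thesis using fl card_residue_class[OF assms, of n] by auto
qed

definition proper_colouring :: "'a hypergraph \<Rightarrow> nat \<Rightarrow> ('a \<Rightarrow> nat) \<Rightarrow> bool" where
  "proper_colouring F m c \<longleftrightarrow>
     c \<in> verts F \<rightarrow> {..<m} \<and> (\<forall>u v. {u, v} \<in> edges F \<longrightarrow> c u \<noteq> c v)"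

definition chromatic_number :: "'a hypergraph \<Rightarrow> nat" where
  "chromatic_number F = (LEAST m. \<exists>c. proper_colouring F m c)"

definition delete_verts :: "'a hypergraph \<Rightarrow> 'a set \<Rightarrow> 'a hypergraph" where
  "delete_verts F X = (verts F - X, {e \<in> edges F. e \<inter> X = {}})"

(* With chromatic number k + 1, the number k - 1 of deleted classes is chromatic_number F - 2. *)
definition decomposition_family :: "'a hypergraph \<Rightarrow> 'a hypergraph set" where
  "decomposition_family F =
     {delete_verts F {v \<in> verts F. c v \<in> D} | c D.
        proper_colouring F (chromatic_number F) c \<and>
        D \<subseteq> {..<chromatic_number F} \<and> card D = chromatic_number F - 2}"

definition biex :: "nat \<Rightarrow> 'a hypergraph \<Rightarrow> nat" where
  "biex n F = ex 2 n (decomposition_family F)"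

end

theory Submission
  imports Defs "HOL-Analysis.Convex"
begin

text \<open>
  Upper bound: discarding the hyperedges that contain a pair of codegree \<open>O(n\<^sup>r\<^sup>-\<^sup>3)\<close> costs only \<open>O(n\<^sup>r\<^sup>-\<^sup>1)\<close>
  hyperedges, after which the graph of the remaining pairs is \<open>F\<close>-free, since any copy of \<open>F\<close> in it
  extends greedily to an expansion. It remains to count \<open>r\<close>-cliques. As \<open>biex\<close> is bounded, a large star
  contains a member of the decomposition family, so \<open>F\<close> minus some vertex is \<open>k\<close>-colourable and \<open>F\<close>
  lies in a \<open>K(1,t,\<dots>,t)\<close> with \<open>k\<close> parts of size \<open>t\<close>. In a graph without this subgraph, vertices of
  degree below \<open>(1 - 1/k - \<epsilon>)n\<close> lie in so few cliques that they can be removed by induction on \<open>n\<close>. If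
  there are none, the vertices can be coloured with \<open>k\<close> colours so that each has fewer than \<open>t\<close>
  neighbours of its own colour; hence all but \<open>O(n\<^sup>r\<^sup>-\<^sup>1)\<close> of the \<open>r\<close>-cliques are properly coloured.

  Lower bound: to the Turan hypergraph add the hyperedges formed by a fixed vertex \<open>x\<close> and \<open>r - 1\<close>
  vertices of another part. A copy of the expansion would give a \<open>k\<close>-colouring of \<open>F\<close> in which only an
  edge having \<open>x\<close> among its new vertices is monochromatic. But deleting one edge from \<open>F\<close> does not make
  it \<open>k\<close>-colourable, because otherwise a single edge would be in the decomposition family and
  \<open>biex\<close> would vanish.
\<close>

section \<open>Counting cliques\<close>

text \<open>The error term is only one factor n below the main term, so an argument that loses
  o(n^r) is too weak and every loss has to be budgeted. There are at most n^2 pairs, hence a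
  codegree threshold of order n^(r-3); the same order suits the greedy extension, as each of
  boundedly many used vertices blocks at most n^(r-3) hyperedges through a given pair. Deleting
  vertices of low degree is free of charge: in a large graph such a vertex lies in fewer ordered
  cliques than the main term p n^r loses with one vertex, so the error constant does not accumulate
  along the induction. The upper bound is compared with binom(k,r) (n/k)^r, which exceeds t_r(n,k)
  by at most O(n^(r-1)), so that no extremal structure has to be identified exactly. The hypothesis
  on biex enters at two values of n only: one where biex is below n - 1, the size of a star, and one
  with n at least |V(F)| where biex is at least 1.\<close>

locale adjacency =
  fixes E :: "'a \<Rightarrow> 'a \<Rightarrow> bool"
  assumes sym: "E x y \<Longrightarrow> E y x"
    and irrefl: "\<not> E x x"
begin

definition nbrs :: "'a set \<Rightarrow> 'a \<Rightarrow> 'a set" where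
  "nbrs V x = {y \<in> V. E x y}"

definition cliques :: "'a set \<Rightarrow> nat \<Rightarrow> 'a set set" where
  "cliques V j = {K. K \<subseteq> V \<and> finite K \<and> card K = j \<and> (\<forall>x\<in>K. \<forall>y\<in>K. x \<noteq> y \<longrightarrow> E x y)}"

text \<open>Counting with orderings removes the factorials from the inequalities below: the balanced
  complete \<open>q\<close>-partite graph on n vertices has about
  \<open>(\<Prod>j<s. 1 - real j / real q)\<close> times n^s ordered
  \<open>s\<close>-cliques.\<close>

definition ordered_cliques :: "'a set \<Rightarrow> nat \<Rightarrow> real" where
  "ordered_cliques V j = fact j * real (card (cliques V j))"

definition common :: "'a set \<Rightarrow> 'a set \<Rightarrow> 'a set" where
  "common V K = {x \<in> V. \<forall>y\<in>K. E x y}"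

lemma finite_cliques: "finite V \<Longrightarrow> finite (cliques V j)"
  by (rule finite_subset[of _ "Pow V"]) (auto simp: cliques_def)

lemma ordered_cliques_nonneg: "0 \<le> ordered_cliques V j"
  by (simp add: ordered_cliques_def)

text \<open>Both sides run over a clique together with one further vertex, matched by
  \<open>(L, v)\<close> and \<open>(L - {v}, v)\<close>. The weight \<open>g\<close> is left free
  for two uses: weight 1 gives the number of larger cliques, the codegree of \<open>K\<close> gives
  the second moment of the codegrees.\<close>

lemma sum_clique_minus:
  fixes g :: "'a set \<Rightarrow> 'a \<Rightarrow> nat"
  assumes "finite V"
  shows "(\<Sum>L\<in>cliques V (Suc j). \<Sum>v\<in>L. g (L - {v}) v) = (\<Sum>K\<in>cliques V j. \<Sum>v\<in>common V K. g K v)"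
proof -
  have fin: "finite L" if "L \<in> cliques V i" for L i using that by (auto simp: cliques_def)
  have "(\<Sum>L\<in>cliques V (Suc j). \<Sum>v\<in>L. g (L - {v}) v)
      = (\<Sum>(L,v)\<in>Sigma (cliques V (Suc j)) (\<lambda>L. L). g (L - {v}) v)"
    by (rule sum.Sigma) (auto simp: finite_cliques assms fin)
  also have "\<dots> = (\<Sum>(K,v)\<in>Sigma (cliques V j) (common V). g K v)"
  proof (rule sum.reindex_bij_witness[where i = "\<lambda>(K,v). (insert v K, v)" and j = "\<lambda>(L,v). (L - {v}, v)"])
    fix p assume "p \<in> Sigma (cliques V (Suc j)) (\<lambda>L. L)"
    then obtain L v where p: "p = (L, v)" "L \<in> cliques V (Suc j)" "v \<in> L" by auto
    then show "(\<lambda>(L,v). (L - {v}, v)) p \<in> Sigma (cliques V j) (common V)"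
      by (auto simp: cliques_def common_def)
    show "(\<lambda>(K,v). (insert v K, v)) ((\<lambda>(L,v). (L - {v}, v)) p) = p" using p by auto
  next
    fix p assume "p \<in> Sigma (cliques V j) (common V)"
    then obtain K v where p: "p = (K, v)" "K \<in> cliques V j" "v \<in> common V K" by auto
    then have "v \<notin> K" using irrefl by (auto simp: common_def)
    then show "(\<lambda>(K,v). (insert v K, v)) p \<in> Sigma (cliques V (Suc j)) (\<lambda>L. L)"
        "(\<lambda>(L,v). (L - {v}, v)) ((\<lambda>(K,v). (insert v K, v)) p) = p"
      using p sym by (auto simp: cliques_def common_def)
  qed auto
  also have "\<dots> = (\<Sum>K\<in>cliques V j. \<Sum>v\<in>common V K. g K v)"
    by (rule sum.Sigma[symmetric]) (auto simp: finite_cliques assms common_def)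
  finally show ?thesis .
qed

lemma card_cliques_Suc:
  assumes "finite V"
  shows "(\<Sum>K\<in>cliques V j. card (common V K)) = Suc j * card (cliques V (Suc j))"
proof -
  have "(\<Sum>L\<in>cliques V (Suc j). \<Sum>v\<in>L. 1) = (\<Sum>L\<in>cliques V (Suc j). Suc j)"
    by (rule sum.cong) (auto simp: cliques_def)
  then show ?thesis
    using sum_clique_minus[OF assms, where g = "\<lambda>_ _. 1" and j = j] by (simp add: mult.commute)
qed

text \<open>Count by \<open>x\<close> instead of \<open>v\<close>. An \<open>x\<close> adjacent to
  all of \<open>L\<close> occurs \<open>Suc j\<close> times; an \<open>x\<close> with a
  non-neighbour \<open>y\<close> in \<open>L\<close> can only occur for \<open>v = y\<close>. The
  members of \<open>L\<close> belong to the second kind, being non-adjacent to themselves.\<close>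

lemma sum_common_minus_le:
  assumes "finite V" "L \<in> cliques V (Suc j)"
  shows "(\<Sum>v\<in>L. card (common V (L - {v}))) \<le> card V + j * card (common V L)"
proof -
  have L: "finite L" "card L = Suc j" using assms by (auto simp: cliques_def)
  have "(\<Sum>v\<in>L. card (common V (L - {v}))) = (\<Sum>v\<in>L. \<Sum>x\<in>V. of_bool (x \<in> common V (L - {v})))"
    using assms by (intro sum.cong refl) (auto simp: common_def Int_def conj_commute of_bool_def sum.If_cases)
  also have "\<dots> = (\<Sum>x\<in>V. \<Sum>v\<in>L. of_bool (x \<in> common V (L - {v})))"
    by (rule sum.swap)
  also have "\<dots> \<le> (\<Sum>x\<in>V. 1 + j * of_bool (x \<in> common V L))"
  proof (rule sum_mono)
    fix x assume x: "x \<in> V"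
    have eq: "(\<Sum>v\<in>L. of_bool (x \<in> common V (L - {v}))) = card {v\<in>L. x \<in> common V (L - {v})}"
      using L by (simp add: of_bool_def sum.If_cases Int_def)
    show "(\<Sum>v\<in>L. of_bool (x \<in> common V (L - {v}))) \<le> 1 + j * of_bool (x \<in> common V L)"
    proof (cases "x \<in> common V L")
      case True
      have "card {v\<in>L. x \<in> common V (L - {v})} \<le> Suc j"
        using L card_mono[of L "{v\<in>L. x \<in> common V (L - {v})}"] by auto
      then show ?thesis using eq True by simp
    next
      case False
      then obtain y where y: "y \<in> L" "\<not> E x y" using x by (auto simp: common_def)
      have "{v\<in>L. x \<in> common V (L - {v})} \<subseteq> {y}" using y by (auto simp: common_def)
      then have "card {v\<in>L. x \<in> common V (L - {v})} \<le> 1" using card_mono[of "{y}"] by fastforce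
      then show ?thesis using eq by simp
    qed
  qed
  also have "\<dots> = card V + j * card (common V L)"
    using assms by (simp only: sum.distrib sum_distrib_left[symmetric])
      (simp add: of_bool_def sum.If_cases common_def Int_def conj_commute)
  finally show ?thesis .
qed

text \<open>Cauchy-Schwarz for the codegrees of the \<open>j\<close>-cliques: their sum counts the
  \<open>Suc j\<close>-cliques, and the sum of their squares is controlled by
  \<open>sum_common_minus_le\<close>.\<close>

lemma moon_moser:
  assumes "finite V"
  shows "real (Suc j) * (ordered_cliques V (Suc j))\<^sup>2
    \<le> ordered_cliques V j * (real (card V) * ordered_cliques V (Suc j) + real j * ordered_cliques V (Suc (Suc j)))"
proof -
  let ?N = "\<lambda>i. real (card (cliques V i))"
  have "(\<Sum>K\<in>cliques V j. (card (common V K))\<^sup>2) = (\<Sum>L\<in>cliques V (Suc j). \<Sum>v\<in>L. card (common V (L - {v})))"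
    using sum_clique_minus[OF assms, where g = "\<lambda>K v. card (common V K)" and j = j] by (simp add: power2_eq_square)
  also have "\<dots> \<le> (\<Sum>L\<in>cliques V (Suc j). card V + j * card (common V L))"
    by (intro sum_mono sum_common_minus_le assms)
  also have "\<dots> = card V * card (cliques V (Suc j)) + j * (Suc (Suc j) * card (cliques V (Suc (Suc j))))"
    by (simp add: sum.distrib sum_distrib_left[symmetric] card_cliques_Suc[OF assms])
  finally have 1: "(\<Sum>K\<in>cliques V j. (real (card (common V K)))\<^sup>2)
      \<le> card V * ?N (Suc j) + j * (Suc (Suc j) * ?N (Suc (Suc j)))"
    by (metis (mono_tags, lifting) of_nat_le_iff of_nat_add of_nat_mult of_nat_sum of_nat_power sum.cong)
  have "(real (Suc j) * ?N (Suc j))\<^sup>2 = (\<Sum>K\<in>cliques V j. real (card (common V K)))\<^sup>2"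
    using card_cliques_Suc[OF assms, of j] by (metis of_nat_mult of_nat_sum)
  also have "\<dots> \<le> ?N j * (\<Sum>K\<in>cliques V j. (real (card (common V K)))\<^sup>2)"
    by (subst mult.commute) (rule sum_squared_le_sum_of_squares)
  also have "\<dots> \<le> ?N j * (card V * ?N (Suc j) + j * (Suc (Suc j) * ?N (Suc (Suc j))))"
    using 1 by (intro mult_left_mono) auto
  \<comment> \<open>One \<open>fact j\<close> belongs to \<open>?N j\<close>; the remaining
    \<open>fact j * Suc j\<close> turns the other counts into ordered ones.\<close>
  finally have "(real (Suc j) * ?N (Suc j))\<^sup>2 * (fact j * fact j * real (Suc j))
     \<le> (?N j * (card V * ?N (Suc j) + j * (Suc (Suc j) * ?N (Suc (Suc j))))) * (fact j * fact j * real (Suc j))"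
    by (rule mult_right_mono) simp
  then show ?thesis
    unfolding ordered_cliques_def fact_Suc of_nat_mult power2_eq_square by (simp only: algebra_simps)
qed

lemma ordered_cliques_0: "ordered_cliques V 0 = 1"
proof -
  have "cliques V 0 = {{}}" by (auto simp: cliques_def)
  then show ?thesis by (simp add: ordered_cliques_def)
qed

lemma ordered_cliques_Suc_le:
  assumes "finite V"
  shows "ordered_cliques V (Suc j) \<le> real (card V) * ordered_cliques V j"
proof -
  have "Suc j * card (cliques V (Suc j)) \<le> (\<Sum>K\<in>cliques V j. card V)"
    unfolding card_cliques_Suc[OF assms, symmetric] 
    by (intro sum_mono card_mono assms) (auto simp: common_def)
  then have "real (Suc j) * card (cliques V (Suc j)) \<le> real (card V) * card (cliques V j)"
    by (metis of_nat_le_iff of_nat_mult sum_constant mult.commute of_nat_id)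
  then have "fact j * (real (Suc j) * card (cliques V (Suc j))) \<le> fact j * (real (card V) * card (cliques V j))"
    by (intro mult_left_mono) auto
  then show ?thesis by (simp add: ordered_cliques_def algebra_simps)
qed

lemma ordered_cliques_le_diff:
  assumes "finite V"
  shows "ordered_cliques V (i + j) \<le> real (card V) ^ j * ordered_cliques V i"
proof (induction j)
  case (Suc j)
  have "ordered_cliques V (i + Suc j) \<le> real (card V) * ordered_cliques V (i + j)"
    using ordered_cliques_Suc_le[OF assms] by simp
  also have "\<dots> \<le> real (card V) * (real (card V) ^ j * ordered_cliques V i)"
    using Suc by (intro mult_left_mono) auto
  finally show ?case by simp
qed simp

lemma ordered_cliques_le: "finite V \<Longrightarrow> ordered_cliques V j \<le> real (card V) ^ j"
  using ordered_cliques_le_diff[of V 0 j] by (simp add: ordered_cliques_0)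

end

section \<open>Clique ratios, supersaturation and Zykov's bound\<close>

context adjacency begin

text \<open>
  Writing \<open>h\<^sub>i\<^sub>+\<^sub>1 = (1 - z\<^sub>i) n h\<^sub>i\<close> for the numbers \<open>h\<^sub>i\<close> of ordered \<open>i\<close>-cliques, the Moon-Moser inequality says
  that \<open>z\<^sub>i / i\<close> is nonincreasing; the Turan graph with \<open>q\<close> parts has \<open>z\<^sub>i = i / q\<close>.
\<close>
lemma clique_ratio_propagate:
  assumes V: "finite V" "0 < card V" and j: "1 \<le> j" "j \<le> i" "i \<le> q" and \<theta>: "0 \<le> \<theta>" "real q * \<theta> < 1"
    and pos: "0 < ordered_cliques V j"
    and ratio: "real (card V) * (1 - real j * \<theta>) * ordered_cliques V j \<le> ordered_cliques V (Suc j)"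
  shows "0 < ordered_cliques V i \<and>
    real (card V) * (1 - real i * \<theta>) * ordered_cliques V i \<le> ordered_cliques V (Suc i)"
  using j(2,3)
proof (induction i rule: dec_induct)
  case base
  then show ?case using pos ratio by simp
next
  case (step i)
  let ?d = "real (card V)" and ?h = "ordered_cliques V"
  have IH: "0 < ?h i" "?d * (1 - real i * \<theta>) * ?h i \<le> ?h (Suc i)" using step by auto
  have i: "1 \<le> i" using step j by simp
  have "real i * \<theta> \<le> real q * \<theta>" using step \<theta> by (intro mult_right_mono) auto
  then have "0 < ?d * (1 - real i * \<theta>) * ?h i" using IH V \<theta> by simp
  then have pos': "0 < ?h (Suc i)" using IH by linarith
  have "real (Suc i) * ?h (Suc i) * (?d * (1 - real i * \<theta>) * ?h i) \<le> real (Suc i) * ?h (Suc i) * ?h (Suc i)"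
    using IH pos' by (intro mult_left_mono) auto
  also have "\<dots> \<le> ?h i * (?d * ?h (Suc i) + real i * ?h (Suc (Suc i)))"
    using moon_moser[OF V(1), of i] by (simp add: power2_eq_square algebra_simps)
  finally have "?h i * (real (Suc i) * ?h (Suc i) * (?d * (1 - real i * \<theta>)))
      \<le> ?h i * (?d * ?h (Suc i) + real i * ?h (Suc (Suc i)))" by (simp add: algebra_simps)
  then have "real (Suc i) * ?h (Suc i) * (?d * (1 - real i * \<theta>)) \<le> ?d * ?h (Suc i) + real i * ?h (Suc (Suc i))"
    using IH by simp
  then have "real i * (?d * (1 - real (Suc i) * \<theta>) * ?h (Suc i)) \<le> real i * ?h (Suc (Suc i))"
    by (simp add: algebra_simps)
  then show ?case using pos' i by simp
qed

text \<open>If every ratio of \<open>ordered_cliques V (Suc j)\<close> to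
  \<open>card V * ordered_cliques V j\<close> with \<open>1 \<le> j < s\<close> were at most
  \<open>1 - j / q + \<eta>\<close>, their product would contradict \<open>many\<close>. So one
  ratio is too large, and \<open>clique_ratio_propagate\<close> keeps all later ratios up to
  \<open>q\<close> away from 0, which leaves a positive fraction of the
  \<open>Suc q\<close>-tuples.\<close>

lemma supersaturation_explicit:
  assumes V: "finite V" and q: "1 \<le> q" "s \<le> Suc q"
    and \<eta>: "0 < \<eta>" "\<eta> \<le> 1" and \<epsilon>: "0 < \<epsilon>"
    and close: "(\<Prod>j<s. 1 - real j / real q + \<eta>) < (\<Prod>j<s. 1 - real j / real q) + \<epsilon>"
    and many: "((\<Prod>j<s. 1 - real j / real q) + \<epsilon>) * real (card V) ^ s \<le> ordered_cliques V s"
  shows "\<epsilon> * (\<eta> / real q) ^ Suc q * real (card V) ^ Suc q \<le> ordered_cliques V (Suc q)"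
proof (cases "card V = 0")
  case True
  then show ?thesis using ordered_cliques_nonneg by simp
next
  case False
  let ?d = "real (card V)" and ?h = "ordered_cliques V"
  have d: "0 < ?d" using False by simp
  have fnn: "0 \<le> 1 - real j / real q" if "j < s" for j using that q by (simp add: field_simps)
  have "\<exists>j. 1 \<le> j \<and> j < s \<and> (1 - real j / real q + \<eta>) * ?d * ?h j < ?h (Suc j)"
  proof (rule ccontr)
    assume "\<not> ?thesis"
    then have no: "?h (Suc j) \<le> (1 - real j / real q + \<eta>) * ?d * ?h j" if "1 \<le> j" "j < s" for j
      using that by (meson not_le)
    have "?h m \<le> (\<Prod>j<m. 1 - real j / real q + \<eta>) * ?d ^ m" if "m \<le> s" for m
      using that
    proof (induction m)
      case 0
      then show ?case by (simp add: ordered_cliques_0)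
    next
      case (Suc m)
      have "?h (Suc m) \<le> (1 - real m / real q + \<eta>) * ?d * ?h m"
      proof (cases "m = 0")
        case True
        have "?h (Suc 0) \<le> ?d" using ordered_cliques_le[OF V, of "Suc 0"] by simp
        also have "\<dots> \<le> (1 + \<eta>) * ?d" using \<eta> d by simp
        finally show ?thesis using True by (simp add: ordered_cliques_0)
      qed (use no Suc in auto)
      also have "\<dots> \<le> (1 - real m / real q + \<eta>) * ?d * ((\<Prod>j<m. 1 - real j / real q + \<eta>) * ?d ^ m)"
        using Suc fnn[of m] \<eta> by (intro mult_left_mono mult_nonneg_nonneg) auto
      finally show ?case by (simp add: algebra_simps)
    qed
    from this[of s] have "?h s \<le> (\<Prod>j<s. 1 - real j / real q + \<eta>) * ?d ^ s" by simp
    also have "\<dots> < ((\<Prod>j<s. 1 - real j / real q) + \<epsilon>) * ?d ^ s"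
      using close d by (intro mult_strict_right_mono) auto
    finally show False using many by simp
  qed
  then obtain j where j: "1 \<le> j" "j < s" "(1 - real j / real q + \<eta>) * ?d * ?h j < ?h (Suc j)" by auto
  \<comment> \<open>Since \<open>?h s\<close> is at most \<open>?d ^ (s - j) * ?h j\<close>, the
    \<open>j\<close>-cliques already have density at least \<open>\<epsilon>\<close>.\<close>
  have "\<epsilon> * ?d ^ s \<le> ((\<Prod>j<s. 1 - real j / real q) + \<epsilon>) * ?d ^ s"
    using fnn by (intro mult_right_mono) (auto intro!: prod_nonneg)
  also have "\<dots> \<le> ?d ^ (s - j) * ?h j"
    using many ordered_cliques_le_diff[OF V, of j "s - j"] j by simp
  finally have "?d ^ (s - j) * (\<epsilon> * ?d ^ j) \<le> ?d ^ (s - j) * ?h j"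
    using j by (simp add: mult.left_commute flip: power_add)
  then have hj: "\<epsilon> * ?d ^ j \<le> ?h j" using d by simp
  then have hjpos: "0 < ?h j" using \<epsilon> d by (meson less_le_trans mult_pos_pos zero_less_power)
  \<comment> \<open>This gives \<open>q * \<theta> = 1 - \<eta> < 1\<close>, as the propagation
    requires, while \<open>1 - j * \<theta>\<close> stays below the excessive ratio. All ratios with
    \<open>1 \<le> i \<le> q\<close> are then at least \<open>\<eta> / q\<close>.\<close>
  define \<theta> where "\<theta> = (1 - \<eta>) / real q"
  have \<theta>: "0 \<le> \<theta>" "real q * \<theta> < 1" using \<eta> q by (auto simp: \<theta>_def)
  have jq: "j \<le> q" using j q by simp
  have "1 - real j * \<theta> = 1 - real j / real q + \<eta> * (real j / real q)" by (simp add: \<theta>_def algebra_simps diff_divide_distrib)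
  also have "\<dots> \<le> 1 - real j / real q + \<eta>"
    using jq q mult_left_mono[of "real j / real q" 1 \<eta>] \<eta> by (simp add: field_simps)
  finally have "?d * (1 - real j * \<theta>) * ?h j \<le> (1 - real j / real q + \<eta>) * ?d * ?h j"
    using d hjpos by (simp add: mult.commute)
  then have ratio: "?d * (1 - real j * \<theta>) * ?h j \<le> ?h (Suc j)" using j by simp
  note ratios = clique_ratio_propagate[OF V _ j(1) _ _ \<theta> hjpos ratio]
  have grow: "(\<eta> / real q * ?d) ^ (i - j) * ?h j \<le> ?h i" if "j \<le> i" "i \<le> Suc q" for i
    using that
  proof (induction i rule: dec_induct)
    case (step i)
    have i: "0 < ?h i" "?d * (1 - real i * \<theta>) * ?h i \<le> ?h (Suc i)" using ratios[of i] step d by auto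
    have "real i / real q \<le> 1" using step q by simp
    moreover have "\<eta> * (1 / real q) \<le> \<eta> * (real i / real q)"
      using step j \<eta> q by (intro mult_left_mono divide_right_mono) auto
    ultimately have "\<eta> / real q \<le> 1 - real i * \<theta>" by (simp add: \<theta>_def algebra_simps diff_divide_distrib)
    then have "\<eta> / real q * (?d * ?h i) \<le> (1 - real i * \<theta>) * (?d * ?h i)"
      using d i by (intro mult_right_mono) auto
    then have "\<eta> / real q * ?d * ?h i \<le> ?d * (1 - real i * \<theta>) * ?h i" by (simp only: mult_ac)
    with i have *: "\<eta> / real q * ?d * ?h i \<le> ?h (Suc i)" by linarith
    have "(\<eta> / real q * ?d) * ((\<eta> / real q * ?d) ^ (i - j) * ?h j) \<le> (\<eta> / real q * ?d) * ?h i"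
      using step \<eta> by (intro mult_left_mono) auto
    with * show ?case using step by (simp add: Suc_diff_le mult.assoc)
  qed simp
  \<comment> \<open>The index \<open>j\<close> depends on the graph; enlarging the exponent
    \<open>Suc q - j\<close> to \<open>Suc q\<close> makes the constant independent of it.\<close>
  have "(\<eta> / real q) ^ Suc q \<le> (\<eta> / real q) ^ (Suc q - j)"
    using \<eta> q by (intro power_decreasing) auto
  then have "\<epsilon> * (\<eta> / real q) ^ Suc q * ?d ^ Suc q \<le> \<epsilon> * (\<eta> / real q) ^ (Suc q - j) * ?d ^ Suc q"
    using \<epsilon> by (intro mult_right_mono mult_left_mono) auto
  also have "\<dots> = (\<eta> / real q * ?d) ^ (Suc q - j) * (\<epsilon> * ?d ^ j)"
  proof -
    have "?d ^ Suc q = ?d ^ (Suc q - j) * ?d ^ j" using jq by (simp flip: power_add)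
    then show ?thesis by (simp only: power_mult_distrib mult_ac)
  qed
  also have "\<dots> \<le> (\<eta> / real q * ?d) ^ (Suc q - j) * ?h j"
    using hj \<eta> by (intro mult_left_mono) auto
  also have "\<dots> \<le> ?h (Suc q)" using grow[of "Suc q"] jq by simp
  finally show ?thesis .
qed

end

text \<open>The gain is uniformity: \<open>\<delta>\<close> is fixed before the graph. By continuity
  of the product at \<open>\<eta> = 0\<close>, some \<open>\<eta>\<close> meets the hypothesis
  \<open>close\<close> of the explicit version.\<close>

lemma supersaturation:
  assumes "1 \<le> q" "s \<le> Suc q" "0 < \<epsilon>"
  shows "\<exists>\<delta>>0. \<forall>(E :: 'a \<Rightarrow> 'a \<Rightarrow> bool) V. adjacency E \<longrightarrow> finite V \<longrightarrow>
    ((\<Prod>j<s. 1 - real j / real q) + \<epsilon>) * real (card V) ^ s \<le> adjacency.ordered_cliques E V s \<longrightarrow>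
    \<delta> * real (card V) ^ Suc q \<le> adjacency.ordered_cliques E V (Suc q)"
proof -
  have "((\<lambda>\<eta>. \<Prod>j<s. 1 - real j / real q + \<eta>) \<longlongrightarrow> (\<Prod>j<s. 1 - real j / real q + 0)) (at_right 0)"
    by (intro tendsto_intros)
  then have "\<forall>\<^sub>F \<eta> in at_right 0. (\<Prod>j<s. 1 - real j / real q + \<eta>) < (\<Prod>j<s. 1 - real j / real q) + \<epsilon>"
    using assms by (intro order_tendstoD) auto
  then obtain b where b: "b > 0" "\<And>\<eta>. 0 < \<eta> \<Longrightarrow> \<eta> < b \<Longrightarrow>
      (\<Prod>j<s. 1 - real j / real q + \<eta>) < (\<Prod>j<s. 1 - real j / real q) + \<epsilon>"
    unfolding eventually_at_right_field by auto
  define \<eta> where "\<eta> = min 1 (b / 2)"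
  have \<eta>: "0 < \<eta>" "\<eta> \<le> 1" "\<eta> < b" using b(1) by (auto simp: \<eta>_def)
  show ?thesis
  proof (intro exI[of _ "\<epsilon> * (\<eta> / real q) ^ Suc q"] conjI allI impI)
    show "0 < \<epsilon> * (\<eta> / real q) ^ Suc q" using assms \<eta> by simp
  qed (rule adjacency.supersaturation_explicit[OF _ _ assms(1,2) \<eta>(1,2) assms(3) b(2)[OF \<eta>(1,3)]])
qed

text \<open>Zykov's theorem in density form, without an error term: any excess of a single graph
  over the bound is a positive \<open>\<epsilon>\<close> for which supersaturation would force
  \<open>Suc q\<close>-cliques.\<close>

lemma zykov:
  assumes "adjacency E" "finite V" "1 \<le> q" "s \<le> Suc q" "adjacency.cliques E V (Suc q) = {}"
  shows "adjacency.ordered_cliques E V s \<le> (\<Prod>j<s. 1 - real j / real q) * real (card V) ^ s"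
proof (rule ccontr)
  interpret adjacency E by fact
  let ?p = "\<Prod>j<s. 1 - real j / real q"
  assume "\<not> ?thesis"
  then have gt: "ordered_cliques V s > ?p * real (card V) ^ s" by simp
  show False
  proof (cases "card V = 0")
    case True
    then have "V = {}" using assms by simp
    then show False using gt ordered_cliques_le[OF assms(2), of s] by (cases s) (auto simp: ordered_cliques_0)
  next
    case False
    define \<epsilon> where "\<epsilon> = ordered_cliques V s / real (card V) ^ s - ?p"
    have "\<epsilon> > 0" using gt False by (simp add: \<epsilon>_def field_simps)
    from supersaturation[OF assms(3,4) this] obtain \<delta> where "\<delta> > 0"
      "(?p + \<epsilon>) * real (card V) ^ s \<le> ordered_cliques V s \<longrightarrow> \<delta> * real (card V) ^ Suc q \<le> ordered_cliques V (Suc q)"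
      using assms by blast
    moreover have "(?p + \<epsilon>) * real (card V) ^ s \<le> ordered_cliques V s" using False by (simp add: \<epsilon>_def)
    moreover have "ordered_cliques V (Suc q) = 0" using assms by (simp add: ordered_cliques_def)
    ultimately have "\<delta> * real (card V) ^ Suc q \<le> 0" by simp
    moreover have "0 < \<delta> * real (card V) ^ Suc q" using \<open>\<delta> > 0\<close> False by (intro mult_pos_pos zero_less_power) auto
    ultimately show False by simp
  qed
qed

section \<open>Complete multipartite subgraphs\<close>

lemma card_subsets_le_power:
  assumes "finite V"
  shows "card {e. e \<subseteq> V \<and> card e = k} \<le> card V ^ k"
  using n_subsets[OF assms, of k] 
  by (cases "k \<le> card V") (auto simp: binomial_le_pow binomial_eq_0)

text \<open>
  A weak form of Erdos's theorem on complete \<open>k\<close>-partite \<open>k\<close>-graphs. A bounded number \<open>M\<close> of vertices of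
  high degree is enough: by pigeonhole over the \<open>2\<^sup>M\<close> traces, some \<open>t\<close> of them have a dense common link.
\<close>
lemma dense_contains_multipartite:
  assumes "0 < \<delta>"
  shows "\<exists>n0. \<forall>(V :: 'a set) H. finite V \<longrightarrow> n0 \<le> card V \<longrightarrow> (\<forall>e\<in>H. e \<subseteq> V \<and> card e = k) \<longrightarrow>
     \<delta> * real (card V) ^ k \<le> real (card H) \<longrightarrow>
     (\<exists>A. (\<forall>i<k. A i \<subseteq> \<Union>H \<and> card (A i) = t) \<and>
       (\<forall>i<k. \<forall>j<k. i \<noteq> j \<longrightarrow> (\<forall>x\<in>A i. \<forall>y\<in>A j. x \<noteq> y \<and> (\<exists>h\<in>H. x \<in> h \<and> y \<in> h))))"
  using assms
proof (induction k arbitrary: \<delta>)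
  case 0
  then show ?case by simp
next
  case (Suc k)
  \<comment> \<open>With \<open>M \<ge> 4 * t / \<delta>\<close>, the \<open>k\<close>-sets having
    fewer than \<open>t\<close> extensions into \<open>X\<close> take up at most half of the
    guaranteed incidences. The other half yields a fraction \<open>\<delta> / 4\<close> of
    \<open>k\<close>-sets in \<open>P\<close>, and \<open>\<delta>'\<close> is the share of one of
    the \<open>2 ^ M\<close> traces.\<close>
  define M where "M = nat \<lceil>4 * real t / \<delta>\<rceil> + 1"
  have M: "4 * real t / \<delta> \<le> real M" "0 < M" unfolding M_def by linarith+
  have tM: "real t \<le> \<delta> * real M / 4" using M Suc.prems by (simp add: field_simps)
  define \<delta>' where "\<delta>' = \<delta> / 4 / 2 ^ M"
  have \<delta>': "0 < \<delta>'" using Suc.prems by (simp add: \<delta>'_def)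
  from Suc.IH[OF this] obtain n1 where n1: "\<forall>(V :: 'a set) H. finite V \<longrightarrow> n1 \<le> card V \<longrightarrow>
     (\<forall>e\<in>H. e \<subseteq> V \<and> card e = k) \<longrightarrow> \<delta>' * real (card V) ^ k \<le> real (card H) \<longrightarrow>
     (\<exists>A. (\<forall>i<k. A i \<subseteq> \<Union>H \<and> card (A i) = t) \<and>
       (\<forall>i<k. \<forall>j<k. i \<noteq> j \<longrightarrow> (\<forall>x\<in>A i. \<forall>y\<in>A j. x \<noteq> y \<and> (\<exists>h\<in>H. x \<in> h \<and> y \<in> h))))"
    ..
  \<comment> \<open>The second bound ensures that \<open>B\<close> has at least \<open>M\<close>
    vertices; \<open>Suc n1\<close> also makes \<open>V\<close> nonempty.\<close>
  define n0 where "n0 = max (Suc n1) (nat \<lceil>2 * real M / \<delta>\<rceil>)"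
  have "\<exists>A. (\<forall>i<Suc k. A i \<subseteq> \<Union>H \<and> card (A i) = t) \<and>
       (\<forall>i<Suc k. \<forall>j<Suc k. i \<noteq> j \<longrightarrow> (\<forall>x\<in>A i. \<forall>y\<in>A j. x \<noteq> y \<and> (\<exists>h\<in>H. x \<in> h \<and> y \<in> h)))"
    if V: "finite V" "n0 \<le> card V" and H: "\<forall>e\<in>H. e \<subseteq> V \<and> card e = Suc k"
      and many: "\<delta> * real (card V) ^ Suc k \<le> real (card H)" for V :: "'a set" and H
  proof -
    let ?n = "real (card V)"
    have n: "0 < ?n" "n1 \<le> card V" "2 * real M / \<delta> \<le> ?n"
      using V unfolding n0_def by linarith+
    have finH: "finite H" by (rule finite_subset[of _ "Pow V"]) (use H V in auto)
    define Y where "Y = {y. y \<subseteq> V \<and> card y = k}"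
    have finY: "finite Y" using V by (simp add: Y_def)
    have cardY: "real (card Y) \<le> ?n ^ k"
      using card_subsets_le_power[OF V(1), of k] unfolding Y_def by (metis of_nat_le_iff of_nat_power)
    define L where "L x = {y \<in> Y. x \<notin> y \<and> insert x y \<in> H}" for x
    have finL: "finite (L x)" for x using finY by (simp add: L_def)
    have "card {e\<in>H. x \<in> e} = card (L x)" for x
    proof (rule bij_betw_same_card[of "\<lambda>e. e - {x}"], rule bij_betw_byWitness[where f' = "insert x"])
      show "(\<lambda>e. e - {x}) ` {e \<in> H. x \<in> e} \<subseteq> L x"
        using H by (auto simp: L_def Y_def insert_absorb)
      show "insert x ` L x \<subseteq> {e \<in> H. x \<in> e}" by (auto simp: L_def)
      show "\<forall>e\<in>{e \<in> H. x \<in> e}. insert x (e - {x}) = e" by auto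
      show "\<forall>y\<in>L x. insert x y - {x} = y" by (auto simp: L_def)
    qed
    then have "(\<Sum>x\<in>V. card (L x)) = (\<Sum>x\<in>V. card {e\<in>H. x \<in> e})" by simp
    also have "\<dots> = Suc k * card H"
    proof (rule sum_multicount[OF V(1) finH])
      show "\<forall>e\<in>H. card {x \<in> V. x \<in> e} = Suc k"
      proof
        fix e assume "e \<in> H"
        then have "{x \<in> V. x \<in> e} = e" using H by auto
        then show "card {x \<in> V. x \<in> e} = Suc k" using H \<open>e \<in> H\<close> by simp
      qed
    qed
    finally have "real (\<Sum>x\<in>V. card (L x)) \<ge> real (card H)" by simp
    then have sumL: "\<delta> * ?n ^ Suc k \<le> (\<Sum>x\<in>V. real (card (L x)))" using many by simp
    have L_le: "real (card (L x)) \<le> ?n ^ k" for x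
      using card_mono[OF finY, of "L x"] cardY by (force simp: L_def)
    define B where "B = {x \<in> V. \<delta> / 2 * ?n ^ k \<le> real (card (L x))}"
    have "(\<Sum>x\<in>V. real (card (L x))) \<le> (\<Sum>x\<in>V. \<delta> / 2 * ?n ^ k + ?n ^ k * of_bool (x \<in> B))"
      using L_le Suc.prems by (intro sum_mono) (auto simp: B_def add_increasing)
    also have "\<dots> = ?n * (\<delta> / 2 * ?n ^ k) + ?n ^ k * card B"
      using V by (simp add: sum.distrib sum_distrib_left[symmetric])
        (simp add: of_bool_def sum.If_cases B_def Int_def)
    finally have "?n ^ k * (\<delta> / 2 * ?n) \<le> ?n ^ k * card B" using sumL by (simp add: field_simps)
    then have "\<delta> / 2 * ?n \<le> card B" using n by simp
    moreover have "real M \<le> \<delta> / 2 * ?n" using n Suc.prems by (simp add: field_simps)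
    ultimately have "M \<le> card B" by linarith
    then obtain X where X: "X \<subseteq> B" "card X = M" "finite X" by (rule obtain_subset_with_card_n)
    have XV: "X \<subseteq> V" using X by (auto simp: B_def)
    define tr where "tr y = {x \<in> X. x \<notin> y \<and> insert x y \<in> H}" for y
    have tr_le: "card (tr y) \<le> M" for y using X card_mono[of X "tr y"] by (auto simp: tr_def)
    have "real M * (\<delta> / 2 * ?n ^ k) = (\<Sum>x\<in>X. \<delta> / 2 * ?n ^ k)" using X by simp
    also have "\<dots> \<le> (\<Sum>x\<in>X. real (card (L x)))" using X by (intro sum_mono) (auto simp: B_def)
    also have "\<dots> = (\<Sum>x\<in>X. \<Sum>y\<in>Y. of_bool (x \<notin> y \<and> insert x y \<in> H))"
      using finY by (simp add: L_def of_bool_def sum.If_cases Int_def)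
    also have "\<dots> = (\<Sum>y\<in>Y. \<Sum>x\<in>X. of_bool (x \<notin> y \<and> insert x y \<in> H))" by (rule sum.swap)
    also have "\<dots> = (\<Sum>y\<in>Y. real (card (tr y)))"
      using X by (simp add: tr_def of_bool_def sum.If_cases Int_def)
    finally have 1: "real M * (\<delta> / 2 * ?n ^ k) \<le> (\<Sum>y\<in>Y. real (card (tr y)))" .
    define P where "P = {y \<in> Y. t \<le> card (tr y)}"
    have finP: "finite P" using finY by (simp add: P_def)
    have "(\<Sum>y\<in>Y. real (card (tr y))) \<le> (\<Sum>y\<in>Y. real t + real M * of_bool (y \<in> P))"
      using tr_le by (intro sum_mono) (auto simp: P_def add_increasing)
    also have "\<dots> = card Y * real t + real M * card P"
      using finY by (simp add: sum.distrib sum_distrib_left[symmetric])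
        (simp add: of_bool_def sum.If_cases P_def Int_def)
    also have "\<dots> \<le> ?n ^ k * (\<delta> * real M / 4) + real M * card P"
      using cardY tM by (intro add_mono mult_mono) auto
    finally have "real M * (\<delta> / 4 * ?n ^ k) \<le> real M * card P" using 1 by (simp add: field_simps)
    then have cardP: "\<delta> / 4 * ?n ^ k \<le> card P" using M by simp
    have "\<exists>Z\<in>Pow X. \<delta>' * ?n ^ k \<le> card {y\<in>P. tr y = Z}"
    proof (rule ccontr)
      assume "\<not> ?thesis"
      then have less: "\<And>Z. Z \<in> Pow X \<Longrightarrow> real (card {y\<in>P. tr y = Z}) < \<delta>' * ?n ^ k"
        by (simp add: not_le)
      have "tr y \<in> Pow X" for y by (auto simp: tr_def)
      then have "P = (\<Union>Z\<in>Pow X. {y\<in>P. tr y = Z})" by blast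
      then have "card P \<le> (\<Sum>Z\<in>Pow X. card {y\<in>P. tr y = Z})"
        using card_UN_le[of "Pow X" "\<lambda>Z. {y\<in>P. tr y = Z}"] X(3) by (metis finite_Pow_iff)
      then have "real (card P) \<le> real (\<Sum>Z\<in>Pow X. card {y\<in>P. tr y = Z})"
        by (simp only: of_nat_le_iff)
      also have "\<dots> = (\<Sum>Z\<in>Pow X. real (card {y\<in>P. tr y = Z}))" by (rule of_nat_sum)
      also have "\<dots> < (\<Sum>Z\<in>Pow X. \<delta>' * ?n ^ k)" using less X by (intro sum_strict_mono) auto
      also have "\<dots> = \<delta> / 4 * ?n ^ k" using X by (simp add: card_Pow \<delta>'_def)
      finally show False using cardP by simp
    qed
    then obtain Z where Z: "Z \<subseteq> X" "\<delta>' * ?n ^ k \<le> card {y\<in>P. tr y = Z}" by auto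
    define H' where "H' = {y\<in>P. tr y = Z}"
    have "0 < \<delta>' * ?n ^ k" using \<delta>' n by simp
    then have "0 < card H'" using Z by (simp add: H'_def)
    then obtain y0 where y0: "y0 \<in> H'" by (metis card.empty ex_in_conv less_irrefl)
    then have "t \<le> card Z" by (auto simp: H'_def P_def)
    then obtain S where S: "S \<subseteq> Z" "card S = t" "finite S"
      by (rule obtain_subset_with_card_n)
    have ext: "x \<notin> y \<and> insert x y \<in> H" if "x \<in> S" "y \<in> H'" for x y
      using that S by (auto simp: H'_def tr_def)
    have "\<forall>e\<in>H'. e \<subseteq> V \<and> card e = k" by (auto simp: H'_def P_def Y_def)
    from n1[THEN spec, THEN spec, THEN mp, THEN mp, THEN mp, THEN mp, OF V(1) n(2) this Z(2)[folded H'_def]]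
    obtain A where A: "\<forall>i<k. A i \<subseteq> \<Union>H' \<and> card (A i) = t"
      "\<forall>i<k. \<forall>j<k. i \<noteq> j \<longrightarrow> (\<forall>x\<in>A i. \<forall>y\<in>A j. x \<noteq> y \<and> (\<exists>h\<in>H'. x \<in> h \<and> y \<in> h))"
      by (elim exE conjE)
    show ?thesis
    proof (cases "S = {}")
      case True
      then have "t = 0" using S by simp
      then show ?thesis by (intro exI[of _ "\<lambda>_. {}"]) simp
    next
      case False
      \<comment> \<open>Inserting \<open>s0\<close> into a member of \<open>H'\<close> gives a
        hyperedge of \<open>H\<close>, so pairs covered by \<open>H'\<close> are covered by
        \<open>H\<close>.\<close>
      then obtain s0 where s0: "s0 \<in> S" by auto
      define A' where "A' i = (if i = k then S else A i)" for i
      have sub: "A' i \<subseteq> \<Union>H" "card (A' i) = t" if "i < Suc k" for i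
      proof -
        show "card (A' i) = t" using that A S by (auto simp: A'_def)
        show "A' i \<subseteq> \<Union>H"
        proof
          fix x assume x: "x \<in> A' i"
          show "x \<in> \<Union>H"
          proof (cases "i = k")
            case True
            then show ?thesis using x ext[of x y0] y0 by (auto simp: A'_def)
          next
            case False
            then have "i < k" "x \<in> A i" using x that by (auto simp: A'_def)
            then have "x \<in> \<Union>H'" using A(1) by blast
            then show ?thesis using ext[OF s0] by auto
          qed
        qed
      qed
      have mix: "x \<noteq> y \<and> (\<exists>h\<in>H. x \<in> h \<and> y \<in> h)" if "x \<in> S" "i < k" "y \<in> A i" for x y i
      proof -
        have "y \<in> \<Union>H'" using A(1) that by blast
        then show ?thesis using ext[OF that(1)] by auto
      qed
      have AA: "x \<noteq> y \<and> (\<exists>h\<in>H. x \<in> h \<and> y \<in> h)" if "i < k" "j < k" "i \<noteq> j" "x \<in> A i" "y \<in> A j" for x y i j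
      proof -
        from A(2)[rule_format, OF that] obtain h where "x \<noteq> y" "h \<in> H'" "x \<in> h" "y \<in> h" by (elim conjE bexE)
        then show ?thesis using ext[OF s0, of h] by auto
      qed
      have "x \<noteq> y \<and> (\<exists>h\<in>H. x \<in> h \<and> y \<in> h)"
        if "i < Suc k" "j < Suc k" "i \<noteq> j" "x \<in> A' i" "y \<in> A' j" for x y i j
      proof -
        have "i = k \<and> j < k \<or> j = k \<and> i < k \<or> i < k \<and> j < k" using that(1-3) by linarith
        then consider "i = k" "j < k" | "j = k" "i < k" | "i < k" "j < k" by blast
        then show ?thesis
        proof cases
          case 1 then show ?thesis using mix[of x j y] that by (auto simp: A'_def)
        next
          case 2 then show ?thesis using mix[of y i x] that by (auto simp: A'_def)
        next
          case 3 then show ?thesis using AA[of i j x y] that by (auto simp: A'_def)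
        qed
      qed
      then show ?thesis using sub by (intro exI[of _ A'] conjI allI impI ballI) simp_all
    qed
  qed
  then show ?case by (intro exI[of _ n0] allI impI)
qed

text \<open>Edges inside a part are allowed, and distinct parts are disjoint because
  \<open>E\<close> is irreflexive.\<close>

definition (in adjacency) multipartite :: "'a set \<Rightarrow> nat \<Rightarrow> nat \<Rightarrow> (nat \<Rightarrow> 'a set) \<Rightarrow> bool" where
  "multipartite V k t A \<longleftrightarrow> (\<forall>i<k. A i \<subseteq> V \<and> finite (A i) \<and> card (A i) = t) \<and>
     (\<forall>i<k. \<forall>j<k. i \<noteq> j \<longrightarrow> (\<forall>x\<in>A i. \<forall>y\<in>A j. E x y))"

text \<open>The \<open>k\<close>-cliques of \<open>U\<close> form a \<open>k\<close>-uniform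
  hypergraph in which two vertices of a common hyperedge are adjacent. Density is measured in the
  larger set \<open>V\<close> because \<open>U\<close> will be a neighbourhood whose size is not
  controlled.\<close>

lemma many_cliques_multipartite:
  assumes "0 < \<delta>"
  shows "\<exists>n0. \<forall>(E :: 'a \<Rightarrow> 'a \<Rightarrow> bool) U V. adjacency E \<longrightarrow> finite V \<longrightarrow> U \<subseteq> V \<longrightarrow> n0 \<le> card V \<longrightarrow>
    \<delta> * real (card V) ^ k \<le> adjacency.ordered_cliques E U k \<longrightarrow> (\<exists>A. adjacency.multipartite E U k t A)"
proof -
  have "0 < \<delta> / fact k" using assms by simp
  from dense_contains_multipartite[OF this, of k t] obtain n0 where n0:
    "\<forall>(V :: 'a set) H. finite V \<longrightarrow> n0 \<le> card V \<longrightarrow> (\<forall>e\<in>H. e \<subseteq> V \<and> card e = k) \<longrightarrow>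
     \<delta> / fact k * real (card V) ^ k \<le> real (card H) \<longrightarrow>
     (\<exists>A. (\<forall>i<k. A i \<subseteq> \<Union>H \<and> card (A i) = t) \<and>
       (\<forall>i<k. \<forall>j<k. i \<noteq> j \<longrightarrow> (\<forall>x\<in>A i. \<forall>y\<in>A j. x \<noteq> y \<and> (\<exists>h\<in>H. x \<in> h \<and> y \<in> h))))"
    ..
  have "\<exists>A. adjacency.multipartite E U k t A"
    if E: "adjacency E" and V: "finite V" "U \<subseteq> V" "n0 \<le> card V"
      and many: "\<delta> * real (card V) ^ k \<le> adjacency.ordered_cliques E U k" for E :: "'a \<Rightarrow> 'a \<Rightarrow> bool" and U V
  proof -
    interpret adjacency E by fact
    have "\<delta> / fact k * real (card V) ^ k \<le> real (card (cliques U k))"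
      using many by (simp add: ordered_cliques_def field_simps)
    moreover have "\<forall>e\<in>cliques U k. e \<subseteq> V \<and> card e = k" using V by (auto simp: cliques_def)
    ultimately have "\<exists>A. (\<forall>i<k. A i \<subseteq> \<Union>(cliques U k) \<and> card (A i) = t) \<and>
       (\<forall>i<k. \<forall>j<k. i \<noteq> j \<longrightarrow> (\<forall>x\<in>A i. \<forall>y\<in>A j. x \<noteq> y \<and> (\<exists>h\<in>cliques U k. x \<in> h \<and> y \<in> h)))"
      using n0[THEN spec, THEN spec, THEN mp, THEN mp, THEN mp, THEN mp, OF V(1,3)] by blast
    then obtain A where A: "\<forall>i<k. A i \<subseteq> \<Union>(cliques U k) \<and> card (A i) = t"
       "\<forall>i<k. \<forall>j<k. i \<noteq> j \<longrightarrow> (\<forall>x\<in>A i. \<forall>y\<in>A j. x \<noteq> y \<and> (\<exists>h\<in>cliques U k. x \<in> h \<and> y \<in> h))"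
      by blast
    have sub: "\<Union>(cliques U k) \<subseteq> U" by (auto simp: cliques_def)
    have "E x y" if "i < k" "j < k" "i \<noteq> j" "x \<in> A i" "y \<in> A j" for i j x y
    proof -
      from A(2) that have "x \<noteq> y \<and> (\<exists>h\<in>cliques U k. x \<in> h \<and> y \<in> h)" by blast
      then show ?thesis by (auto simp: cliques_def)
    qed
    moreover have "A i \<subseteq> U \<and> finite (A i) \<and> card (A i) = t" if "i < k" for i
      using A(1) that sub V finite_subset by (metis subset_trans)
    ultimately show ?thesis by (intro exI[of _ A]) (auto simp: multipartite_def)
  qed
  then show ?thesis by blast
qed

text \<open>An excess over the bound forces \<open>card U\<close> to be at least
  \<open>\<epsilon> * card V\<close>; supersaturation inside \<open>U\<close> then gives a positive
  fraction of the \<open>Suc q\<close>-tuples of \<open>V\<close>. For smaller \<open>U\<close> the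
  error term, which is relative to \<open>V\<close>, already covers the count.\<close>

lemma generalized_turan_multipartite:
  assumes "1 \<le> q" "1 \<le> s" "s \<le> Suc q" "0 < \<epsilon>"
  shows "\<exists>n0. \<forall>(E :: 'a \<Rightarrow> 'a \<Rightarrow> bool) U V. adjacency E \<longrightarrow> finite V \<longrightarrow> U \<subseteq> V \<longrightarrow> n0 \<le> card V \<longrightarrow>
    (\<nexists>A. adjacency.multipartite E U (Suc q) t A) \<longrightarrow>
    adjacency.ordered_cliques E U s \<le> (\<Prod>j<s. 1 - real j / real q) * real (card U) ^ s + \<epsilon> * real (card V) ^ s"
proof -
  let ?p = "\<Prod>j<s. 1 - real j / real q"
  have p: "0 \<le> ?p" using assms by (intro prod_nonneg) (auto simp: field_simps)
  obtain \<delta> where \<delta>: "\<delta> > 0" "\<And>(E :: 'a \<Rightarrow> 'a \<Rightarrow> bool) V. adjacency E \<Longrightarrow> finite V \<Longrightarrow>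
    (?p + \<epsilon>) * real (card V) ^ s \<le> adjacency.ordered_cliques E V s \<Longrightarrow>
    \<delta> * real (card V) ^ Suc q \<le> adjacency.ordered_cliques E V (Suc q)"
    using supersaturation[OF assms(1,3,4)] by metis
  have "0 < \<delta> * \<epsilon> ^ Suc q" using \<delta> assms by simp
  from many_cliques_multipartite[OF this, of "Suc q" t] obtain n0 where n0:
    "\<forall>(E :: 'a \<Rightarrow> 'a \<Rightarrow> bool) U V. adjacency E \<longrightarrow> finite V \<longrightarrow> U \<subseteq> V \<longrightarrow> n0 \<le> card V \<longrightarrow>
    \<delta> * \<epsilon> ^ Suc q * real (card V) ^ Suc q \<le> adjacency.ordered_cliques E U (Suc q) \<longrightarrow> (\<exists>A. adjacency.multipartite E U (Suc q) t A)"
    ..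
  have "adjacency.ordered_cliques E U s \<le> ?p * real (card U) ^ s + \<epsilon> * real (card V) ^ s"
    if E: "adjacency E" and V: "finite V" "U \<subseteq> V" "Suc n0 \<le> card V"
      and no: "\<nexists>A. adjacency.multipartite E U (Suc q) t A" for E :: "'a \<Rightarrow> 'a \<Rightarrow> bool" and U V
  proof (rule ccontr)
    interpret adjacency E by fact
    let ?n = "real (card V)" and ?d = "real (card U)"
    assume "\<not> ?thesis"
    then have gt: "?p * ?d ^ s + \<epsilon> * ?n ^ s < ordered_cliques U s" by simp
    have finU: "finite U" using V finite_subset by blast
    have dn: "?d \<le> ?n" using card_mono V by simp
    have n: "0 < ?n" using V by simp
    have "\<epsilon> * ?d ^ s \<le> \<epsilon> * ?n ^ s" using dn assms by (intro mult_left_mono power_mono) auto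
    then have "(?p + \<epsilon>) * ?d ^ s \<le> ordered_cliques U s" using gt by (simp add: algebra_simps)
    from \<delta>(2)[OF E finU this] have 1: "\<delta> * ?d ^ Suc q \<le> ordered_cliques U (Suc q)" .
    have "0 \<le> ?p * ?d ^ s" using p by simp
    then have "\<epsilon> * ?n ^ s \<le> ?d ^ s" using gt ordered_cliques_le[OF finU, of s] by linarith
    also have "\<dots> = ?d * ?d ^ (s - 1)" using assms by (metis power_eq_if not_one_le_zero)
    also have "\<dots> \<le> ?d * ?n ^ (s - 1)" using dn by (intro mult_left_mono power_mono) auto
    finally have "?n ^ (s - 1) * (\<epsilon> * ?n) \<le> ?n ^ (s - 1) * ?d"
      using assms by (metis (no_types) power_eq_if not_one_le_zero mult.assoc mult.commute)
    then have "\<epsilon> * ?n \<le> ?d" using n by simp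
    then have "(\<epsilon> * ?n) ^ Suc q \<le> ?d ^ Suc q" using assms n by (intro power_mono) auto
    then have "\<delta> * (\<epsilon> * ?n) ^ Suc q \<le> \<delta> * ?d ^ Suc q" using \<delta> by (intro mult_left_mono) auto
    then have "\<delta> * \<epsilon> ^ Suc q * ?n ^ Suc q \<le> ordered_cliques U (Suc q)"
      using 1 by (simp add: power_mult_distrib mult.assoc del: power_Suc)
    then show False using n0[rule_format, OF E V(1,2)] V no by (simp del: power_Suc)
  qed
  then show ?thesis by (intro exI[of _ "Suc n0"]) blast
qed

section \<open>Graphs without large cones\<close>

context adjacency begin

text \<open>No \<open>K(1,t,\<dots>,t)\<close> with \<open>k\<close> parts of size \<open>t\<close>.\<close>
definition cone_free :: "'a set \<Rightarrow> nat \<Rightarrow> nat \<Rightarrow> bool" where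
  "cone_free V k t \<longleftrightarrow> (\<forall>w\<in>V. \<nexists>A. multipartite (nbrs V w) k t A)"

lemma adjacent_commute: "E x y \<longleftrightarrow> E y x"
  using sym by blast

text \<open>The sets are chosen one index at a time: at most \<open>card J * t\<close> vertices have
  been chosen before, each of them excludes at most \<open>g\<close> candidates, and
  \<open>t\<close> candidates survive.\<close>

lemma greedy_multipartite:
  fixes W :: "nat \<Rightarrow> 'a set"
  assumes "finite J" "\<And>j. j \<in> J \<Longrightarrow> finite (W j)" "0 \<le> g"
    and miss: "\<And>i j x. i \<in> J \<Longrightarrow> j \<in> J \<Longrightarrow> i \<noteq> j \<Longrightarrow> x \<in> W i \<Longrightarrow> real (card {y \<in> W j. \<not> E x y}) \<le> g"
    and large: "\<And>j. j \<in> J \<Longrightarrow> real t + real (card J) * real t * g \<le> real (card (W j))"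
  shows "\<exists>S. (\<forall>j\<in>J. S j \<subseteq> W j \<and> card (S j) = t) \<and>
    (\<forall>i\<in>J. \<forall>j\<in>J. i \<noteq> j \<longrightarrow> (\<forall>x\<in>S i. \<forall>y\<in>S j. E x y))"
  using assms
proof (induction J rule: finite_induct)
  case empty
  then show ?case by simp
next
  case (insert j J)
  have "real t + real (card J) * real t * g \<le> real (card (W i))" if "i \<in> J" for i
  proof -
    have "real (card J) * real t * g \<le> real (card (insert j J)) * real t * g"
      using insert by (intro mult_right_mono) auto
    then show ?thesis using insert.prems(4)[of i] that by simp
  qed
  then have "\<exists>S. (\<forall>j\<in>J. S j \<subseteq> W j \<and> card (S j) = t) \<and>
    (\<forall>i\<in>J. \<forall>j\<in>J. i \<noteq> j \<longrightarrow> (\<forall>x\<in>S i. \<forall>y\<in>S j. E x y))"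
  proof (intro insert.IH)
    show "real (card {y \<in> W b. \<not> E x y}) \<le> g" if "a \<in> J" "b \<in> J" "a \<noteq> b" "x \<in> W a" for a b x
      using insert.prems(3)[of a b x] that by simp
  qed (use insert.prems(1,2) in auto)
  then obtain S where S: "\<forall>j\<in>J. S j \<subseteq> W j \<and> card (S j) = t"
      "\<forall>i\<in>J. \<forall>j\<in>J. i \<noteq> j \<longrightarrow> (\<forall>x\<in>S i. \<forall>y\<in>S j. E x y)" by (elim exE conjE)
  define X where "X = (\<Union>i\<in>J. S i)"
  have finS: "finite (S i)" if "i \<in> J" for i
    using S(1) that insert.prems(1)[of i] finite_subset by blast
  have finX: "finite X" using finS insert.hyps by (auto simp: X_def)
  have cX: "card X \<le> card J * t"
  proof -
    have "card X \<le> (\<Sum>i\<in>J. card (S i))" unfolding X_def by (rule card_UN_le[OF insert.hyps(1)])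
    also have "\<dots> = card J * t" using S(1) by simp
    finally show ?thesis .
  qed
  define Bad where "Bad = (\<Union>x\<in>X. {y \<in> W j. \<not> E x y})"
  have finW: "finite (W j)" using insert by simp
  have "real (card Bad) \<le> real (\<Sum>x\<in>X. card {y \<in> W j. \<not> E x y})"
    unfolding Bad_def of_nat_le_iff by (rule card_UN_le[OF finX])
  also have "\<dots> = (\<Sum>x\<in>X. real (card {y \<in> W j. \<not> E x y}))" by simp
  also have "\<dots> \<le> (\<Sum>x\<in>X. g)"
  proof (rule sum_mono)
    fix x assume "x \<in> X"
    then obtain i where i: "i \<in> J" "x \<in> S i" by (auto simp: X_def)
    then show "real (card {y \<in> W j. \<not> E x y}) \<le> g"
      using insert.hyps(2) S(1) by (intro insert.prems(3)[of i j]) auto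
  qed
  also have "\<dots> = real (card X) * g" by simp
  also have "\<dots> \<le> real (card J * t) * g"
    using insert.prems(2) by (intro mult_right_mono) (simp_all only: of_nat_le_iff cX)
  finally have Bad: "real (card Bad) \<le> real (card J) * real t * g" by simp
  have "0 \<le> real t * g" using insert.prems by simp
  then have "real t + real (card J) * real t * g \<le> real (card (W j))"
    using insert.prems(4)[of j] insert.hyps by (simp add: algebra_simps)
  moreover have "card (W j) - card Bad \<le> card (W j - Bad)"
    by (rule diff_card_le_card_Diff) (use finW in \<open>auto simp: Bad_def intro: finite_subset[OF _ finW]\<close>)
  ultimately have "t \<le> card (W j - Bad)" using Bad by linarith
  then obtain R where R: "R \<subseteq> W j - Bad" "card R = t" "finite R" by (rule obtain_subset_with_card_n)
  have new: "E x y" if "x \<in> S i" "i \<in> J" "y \<in> R" for x y i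
    using that R by (auto simp: Bad_def X_def)
  have ne: "i \<noteq> j" if "i \<in> J" for i using insert.hyps that by auto
  show ?case
  proof (intro exI[of _ "S(j := R)"] conjI ballI impI)
    fix i assume "i \<in> insert j J"
    then show "(S(j := R)) i \<subseteq> W i" "card ((S(j := R)) i) = t" using S(1) R by auto
  next
    fix a b x y
    assume "a \<in> insert j J" "b \<in> insert j J" "a \<noteq> b" "x \<in> (S(j := R)) a" "y \<in> (S(j := R)) b"
    then consider "a = j" "b \<in> J" "x \<in> R" "y \<in> S b" | "b = j" "a \<in> J" "y \<in> R" "x \<in> S a"
      | "a \<in> J" "b \<in> J" "a \<noteq> b" "x \<in> S a" "y \<in> S b"
      by (auto split: if_splits)
    then show "E x y"
    proof cases
      case 1 then show ?thesis using new sym by blast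
    next
      case 2 then show ?thesis using new by blast
    next
      case 3 then show ?thesis using S(2) by blast
    qed
  qed
qed

text \<open>The vertex \<open>w\<close> is an apex, and its neighbours \<open>L\<close> from its own
  part stand in for part \<open>i\<close>. This is what limits the number of neighbours inside one's
  own part or colour class.\<close>

lemma cone_free_star:
  assumes free: "cone_free V k t" and fin: "finite V" and i: "i < k"
    and w: "w \<in> V" and L: "L \<subseteq> nbrs V w" "card L = t"
    and S: "\<And>j. j < k \<Longrightarrow> j \<noteq> i \<Longrightarrow> S j \<subseteq> nbrs V w \<and> card (S j) = t \<and> (\<forall>x\<in>S j. \<forall>y\<in>L. E x y)"
    and SS: "\<And>a b x y. a < k \<Longrightarrow> b < k \<Longrightarrow> a \<noteq> i \<Longrightarrow> b \<noteq> i \<Longrightarrow> a \<noteq> b \<Longrightarrow> x \<in> S a \<Longrightarrow> y \<in> S b \<Longrightarrow> E x y"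
  shows False
proof -
  have finN: "finite (nbrs V w)" using fin by (simp add: nbrs_def)
  have "multipartite (nbrs V w) k t (S(i := L))"
    unfolding multipartite_def
  proof (intro conjI allI impI ballI)
    fix j assume j: "j < k"
    show "(S(i := L)) j \<subseteq> nbrs V w" "card ((S(i := L)) j) = t" using L S[OF j] by auto
    then show "finite ((S(i := L)) j)" using finN finite_subset by blast
  next
    fix a b x y assume "a < k" "b < k" "a \<noteq> b" "x \<in> (S(i := L)) a" "y \<in> (S(i := L)) b"
    then show "E x y"
      using S[of a] S[of b] SS[of a b x y] sym by (cases "a = i"; cases "b = i") auto
  qed
  then show False using free w by (auto simp: cone_free_def)
qed

lemma card_nonneighbours:
  assumes "finite V" "U \<subseteq> V"
  shows "card {y \<in> U. \<not> E x y} + card {y \<in> U. E x y} = card U"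
proof -
  have "finite U" using assms finite_subset by blast
  then show ?thesis
    by (subst card_Un_disjoint[symmetric]) (auto intro!: arg_cong[of _ _ card])
qed

text \<open>The parts may leave vertices uncovered, yet all of \<open>V\<close> gets coloured. A
  vertex with many neighbours in every part would be an apex, so it has few in some part, and this
  part is its colour; by the degree condition it is adjacent to almost all of every other part.
  Hence a vertex and \<open>t\<close> neighbours of its own colour have large common neighbourhoods
  in the other parts, which completes a cone.\<close>

lemma cone_free_colouring_of_parts:
  fixes P :: "nat \<Rightarrow> 'a set" and \<gamma> :: real
  assumes fin: "finite V" and k: "1 \<le> k" and t: "1 \<le> t" and free: "cone_free V k t"
    and P: "\<And>i. i < k \<Longrightarrow> P i \<subseteq> V"
    and disj: "\<And>i j. i < k \<Longrightarrow> j < k \<Longrightarrow> i \<noteq> j \<Longrightarrow> P i \<inter> P j = {}"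
    and inside: "\<And>i x. i < k \<Longrightarrow> x \<in> P i \<Longrightarrow> card {y \<in> P i. E x y} \<le> t"
    and large: "\<And>i. i < k \<Longrightarrow> (1 / real k - \<gamma>) * real (card V) \<le> real (card (P i))"
    and deg: "\<And>x. x \<in> V \<Longrightarrow> real (card {y \<in> V. \<not> E x y}) \<le> (1 / real k + \<gamma>) * real (card V)"
    and \<gamma>: "0 < \<gamma>" "real t \<le> \<gamma> * real (card V)" "(2 * real t + 4) * (4 * real k * real t * \<gamma>) \<le> 1 / real k"
  shows "\<exists>c. (\<forall>w\<in>V. c w < k) \<and> (\<forall>w\<in>V. card {x \<in> V. E w x \<and> c x = c w} < t)"
proof -
  define n where "n = real (card V)"
  \<comment> \<open>Large enough for \<open>greedy_multipartite\<close> to work in sets of size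
    \<open>\<eta> * n\<close> with defect \<open>3 * \<gamma> * n\<close>, given that
    \<open>t \<le> \<gamma> * n\<close>.\<close>
  define \<eta> where "\<eta> = 4 * real k * real t * \<gamma>"
  have n: "0 \<le> n" by (simp add: n_def)
  have "1 \<le> real k * real t" using k t by (metis mult_mono of_nat_1 of_nat_le_iff mult_1 of_nat_0_le_iff)
  then have \<eta>\<gamma>: "4 * \<gamma> \<le> \<eta>" using \<gamma>(1) mult_right_mono[of 1 "real k * real t" "4 * \<gamma>"] by (simp add: \<eta>_def)
  have \<eta>0: "0 < \<eta>" using \<eta>\<gamma> \<gamma> by simp
  have finP: "finite (P i)" if "i < k" for i using P[OF that] fin finite_subset by blast
  have miss2: "real (card {y \<in> P j. \<not> E x y}) + real (card {y \<in> P i. \<not> E x y}) \<le> (1 / real k + \<gamma>) * n"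
    if "i < k" "j < k" "i \<noteq> j" "x \<in> V" for i j x
  proof -
    have "card {y \<in> P j. \<not> E x y} + card {y \<in> P i. \<not> E x y} = card ({y \<in> P j. \<not> E x y} \<union> {y \<in> P i. \<not> E x y})"
      using disj[of i j] that finP by (intro card_Un_disjoint[symmetric]) auto
    also have "\<dots> \<le> card {y \<in> V. \<not> E x y}" using P that fin by (intro card_mono) auto
    finally show ?thesis using deg[OF that(4)] unfolding n_def by linarith
  qed
  \<comment> \<open>At least \<open>(1 / k - \<gamma>) * n - t\<close> non-neighbours of
    \<open>x\<close> lie in \<open>P i\<close> itself, which leaves at most
    \<open>2 * \<gamma> * n + t\<close> of the allowance for \<open>P j\<close>.\<close>
  have miss: "real (card {y \<in> P j. \<not> E x y}) \<le> 3 * \<gamma> * n" if "i < k" "j < k" "i \<noteq> j" "x \<in> P i" for i j x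
  proof -
    have "x \<in> V" using P that by auto
    from miss2[OF that(1-3) this] card_nonneighbours[OF fin P[OF that(1)], of x] inside[OF that(1,4)] large[OF that(1)]
    have "real (card {y \<in> P j. \<not> E x y}) \<le> (1 / real k + \<gamma>) * n - (1 / real k - \<gamma>) * n + real t"
      unfolding n_def by linarith
    then show ?thesis using \<gamma>(2) by (simp add: algebra_simps n_def)
  qed
  have big: "real t + real k * real t * (3 * \<gamma> * n) \<le> \<eta> * n"
  proof -
    have "1 * (\<gamma> * n) \<le> (real k * real t) * (\<gamma> * n)" using \<open>1 \<le> real k * real t\<close> \<gamma> n by (intro mult_right_mono) auto
    then show ?thesis using \<gamma>(2) by (simp add: \<eta>_def algebra_simps n_def)
  qed
  have "\<exists>i<k. real (card {y \<in> P i. E w y}) < \<eta> * n" if w: "w \<in> V" for w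
  proof (rule ccontr)
    assume "\<not> ?thesis"
    then have ge: "\<And>i. i < k \<Longrightarrow> \<eta> * n \<le> real (card {y \<in> P i. E w y})" by (meson not_le)
    have "\<exists>S. (\<forall>j\<in>{..<k}. S j \<subseteq> {y \<in> P j. E w y} \<and> card (S j) = t) \<and>
      (\<forall>i\<in>{..<k}. \<forall>j\<in>{..<k}. i \<noteq> j \<longrightarrow> (\<forall>x\<in>S i. \<forall>y\<in>S j. E x y))"
    proof (rule greedy_multipartite[where g = "3 * \<gamma> * n"])
      fix i j x assume ij: "i \<in> {..<k}" "j \<in> {..<k}" "i \<noteq> j" "x \<in> {y \<in> P i. E w y}"
      have "card {y \<in> {y \<in> P j. E w y}. \<not> E x y} \<le> card {y \<in> P j. \<not> E x y}"
        using finP ij by (intro card_mono) auto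
      then show "real (card {y \<in> {y \<in> P j. E w y}. \<not> E x y}) \<le> 3 * \<gamma> * n"
        using miss[of i j x] ij by simp
    qed (use finP ge big \<gamma> n in force)+
    then obtain S where S: "\<forall>j\<in>{..<k}. S j \<subseteq> {y \<in> P j. E w y} \<and> card (S j) = t"
      "\<forall>i\<in>{..<k}. \<forall>j\<in>{..<k}. i \<noteq> j \<longrightarrow> (\<forall>x\<in>S i. \<forall>y\<in>S j. E x y)" by (elim exE conjE)
    have "multipartite (nbrs V w) k t S"
      unfolding multipartite_def
    proof (intro conjI allI impI ballI)
      fix j assume j: "j < k"
      then have "S j \<subseteq> {y \<in> P j. E w y}" using S by auto
      then show "S j \<subseteq> nbrs V w" "finite (S j)" using P[OF j] finP[OF j] by (auto simp: nbrs_def finite_subset)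
    qed (use S in auto)
    then show False using free w by (auto simp: cone_free_def)
  qed
  then obtain c where c: "\<And>w. w \<in> V \<Longrightarrow> c w < k" "\<And>w. w \<in> V \<Longrightarrow> real (card {y \<in> P (c w). E w y}) < \<eta> * n"
    by metis
  have miss': "real (card {y \<in> P j. \<not> E w y}) \<le> 2 * \<eta> * n" if "w \<in> V" "j < k" "j \<noteq> c w" for w j
  proof -
    have "real (card {y \<in> P j. \<not> E w y}) \<le> (1 / real k + \<gamma>) * n - (1 / real k - \<gamma>) * n + \<eta> * n"
      using miss2[of "c w" j w] c[OF that(1)] that large[of "c w"] card_nonneighbours[OF fin P[of "c w"], of w]
      unfolding n_def by linarith
    also have "\<dots> = (2 * \<gamma> + \<eta>) * n" by (simp add: algebra_simps)
    also have "\<dots> \<le> (2 * \<eta>) * n" using \<eta>\<gamma> \<gamma> n by (intro mult_right_mono) auto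
    finally show ?thesis .
  qed
  have "card {x \<in> V. E w x \<and> c x = c w} < t" if w: "w \<in> V" for w
  proof (rule ccontr)
    let ?i = "c w"
    assume "\<not> ?thesis"
    then have "t \<le> card {x \<in> V. E w x \<and> c x = c w}" by simp
    then obtain L where L: "L \<subseteq> {x \<in> V. E w x \<and> c x = c w}" "card L = t" "finite L"
      by (rule obtain_subset_with_card_n)
    define Q where "Q j = {y \<in> P j. \<forall>x\<in>insert w L. E x y}" for j
    have cQ: "\<eta> * n \<le> real (card (Q j))" if j: "j < k" "j \<noteq> ?i" for j
    proof -
      define Bad where "Bad = (\<Union>x\<in>insert w L. {y \<in> P j. \<not> E x y})"
      have "real (card Bad) \<le> real (\<Sum>x\<in>insert w L. card {y \<in> P j. \<not> E x y})"
        unfolding Bad_def of_nat_le_iff using L by (intro card_UN_le) auto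
      also have "\<dots> = (\<Sum>x\<in>insert w L. real (card {y \<in> P j. \<not> E x y}))" by simp
      also have "\<dots> \<le> (\<Sum>x\<in>insert w L. 2 * \<eta> * n)"
        using L w j by (intro sum_mono miss') auto
      also have "\<dots> = real (card (insert w L)) * (2 * \<eta> * n)" by simp
      also have "\<dots> \<le> (real t + 1) * (2 * \<eta> * n)"
        using card_insert_le_m1[of "Suc t" L w] L \<eta>0 n by (intro mult_right_mono) auto
      finally have Bad: "real (card Bad) \<le> (real t + 1) * (2 * \<eta> * n)" .
      have "card (P j) \<le> card (Q j \<union> Bad)"
        using finP[OF j(1)] L by (intro card_mono) (auto simp: Q_def Bad_def)
      also have "\<dots> \<le> card (Q j) + card Bad" by (rule card_Un_le)
      finally have "(1 / real k - \<gamma>) * n - (real t + 1) * (2 * \<eta> * n) \<le> real (card (Q j))"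
        using large[OF j(1)] Bad unfolding n_def by linarith
      \<comment> \<open>Each of the at most \<open>t + 1\<close> vertices of
        \<open>insert w L\<close> excludes at most \<open>2 * \<eta> * n\<close> vertices of
        \<open>P j\<close>; the constant \<open>2 * t + 4\<close> leaves
        \<open>2 * \<eta> * n\<close> before the deficit \<open>\<gamma> * n\<close> of
        \<open>P j\<close> is subtracted.\<close>
      moreover have "((2 * real t + 4) * \<eta>) * n \<le> (1 / real k) * n"
        using \<gamma>(3) n unfolding \<eta>_def by (intro mult_right_mono) auto
      moreover have "\<gamma> * n \<le> \<eta> * n" using \<eta>\<gamma> \<gamma> n by (intro mult_right_mono) auto
      ultimately show ?thesis by (simp add: algebra_simps)
    qed
    have "\<exists>S. (\<forall>j\<in>{..<k} - {?i}. S j \<subseteq> Q j \<and> card (S j) = t) \<and>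
      (\<forall>i\<in>{..<k} - {?i}. \<forall>j\<in>{..<k} - {?i}. i \<noteq> j \<longrightarrow> (\<forall>x\<in>S i. \<forall>y\<in>S j. E x y))"
    proof (rule greedy_multipartite[where g = "3 * \<gamma> * n"])
      fix i j x assume ij: "i \<in> {..<k} - {?i}" "j \<in> {..<k} - {?i}" "i \<noteq> j" "x \<in> Q i"
      have "card {y \<in> Q j. \<not> E x y} \<le> card {y \<in> P j. \<not> E x y}"
        using finP ij by (intro card_mono) (auto simp: Q_def)
      then show "real (card {y \<in> Q j. \<not> E x y}) \<le> 3 * \<gamma> * n"
        using miss[of i j x] ij by (simp add: Q_def)
    next
      fix j assume j: "j \<in> {..<k} - {?i}"
      then show "finite (Q j)" using finP by (simp add: Q_def)
      have "real (card ({..<k} - {?i})) * real t * (3 * \<gamma> * n) \<le> real k * real t * (3 * \<gamma> * n)"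
        using c w \<gamma> n by (intro mult_right_mono) auto
      then show "real t + real (card ({..<k} - {?i})) * real t * (3 * \<gamma> * n) \<le> real (card (Q j))"
        using big cQ[of j] j by (simp del: card_Diff_insert card_Diff_singleton; linarith)
    qed (use \<gamma> n in auto)
    then obtain S where S: "\<forall>j\<in>{..<k} - {?i}. S j \<subseteq> Q j \<and> card (S j) = t"
      "\<forall>i\<in>{..<k} - {?i}. \<forall>j\<in>{..<k} - {?i}. i \<noteq> j \<longrightarrow> (\<forall>x\<in>S i. \<forall>y\<in>S j. E x y)" by (elim exE conjE)
    show False
    proof (rule cone_free_star[OF free fin c(1)[OF w] w _ L(2)])
      show "L \<subseteq> nbrs V w" using L by (auto simp: nbrs_def)
      fix j assume j: "j < k" "j \<noteq> ?i"
      then have "S j \<subseteq> Q j" "card (S j) = t" using S by auto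
      moreover have "Q j \<subseteq> nbrs V w" using P[OF j(1)] by (auto simp: Q_def nbrs_def)
      ultimately show "S j \<subseteq> nbrs V w \<and> card (S j) = t \<and> (\<forall>x\<in>S j. \<forall>y\<in>L. E x y)"
        using sym by (auto simp: Q_def)
    qed (use S(2) in blast)
  qed
  then show ?thesis using c(1) by (intro exI[of _ c]) blast
qed

lemma ordered_cliques_2:
  assumes "finite V"
  shows "ordered_cliques V 2 = (\<Sum>v\<in>V. real (card (nbrs V v)))"
proof -
  have "cliques V (Suc 0) = (\<lambda>v. {v}) ` V"
    by (auto simp: cliques_def card_1_singleton_iff)
  then have "(\<Sum>v\<in>V. card (common V {v})) = 2 * card (cliques V 2)"
    using card_cliques_Suc[OF assms, of 1] by (simp add: sum.reindex inj_on_def numeral_2_eq_2)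
  moreover have "common V {v} = nbrs V v" for v
    using sym by (auto simp: common_def nbrs_def)
  ultimately have "(\<Sum>v\<in>V. card (nbrs V v)) = 2 * card (cliques V 2)" by simp
  then have "real (\<Sum>v\<in>V. card (nbrs V v)) = real (2 * card (cliques V 2))" by simp
  then show ?thesis by (simp add: ordered_cliques_def)
qed

text \<open>Every vertex has fewer than \<open>t\<close> neighbours in some \<open>A i\<close>; the degree condition forces almost all
  vertices to be adjacent to almost all of the other \<open>A j\<close>, and these vertices form the parts.\<close>
lemma cone_free_parts:
  fixes \<beta> \<epsilon> :: real
  assumes fin: "finite V" and k: "2 \<le> k" and t: "1 \<le> t" and free: "cone_free V k t"
    and A: "multipartite V k T A" and T: "T = (t + 1) * (s + t) + t"
    and s: "2 * real t \<le> \<beta> * real s" and \<epsilon>: "0 < \<epsilon>" "\<epsilon> * (real k * real T) \<le> real t"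
    and n: "real t \<le> \<epsilon> * real (card V)"
    and deg: "\<And>x. x \<in> V \<Longrightarrow> (1 - 1 / real k - \<epsilon>) * real (card V) \<le> real (card (nbrs V x))"
  shows "\<exists>P. (\<forall>i<k. P i \<subseteq> V) \<and> (\<forall>i<k. \<forall>j<k. i \<noteq> j \<longrightarrow> P i \<inter> P j = {}) \<and>
    (\<forall>i<k. \<forall>x\<in>P i. card {y \<in> P i. E x y} \<le> t) \<and>
    (\<forall>i<k. (1 / real k - \<beta> - 2 * real k * \<epsilon>) * real (card V) \<le> real (card (P i)))"
proof -
  define n where "n = real (card V)"
  have n0: "0 \<le> n" by (simp add: n_def)
  define d where "d v i = card {x \<in> A i. E v x}" for v i
  \<comment> \<open>The value of \<open>T\<close> is adapted to this definition:
    \<open>t + 1\<close> vertices of \<open>P i\<close> miss together at most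
    \<open>(t + 1) * (s + t)\<close> vertices of another \<open>A j\<close>, so they keep
    \<open>t\<close> common neighbours there.\<close>
  define P where "P i = {v \<in> V. d v i < t \<and> (\<forall>j<k. j \<noteq> i \<longrightarrow> T \<le> d v j + s + t)}" for i
  have finA: "finite (A i)" and cA: "card (A i) = T" and AV: "A i \<subseteq> V" if "i < k" for i
    using A that by (auto simp: multipartite_def)
  have AA: "E x y" if "i < k" "j < k" "i \<noteq> j" "x \<in> A i" "y \<in> A j" for i j x y
    using A that by (auto simp: multipartite_def)
  have dT: "d v i \<le> T" if "i < k" for v i
    using card_mono[OF finA[OF that], of "{x \<in> A i. E v x}"] cA[OF that] by (auto simp: d_def)
  have small: "\<exists>i<k. d v i < t" if v: "v \<in> V" for v
  proof (rule ccontr)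
    assume "\<not> ?thesis"
    then have "\<forall>i<k. \<exists>S. S \<subseteq> {x \<in> A i. E v x} \<and> card S = t"
      unfolding d_def by (meson not_le obtain_subset_with_card_n)
    then obtain S where S: "\<And>i. i < k \<Longrightarrow> S i \<subseteq> {x \<in> A i. E v x} \<and> card (S i) = t" by metis
    have "multipartite (nbrs V v) k t S"
      unfolding multipartite_def
    proof (intro conjI allI impI ballI)
      fix j assume j: "j < k"
      show "S j \<subseteq> nbrs V v" "finite (S j)" "card (S j) = t"
        using S[OF j] AV[OF j] finA[OF j] by (auto simp: nbrs_def intro: finite_subset)
    next
      fix i j x y assume "i < k" "j < k" "i \<noteq> j" "x \<in> S i" "y \<in> S j"
      then show "E x y" using S[of i] S[of j] AA[of i j x y] by auto
    qed
    then show False using free v by (auto simp: cone_free_def)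
  qed
  define D where "D v = (\<Sum>i<k. d v i)" for v
  have D_split: "D v = d v i + (\<Sum>j\<in>{..<k} - {i}. d v j)" if "i < k" for v i
    unfolding D_def using that by (subst sum.remove[of _ i]) auto
  have D_le: "D v \<le> (k - 1) * T + t" if v: "v \<in> V" for v
  proof -
    obtain i where i: "i < k" "d v i < t" using small[OF v] by auto
    have "(\<Sum>j\<in>{..<k} - {i}. d v j) \<le> (\<Sum>j\<in>{..<k} - {i}. T)" by (intro sum_mono dT) auto
    also have "\<dots> = (k - 1) * T" using i by simp
    finally show ?thesis using D_split[OF i(1), of v] i by simp
  qed
  have good: "\<exists>i<k. v \<in> P i" if v: "v \<in> V" and Dv: "(k - 1) * T \<le> D v + s" for v
  proof -
    obtain i where i: "i < k" "d v i < t" using small[OF v] by auto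
    have "T \<le> d v j + s + t" if j: "j < k" "j \<noteq> i" for j
    proof -
      have "(\<Sum>j\<in>{..<k} - {i}. d v j) = d v j + (\<Sum>j\<in>{..<k} - {i} - {j}. d v j)"
        using j by (subst sum.remove[of _ j]) auto
      also have "(\<Sum>j\<in>{..<k} - {i} - {j}. d v j) \<le> (\<Sum>j\<in>{..<k} - {i} - {j}. T)" by (intro sum_mono dT) auto
      also have "\<dots> = (k - 2) * T" using i j by (simp add: numeral_2_eq_2)
      finally have "D v \<le> t + d v j + (k - 2) * T" using D_split[OF i(1), of v] i by simp
      moreover have "(k - 1) * T = T + (k - 2) * T" using k by (simp add: algebra_simps flip: mult_Suc)
      ultimately show ?thesis using Dv by simp
    qed
    then show ?thesis using i v by (auto simp: P_def)
  qed
  \<comment> \<open>No \<open>D v\<close> exceeds \<open>(k - 1) * T + t\<close>, and a bad vertex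
    is more than \<open>s + t\<close> below this. The degrees of the vertices in the sets
    \<open>A i\<close> force the average of \<open>D\<close> up to nearly
    \<open>(k - 1) * T\<close>, so few vertices are bad.\<close>
  define Bad where "Bad = {v \<in> V. D v + s < (k - 1) * T}"
  have "real k * real T * ((1 - 1 / real k - \<epsilon>) * n) = (\<Sum>i<k. \<Sum>a\<in>A i. (1 - 1 / real k - \<epsilon>) * n)"
    using cA by simp
  also have "\<dots> \<le> (\<Sum>i<k. \<Sum>a\<in>A i. real (card (nbrs V a)))"
    unfolding n_def using AV by (intro sum_mono deg) auto
  also have "\<dots> = (\<Sum>i<k. \<Sum>a\<in>A i. \<Sum>v\<in>V. of_bool (E a v))"
    using fin by (simp add: nbrs_def of_bool_def sum.If_cases Int_def)
  also have "\<dots> = (\<Sum>i<k. \<Sum>v\<in>V. \<Sum>a\<in>A i. of_bool (E a v))" by (intro sum.cong refl sum.swap)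
  also have "\<dots> = (\<Sum>v\<in>V. \<Sum>i<k. \<Sum>a\<in>A i. of_bool (E v a))"
    by (subst sum.swap) (simp add: adjacent_commute cong: sum.cong)
  also have "\<dots> = (\<Sum>v\<in>V. real (D v))"
    using finA by (simp add: D_def d_def of_bool_def sum.If_cases Int_def)
  also have "\<dots> \<le> (\<Sum>v\<in>V. real ((k - 1) * T + t) - real (s + t) * of_bool (v \<in> Bad))"
    using D_le by (intro sum_mono) (force simp: Bad_def simp flip: of_nat_add of_nat_mult)
  also have "\<dots> = n * real ((k - 1) * T + t) - real (s + t) * real (card Bad)"
    using fin by (simp add: sum_subtractf sum_distrib_left[symmetric] n_def)
      (simp add: of_bool_def sum.If_cases Bad_def Int_def)
  finally have "real (s + t) * card Bad \<le> n * (real (k - 1) * real T + real t) - real k * real T * ((1 - 1 / real k - \<epsilon>) * n)"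
    by simp
  also have "\<dots> = n * real t + n * (\<epsilon> * (real k * real T))"
    using k by (simp add: of_nat_diff field_simps)
  also have "\<dots> \<le> n * real t + n * real t" using \<epsilon>(2) n0 by (intro add_left_mono mult_left_mono) auto
  also have "\<dots> = 2 * real t * n" by simp
  also have "\<dots> \<le> \<beta> * real s * n" using s n0 by (intro mult_right_mono) auto
  finally have 1: "real (s + t) * card Bad \<le> \<beta> * n * real s" by (simp add: mult_ac)
  have "0 < s" using s t by (cases s) auto
  have "real s * card Bad \<le> real (s + t) * card Bad" by (intro mult_right_mono) auto
  then have "real s * card Bad \<le> real s * (\<beta> * n)" using 1 by (simp add: mult_ac)
  then have Bad: "card Bad \<le> \<beta> * n" using \<open>0 < s\<close> by simp
  have PV: "P i \<subseteq> V" for i by (auto simp: P_def)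
  have finP: "finite (P i)" for i using PV fin finite_subset by blast
  have disj: "P i \<inter> P j = {}" if "i < k" "j < k" "i \<noteq> j" for i j
  proof -
    \<comment> \<open>Membership of \<open>x\<close> in \<open>P i\<close> gives
      \<open>d x i < t\<close>, membership in \<open>P j\<close> gives
      \<open>T \<le> d x i + s + t\<close>.\<close>
    have "s + t + t \<le> T" using T by simp
    then have "False" if "x \<in> P i" "x \<in> P j" for x
      using that \<open>i < k\<close> \<open>j < k\<close> \<open>i \<noteq> j\<close> by (force simp: P_def)
    then show ?thesis by blast
  qed
  have inside: "card {y \<in> P i. E w y} \<le> t" if i: "i < k" and w: "w \<in> P i" for i w
  proof (rule ccontr)
    assume "\<not> ?thesis"
    then have "t \<le> card {y \<in> P i. E w y}" by simp
    then obtain L where L: "L \<subseteq> {y \<in> P i. E w y}" "card L = t" "finite L" by (rule obtain_subset_with_card_n)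
    have "\<exists>S. S \<subseteq> {x \<in> A j. \<forall>y\<in>insert w L. E x y} \<and> card S = t" if j: "j < k" "j \<noteq> i" for j
    proof -
      define B where "B = (\<Union>y\<in>insert w L. {x \<in> A j. \<not> E y x})"
      have "card B \<le> (\<Sum>y\<in>insert w L. card {x \<in> A j. \<not> E y x})"
        unfolding B_def using L by (intro card_UN_le) auto
      also have "\<dots> \<le> (\<Sum>y\<in>insert w L. s + t)"
      proof (rule sum_mono)
        fix y assume "y \<in> insert w L"
        then have "T \<le> d y j + s + t" using w L j by (auto simp: P_def)
        then show "card {x \<in> A j. \<not> E y x} \<le> s + t"
          using card_nonneighbours[OF fin AV[OF j(1)], of y] cA[OF j(1)] by (simp add: d_def)
      qed
      also have "\<dots> = card (insert w L) * (s + t)" by simp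
      also have "\<dots> \<le> (t + 1) * (s + t)"
        using card_insert_le_m1[of "Suc t" L w] L by (intro mult_right_mono) auto
      finally have B: "card B \<le> (t + 1) * (s + t)" .
      have "T = card (A j)" using cA j by simp
      also have "\<dots> \<le> card ({x \<in> A j. \<forall>y\<in>insert w L. E x y} \<union> B)"
        using finA[OF j(1)] L sym by (intro card_mono) (auto simp: B_def)
      also have "\<dots> \<le> card {x \<in> A j. \<forall>y\<in>insert w L. E x y} + card B" by (rule card_Un_le)
      finally have "t \<le> card {x \<in> A j. \<forall>y\<in>insert w L. E x y}" using B T by linarith
      then show ?thesis by (meson obtain_subset_with_card_n)
    qed
    then obtain S where S: "\<And>j. j < k \<Longrightarrow> j \<noteq> i \<Longrightarrow> S j \<subseteq> {x \<in> A j. \<forall>y\<in>insert w L. E x y} \<and> card (S j) = t"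
      by metis
    show False
    proof (rule cone_free_star[OF free fin i _ _ L(2)])
      show "w \<in> V" using w PV by auto
      show "L \<subseteq> nbrs V w" using L PV by (auto simp: nbrs_def)
      fix j assume j: "j < k" "j \<noteq> i"
      show "S j \<subseteq> nbrs V w \<and> card (S j) = t \<and> (\<forall>x\<in>S j. \<forall>y\<in>L. E x y)"
        using S[OF j] AV[OF j(1)] sym by (auto simp: nbrs_def)
    next
      fix a b x y assume "a < k" "b < k" "a \<noteq> i" "b \<noteq> i" "a \<noteq> b" "x \<in> S a" "y \<in> S b"
      then show "E x y" using S[of a] S[of b] AA[of a b x y] by auto
    qed
  qed
  \<comment> \<open>Each part is bounded below by bounding all the others above: a vertex of
    \<open>P i\<close> has at most \<open>t\<close> neighbours in \<open>P i\<close>, so its degree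
    leaves little room for \<open>P i\<close>.\<close>
  have upper: "real (card (P i)) \<le> (1 / real k + 2 * \<epsilon>) * n" if i: "i < k" for i
  proof (cases "P i = {}")
    case True
    then show ?thesis using n0 \<epsilon> by simp
  next
    case False
    then obtain w where w: "w \<in> P i" by auto
    have "card (P i) = card {y \<in> P i. \<not> E w y} + card {y \<in> P i. E w y}"
      using card_nonneighbours[OF fin PV] by simp
    also have "\<dots> \<le> card {y \<in> V. \<not> E w y} + t"
      using inside[OF i w] PV fin by (intro add_mono card_mono) auto
    finally have "real (card (P i)) \<le> n - real (card (nbrs V w)) + real t"
      using card_nonneighbours[OF fin subset_refl, of w] unfolding n_def nbrs_def by linarith
    also have "\<dots> \<le> n - (1 - 1 / real k - \<epsilon>) * n + \<epsilon> * n"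
      using deg[of w] w PV n unfolding n_def by fastforce
    finally show ?thesis by (simp add: algebra_simps)
  qed
  have "(1 / real k - \<beta> - 2 * real k * \<epsilon>) * n \<le> real (card (P i))" if i: "i < k" for i
  proof -
    have "V \<subseteq> Bad \<union> (\<Union>j<k. P j)" using good by (fastforce simp: Bad_def not_less)
    then have "card V \<le> card (Bad \<union> (\<Union>j<k. P j))" using fin finP by (intro card_mono) (auto simp: Bad_def)
    also have "\<dots> \<le> card Bad + card (\<Union>j<k. P j)" by (rule card_Un_le)
    also have "card (\<Union>j<k. P j) \<le> (\<Sum>j<k. card (P j))" by (rule card_UN_le) simp
    also have "\<dots> = card (P i) + (\<Sum>j\<in>{..<k} - {i}. card (P j))" using i by (subst sum.remove[of _ i]) auto
    finally have "n \<le> real (card Bad) + real (card (P i)) + (\<Sum>j\<in>{..<k} - {i}. real (card (P j)))"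
      unfolding n_def by (simp flip: of_nat_sum of_nat_add)
    also have "(\<Sum>j\<in>{..<k} - {i}. real (card (P j))) \<le> (\<Sum>j\<in>{..<k} - {i}. (1 / real k + 2 * \<epsilon>) * n)"
      by (intro sum_mono upper) auto
    also have "\<dots> = (real k - 1) * ((1 / real k + 2 * \<epsilon>) * n)" using i by (simp add: of_nat_diff)
    finally have "n - \<beta> * n - (real k - 1) * ((1 / real k + 2 * \<epsilon>) * n) \<le> real (card (P i))"
      using Bad by simp
    moreover have "n - \<beta> * n - (real k - 1) * ((1 / real k + 2 * \<epsilon>) * n)
        = (1 / real k - \<beta> - 2 * real k * \<epsilon>) * n + 2 * (\<epsilon> * n)"
      using k by (simp add: field_simps)
    moreover have "0 \<le> \<epsilon> * n" using \<epsilon> n0 by simp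
    ultimately show ?thesis by linarith
  qed
  then show ?thesis using PV disj inside unfolding n_def by (intro exI[of _ P] conjI allI impI ballI)
qed

end

text \<open>The degree condition lifts the edge density above that of the Turan graph with
  \<open>k - 1\<close> parts. This gives many \<open>k\<close>-cliques, hence \<open>k\<close>
  completely joined sets of size \<open>T\<close>, which \<open>cone_free_parts\<close> expands to
  parts of nearly equal size.\<close>

lemma cone_free_colouring:
  assumes k: "2 \<le> k" and t: "1 \<le> t"
  shows "\<exists>\<epsilon> n0. 0 < \<epsilon> \<and> \<epsilon> < 1 - 1 / real k \<and> (\<forall>(E :: 'a \<Rightarrow> 'a \<Rightarrow> bool) V. adjacency E \<longrightarrow> finite V \<longrightarrow> n0 \<le> card V \<longrightarrow>
    adjacency.cone_free E V k t \<longrightarrow>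
    (\<forall>x\<in>V. (1 - 1 / real k - \<epsilon>) * real (card V) \<le> real (card (adjacency.nbrs E V x))) \<longrightarrow>
    (\<exists>c. (\<forall>w\<in>V. c w < k) \<and> (\<forall>w\<in>V. card {x \<in> V. E w x \<and> c x = c w} < t)))"
proof -
  \<comment> \<open>Satisfies the last hypothesis of \<open>cone_free_colouring_of_parts\<close>
    with equality.\<close>
  define \<gamma> where "\<gamma> = 1 / (real k * ((2 * real t + 4) * (4 * real k * real t)))"
  have \<gamma>: "0 < \<gamma>" "(2 * real t + 4) * (4 * real k * real t * \<gamma>) \<le> 1 / real k"
  proof -
    have "0 < (2 * real t + 4) * (4 * real k * real t)" using k t by (intro mult_pos_pos) auto
    then show "0 < \<gamma>" "(2 * real t + 4) * (4 * real k * real t * \<gamma>) \<le> 1 / real k"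
      using k by (simp_all add: \<gamma>_def)
  qed
  define s where "s = nat \<lceil>4 * real t / \<gamma>\<rceil>"
  have "4 * real t / \<gamma> \<le> real s" unfolding s_def by linarith
  then have s: "2 * real t \<le> \<gamma> / 2 * real s" using \<gamma> by (simp add: field_simps)
  define T where "T = (t + 1) * (s + t) + t"
  define q where "q = k - 1"
  have q: "k = Suc q" "1 \<le> q" using k by (auto simp: q_def)
  \<comment> \<open>Half of the gap between \<open>1 / q\<close> and \<open>1 / k\<close>; the other
    half is left to \<open>\<epsilon>\<close>.\<close>
  define e where "e = 1 / (2 * real k * real q)"
  have e: "0 < e" using k q by (simp add: e_def)
  have e2: "1 / real q - 1 / real k = 2 * e"
  proof -
    have "1 / real q - 1 / real k = 1 / (real k * real q)" using q by (simp add: field_simps)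
    then show ?thesis by (simp add: e_def)
  qed
  \<comment> \<open>The bound \<open>e\<close> serves the edge density, \<open>t / (k * T)\<close>
    the averaging in \<open>cone_free_parts\<close>, \<open>\<gamma>\<close> the degree hypothesis
    of the colouring. With \<open>\<gamma> / (4 * k)\<close> and the choice
    \<open>\<beta> = \<gamma> / 2\<close>, the parts have at least
    \<open>(1 / k - \<gamma>) * card V\<close> vertices.\<close>
  define \<epsilon> where "\<epsilon> = min (min e (real t / (real k * real T))) (min \<gamma> (\<gamma> / (4 * real k)))"
  have T0: "0 < T" using t by (simp add: T_def)
  have \<epsilon>: "0 < \<epsilon>" "\<epsilon> \<le> e" "\<epsilon> \<le> real t / (real k * real T)" "\<epsilon> \<le> \<gamma>" "\<epsilon> \<le> \<gamma> / (4 * real k)"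
    using e t k T0 \<gamma> by (auto simp: \<epsilon>_def min_le_iff_disj)
  have \<epsilon>T: "\<epsilon> * (real k * real T) \<le> real t" using \<epsilon>(3) k T0 by (simp add: field_simps)
  have k\<epsilon>: "2 * real k * \<epsilon> \<le> \<gamma> / 2" using \<epsilon>(5) k by (simp add: field_simps)
  have q2: "2 \<le> Suc q" using q(2) by simp
  have prod: "(\<Prod>j<2. 1 - real j / real q) = 1 - 1 / real q" by (simp add: numeral_2_eq_2)
  obtain \<delta> where \<delta>: "0 < \<delta>" "\<forall>(E :: 'a \<Rightarrow> 'a \<Rightarrow> bool) V. adjacency E \<longrightarrow> finite V \<longrightarrow>
    ((\<Prod>j<2. 1 - real j / real q) + e) * real (card V) ^ 2 \<le> adjacency.ordered_cliques E V 2 \<longrightarrow>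
    \<delta> * real (card V) ^ Suc q \<le> adjacency.ordered_cliques E V (Suc q)"
    using supersaturation[OF q(2) q2 e] by (elim exE conjE)
  obtain n1 where n1: "\<forall>(E :: 'a \<Rightarrow> 'a \<Rightarrow> bool) U V. adjacency E \<longrightarrow> finite V \<longrightarrow> U \<subseteq> V \<longrightarrow> n1 \<le> card V \<longrightarrow>
    \<delta> * real (card V) ^ k \<le> adjacency.ordered_cliques E U k \<longrightarrow> (\<exists>A. adjacency.multipartite E U k T A)"
    using many_cliques_multipartite[OF \<delta>(1), of k T] ..
  define n0 where "n0 = max n1 (nat \<lceil>real t / \<epsilon>\<rceil>)"
  have "\<exists>c. (\<forall>w\<in>V. c w < k) \<and> (\<forall>w\<in>V. card {x \<in> V. E w x \<and> c x = c w} < t)"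
    if E: "adjacency E" and fin: "finite V" and n: "n0 \<le> card V" and free: "adjacency.cone_free E V k t"
      and deg: "\<forall>x\<in>V. (1 - 1 / real k - \<epsilon>) * real (card V) \<le> real (card (adjacency.nbrs E V x))"
    for E :: "'a \<Rightarrow> 'a \<Rightarrow> bool" and V
  proof -
    interpret adjacency E by fact
    have "real t / \<epsilon> \<le> real (card V)" using n unfolding n0_def by linarith
    then have n2: "real t \<le> \<epsilon> * real (card V)" using \<epsilon> by (simp add: field_simps)
    have "((1 - 1 / real q) + e) * real (card V) ^ 2 \<le> (1 - 1 / real k - \<epsilon>) * real (card V) ^ 2"
      using e2 \<epsilon>(2) by (intro mult_right_mono) auto
    also have "\<dots> = (\<Sum>v\<in>V. (1 - 1 / real k - \<epsilon>) * real (card V))" by (simp add: power2_eq_square)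
    also have "\<dots> \<le> ordered_cliques V 2" unfolding ordered_cliques_2[OF fin] using deg by (intro sum_mono) auto
    finally have "\<delta> * real (card V) ^ k \<le> ordered_cliques V k"
      using \<delta>(2)[rule_format, OF E fin] unfolding prod q(1) by blast
    then obtain A where A: "multipartite V k T A"
      using n1[rule_format, OF E fin subset_refl] n by (auto simp: n0_def)
    have "\<exists>P. (\<forall>i<k. P i \<subseteq> V) \<and> (\<forall>i<k. \<forall>j<k. i \<noteq> j \<longrightarrow> P i \<inter> P j = {}) \<and>
      (\<forall>i<k. \<forall>x\<in>P i. card {y \<in> P i. E x y} \<le> t) \<and>
      (\<forall>i<k. (1 / real k - \<gamma> / 2 - 2 * real k * \<epsilon>) * real (card V) \<le> real (card (P i)))"
      by (rule cone_free_parts[OF fin k t free A T_def s \<epsilon>(1) \<epsilon>T n2]) (rule bspec[OF deg])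
    then obtain P where P: "\<forall>i<k. P i \<subseteq> V" "\<forall>i<k. \<forall>j<k. i \<noteq> j \<longrightarrow> P i \<inter> P j = {}"
      "\<forall>i<k. \<forall>x\<in>P i. card {y \<in> P i. E x y} \<le> t"
      "\<forall>i<k. (1 / real k - \<gamma> / 2 - 2 * real k * \<epsilon>) * real (card V) \<le> real (card (P i))"
      by (elim exE conjE)
    show ?thesis
    proof (rule cone_free_colouring_of_parts[OF fin _ t free _ _ _ _ _ \<gamma>(1) _ \<gamma>(2)])
      show "1 \<le> k" using k by simp
      show "real t \<le> \<gamma> * real (card V)"
        using n2 \<epsilon>(4) by (meson mult_right_mono of_nat_0_le_iff order_trans)
      fix i assume i: "i < k"
      have "(1 / real k - \<gamma>) * real (card V) \<le> (1 / real k - \<gamma> / 2 - 2 * real k * \<epsilon>) * real (card V)"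
        using k\<epsilon> by (intro mult_right_mono) auto
      then show "(1 / real k - \<gamma>) * real (card V) \<le> real (card (P i))" using P(4) i by force
    next
      fix x assume x: "x \<in> V"
      have "(1 / real k + \<epsilon>) * real (card V) \<le> (1 / real k + \<gamma>) * real (card V)"
        using \<epsilon>(4) by (intro mult_right_mono) auto
      moreover have "real (card {y \<in> V. \<not> E x y}) \<le> real (card V) - (1 - 1 / real k - \<epsilon>) * real (card V)"
        using card_nonneighbours[OF fin subset_refl, of x] deg x unfolding nbrs_def by force
      ultimately show "real (card {y \<in> V. \<not> E x y}) \<le> (1 / real k + \<gamma>) * real (card V)"
        by (simp add: algebra_simps)
    qed (use P in auto)
  qed
  \<comment> \<open>Allows powers of \<open>1 - 1 / k - \<epsilon>\<close> to be compared with those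
    of \<open>1 - 1 / k\<close>.\<close>
  moreover have "\<epsilon> < 1 - 1 / real k"
  proof -
    have "1 / (2 * real k) * (1 / real q) \<le> 1 / (2 * real k) * 1" using q(2) by (intro mult_left_mono) auto
    then have "e \<le> 1 / (2 * real k)" by (simp add: e_def)
    moreover have "1 / (2 * real k) < 1 - 1 / real k" using k by (simp add: field_simps)
    ultimately show ?thesis using \<epsilon>(2) by linarith
  qed
  ultimately show ?thesis using \<epsilon>(1) by (intro exI[of _ \<epsilon>] exI[of _ n0] conjI allI impI)
qed

section \<open>The clique count by induction on the number of vertices\<close>

lemma card_supersets_le_power:
  assumes "finite V" "finite B"
  shows "card {e. e \<subseteq> V \<and> card e = r \<and> B \<subseteq> e} \<le> card V ^ (r - card B)"
proof -
  have "card {e. e \<subseteq> V \<and> card e = r \<and> B \<subseteq> e} \<le> card {e. e \<subseteq> V \<and> card e = r - card B}"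
  proof (rule card_inj_on_le[where f = "\<lambda>e. e - B"])
    show "inj_on (\<lambda>e. e - B) {e. e \<subseteq> V \<and> card e = r \<and> B \<subseteq> e}" by (rule inj_onI) blast
    show "(\<lambda>e. e - B) ` {e. e \<subseteq> V \<and> card e = r \<and> B \<subseteq> e} \<subseteq> {e. e \<subseteq> V \<and> card e = r - card B}"
      using assms by (auto simp: card_Diff_subset)
  qed (use assms in simp)
  also have "\<dots> \<le> card V ^ (r - card B)" by (rule card_subsets_le_power[OF assms(1)])
  finally show ?thesis .
qed

context adjacency begin

lemma multipartite_mono: "multipartite U k t A \<Longrightarrow> U \<subseteq> V \<Longrightarrow> multipartite V k t A"
  by (auto simp: multipartite_def)

lemma cone_free_mono:
  assumes "cone_free V k t" "U \<subseteq> V"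
  shows "cone_free U k t"
proof -
  have "nbrs U w \<subseteq> nbrs V w" for w using assms(2) by (auto simp: nbrs_def)
  then show ?thesis using assms multipartite_mono unfolding cone_free_def by blast
qed

text \<open>A clique through \<open>v\<close> is \<open>v\<close> together with a clique in its
  neighbourhood; the factor \<open>Suc s\<close> counts the positions of \<open>v\<close> in the
  ordering.\<close>

lemma ordered_cliques_remove_vertex:
  assumes "finite V" "v \<in> V"
  shows "ordered_cliques V (Suc s) = ordered_cliques (V - {v}) (Suc s) + real (Suc s) * ordered_cliques (nbrs V v) s"
proof -
  have "card {K \<in> cliques V (Suc s). v \<in> K} = card (cliques (nbrs V v) s)"
  proof (rule bij_betw_same_card[of "\<lambda>K. K - {v}"], rule bij_betw_byWitness[where f' = "insert v"])
    show "(\<lambda>K. K - {v}) ` {K \<in> cliques V (Suc s). v \<in> K} \<subseteq> cliques (nbrs V v) s"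
      by (auto simp: cliques_def nbrs_def)
    show "insert v ` cliques (nbrs V v) s \<subseteq> {K \<in> cliques V (Suc s). v \<in> K}"
    proof (clarify, intro conjI insertI1)
      fix K assume K: "K \<in> cliques (nbrs V v) s"
      then have "v \<notin> K" using irrefl by (auto simp: cliques_def nbrs_def)
      then show "insert v K \<in> cliques V (Suc s)"
        using K assms sym by (auto simp: cliques_def nbrs_def)
    qed
    show "\<forall>K\<in>cliques (nbrs V v) s. insert v K - {v} = K"
      using irrefl by (auto simp: cliques_def nbrs_def)
  qed auto
  moreover have "card (cliques V (Suc s)) = card (cliques (V - {v}) (Suc s)) + card {K \<in> cliques V (Suc s). v \<in> K}"
    using assms finite_cliques[OF assms(1)] finite_cliques[of "V - {v}"]
    by (subst card_Un_disjoint[symmetric]) (auto simp: cliques_def intro!: arg_cong[of _ _ card])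
  ultimately show ?thesis by (simp add: ordered_cliques_def algebra_simps)
qed

text \<open>Without its monochromatic edges the graph is \<open>k\<close>-colourable, so
  \<open>zykov\<close> applies. Every other clique contains one of at most \<open>card V * t\<close>
  monochromatic adjacent pairs, each contained in at most \<open>card V ^ (r - 2)\<close> sets of
  size \<open>r\<close>.\<close>

lemma ordered_cliques_coloured:
  assumes fin: "finite V" and k: "1 \<le> k" "2 \<le> r" "r \<le> Suc k"
    and c: "\<And>w. w \<in> V \<Longrightarrow> c w < k" and sparse: "\<And>w. w \<in> V \<Longrightarrow> card {x \<in> V. E w x \<and> c x = c w} \<le> t"
  shows "ordered_cliques V r \<le> (\<Prod>j<r. 1 - real j / real k) * real (card V) ^ r + fact r * real t * real (card V) ^ (r - 1)"
proof -
  define E' where "E' x y \<longleftrightarrow> E x y \<and> c x \<noteq> c y" for x y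
  interpret E': adjacency E' by standard (auto simp: E'_def irrefl intro: sym)
  have "E'.cliques V (Suc k) = {}"
  proof (rule ccontr)
    assume "E'.cliques V (Suc k) \<noteq> {}"
    then obtain K where "K \<in> E'.cliques V (Suc k)" by auto
    then have K: "K \<subseteq> V" "card K = Suc k" "\<forall>x\<in>K. \<forall>y\<in>K. x \<noteq> y \<longrightarrow> E' x y" by (auto simp: E'.cliques_def)
    then have "inj_on c K" by (auto simp: inj_on_def E'_def)
    moreover have "c ` K \<subseteq> {..<k}" using K c by auto
    ultimately have "card K \<le> card {..<k}" by (rule card_inj_on_le) simp
    then show False using K by simp
  qed
  then have z: "E'.ordered_cliques V r \<le> (\<Prod>j<r. 1 - real j / real k) * real (card V) ^ r"
    using zykov[OF E'.adjacency_axioms fin k(1,3)] by simp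
  define S where "S w = {x \<in> V. E w x \<and> c x = c w}" for w
  define Q where "Q w x = {K. K \<subseteq> V \<and> card K = r \<and> {w, x} \<subseteq> K}" for w x
  have finS: "finite (S w)" for w using fin by (simp add: S_def)
  have "card (cliques V r) \<le> card (E'.cliques V r \<union> (\<Union>w\<in>V. \<Union>x\<in>S w. Q w x))"
  proof (rule card_mono)
    show "finite (E'.cliques V r \<union> (\<Union>w\<in>V. \<Union>x\<in>S w. Q w x))"
      using fin finS by (auto simp: E'.finite_cliques Q_def)
    show "cliques V r \<subseteq> E'.cliques V r \<union> (\<Union>w\<in>V. \<Union>x\<in>S w. Q w x)"
    proof
      fix K assume K: "K \<in> cliques V r"
      show "K \<in> E'.cliques V r \<union> (\<Union>w\<in>V. \<Union>x\<in>S w. Q w x)"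
      proof (cases "\<exists>w\<in>K. \<exists>x\<in>K. w \<noteq> x \<and> c x = c w")
        case True
        then obtain w x where "w \<in> K" "x \<in> K" "w \<noteq> x" "c x = c w" by auto
        then have "w \<in> V" "x \<in> S w" "K \<in> Q w x" using K by (auto simp: cliques_def S_def Q_def)
        then show ?thesis by blast
      next
        case False
        then have "K \<in> E'.cliques V r" using K by (auto simp: cliques_def E'.cliques_def E'_def)
        then show ?thesis by blast
      qed
    qed
  qed
  also have "\<dots> \<le> card (E'.cliques V r) + card (\<Union>w\<in>V. \<Union>x\<in>S w. Q w x)" by (rule card_Un_le)
  also have "card (\<Union>w\<in>V. \<Union>x\<in>S w. Q w x) \<le> (\<Sum>w\<in>V. card (\<Union>x\<in>S w. Q w x))" by (rule card_UN_le[OF fin])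
  also have "\<dots> \<le> (\<Sum>w\<in>V. t * card V ^ (r - 2))"
  proof (rule sum_mono)
    fix w assume w: "w \<in> V"
    have "card (\<Union>x\<in>S w. Q w x) \<le> (\<Sum>x\<in>S w. card (Q w x))" by (rule card_UN_le[OF finS])
    also have "\<dots> \<le> (\<Sum>x\<in>S w. card V ^ (r - 2))"
    proof (rule sum_mono)
      fix x assume "x \<in> S w"
      then have "card {w, x} = 2" using irrefl by (auto simp: S_def card_insert_if)
      then show "card (Q w x) \<le> card V ^ (r - 2)"
        using card_supersets_le_power[OF fin, of "{w, x}" r] by (simp add: Q_def)
    qed
    also have "\<dots> \<le> t * card V ^ (r - 2)" using sparse[OF w] by (simp add: S_def)
    finally show "card (\<Union>x\<in>S w. Q w x) \<le> t * card V ^ (r - 2)" .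
  qed
  also have "\<dots> = t * card V ^ (r - 1)"
  proof -
    have "r - 1 = Suc (r - 2)" using k by simp
    then show ?thesis by simp
  qed
  finally have "real (card (cliques V r)) \<le> real (card (E'.cliques V r) + t * card V ^ (r - 1))"
    by (simp only: of_nat_le_iff)
  then have "fact r * real (card (cliques V r)) \<le> fact r * real (card (E'.cliques V r) + t * card V ^ (r - 1))"
    by (intro mult_left_mono) auto
  then have "ordered_cliques V r \<le> E'.ordered_cliques V r + fact r * real t * real (card V) ^ (r - 1)"
    by (simp add: ordered_cliques_def E'.ordered_cliques_def algebra_simps)
  then show ?thesis using z by simp
qed

end

text \<open>Two terms of the binomial expansion. It measures by how much the main term grows when
  one vertex is put back.\<close>

lemma power_Suc_diff_ge:
  fixes x :: real
  assumes "0 \<le> x"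
  shows "x ^ Suc s + real (Suc s) * x ^ s \<le> (x + 1) ^ Suc s"
proof (induction s)
  case (Suc s)
  have "x ^ Suc (Suc s) + real (Suc (Suc s)) * x ^ Suc s + real (Suc s) * x ^ s
      = (x ^ Suc s + real (Suc s) * x ^ s) * (x + 1)" by (simp add: algebra_simps)
  also have "\<dots> \<le> (x + 1) ^ Suc s * (x + 1)" using Suc assms by (intro mult_right_mono) auto
  finally show ?case using assms by (simp add: algebra_simps) (smt (verit) mult_nonneg_nonneg of_nat_0_le_iff zero_le_power)
qed simp

text \<open>Reflects that a neighbourhood in the Turan graph with \<open>k\<close> parts covers a
  fraction \<open>1 - 1 / k\<close> of the vertices and is itself a Turan graph with
  \<open>k - 1\<close> parts.\<close>

lemma falling_prod_Suc:
  assumes "2 \<le> k"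
  shows "(\<Prod>j<Suc s. 1 - real j / real k) = (1 - 1 / real k) ^ s * (\<Prod>j<s. 1 - real j / real (k - 1))"
proof -
  have "1 - real (Suc j) / real k = (1 - 1 / real k) * (1 - real j / real (k - 1))" for j
    using assms by (simp add: of_nat_diff field_simps)
  then show ?thesis
    by (simp only: prod.lessThan_Suc_shift prod.distrib prod_constant) simp
qed

text \<open>The neighbourhood of any vertex contains no \<open>k\<close> completely joined sets of
  size \<open>t\<close>, so \<open>generalized_turan_multipartite\<close> with
  \<open>q = k - 1\<close> bounds its cliques. For a vertex of low degree the result is at most
  \<open>p * (n - 1) ^ s\<close>, and \<open>r\<close> times this is what the main term gains when
  the vertex is put back.\<close>

lemma cone_free_clique_count:
  assumes k: "2 \<le> r" "r \<le> k" and t: "1 \<le> t"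
  shows "\<exists>C\<ge>0. \<forall>(E :: 'a \<Rightarrow> 'a \<Rightarrow> bool) V. adjacency E \<longrightarrow> finite V \<longrightarrow> adjacency.cone_free E V k t \<longrightarrow>
    adjacency.ordered_cliques E V r \<le> (\<Prod>j<r. 1 - real j / real k) * real (card V) ^ r + C * real (card V) ^ (r - 1)"
proof -
  define s where "s = r - 1"
  have s: "r = Suc s" "1 \<le> s" "s < k" using k by (auto simp: s_def)
  have k2: "2 \<le> k" using k by simp
  have k1: "1 \<le> k - 1" and k1': "s \<le> Suc (k - 1)" using k2 s by auto
  define p where "p = (\<Prod>j<r. 1 - real j / real k)"
  define p' where "p' = (\<Prod>j<s. 1 - real j / real (k - 1))"
  define a where "a = 1 - 1 / real k"
  have p: "p = a ^ s * p'" unfolding p_def p'_def a_def s(1) by (rule falling_prod_Suc[OF k2])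
  have p'0: "0 < p'" unfolding p'_def using s k2 by (intro prod_pos) (auto simp: field_simps of_nat_diff)
  have p0: "0 \<le> p" unfolding p_def using k by (intro prod_nonneg) (auto simp: field_simps)
  obtain \<epsilon> n1 where \<epsilon>: "0 < \<epsilon>" "\<epsilon> < 1 - 1 / real k" and n1: "\<forall>(E :: 'a \<Rightarrow> 'a \<Rightarrow> bool) V. adjacency E \<longrightarrow> finite V \<longrightarrow> n1 \<le> card V \<longrightarrow>
    adjacency.cone_free E V k t \<longrightarrow>
    (\<forall>x\<in>V. (1 - 1 / real k - \<epsilon>) * real (card V) \<le> real (card (adjacency.nbrs E V x))) \<longrightarrow>
    (\<exists>c. (\<forall>w\<in>V. c w < k) \<and> (\<forall>w\<in>V. card {x \<in> V. E w x \<and> c x = c w} < t))"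
    using cone_free_colouring[OF k2 t] by (elim exE conjE)
  \<comment> \<open>One \<open>e\<close> pays for the error term in the neighbourhood, a second one
    for passing from \<open>n ^ s\<close> to \<open>(n - 1) ^ s\<close>.\<close>
  define e where "e = (p - p' * (a - \<epsilon>) ^ s) / 2"
  have "(a - \<epsilon>) ^ s < a ^ s" using \<epsilon> s by (intro power_strict_mono) (auto simp: a_def)
  then have e: "0 < e" using p'0 p by (simp add: e_def mult.commute)
  obtain n2 where n2: "\<forall>(E :: 'a \<Rightarrow> 'a \<Rightarrow> bool) U V. adjacency E \<longrightarrow> finite V \<longrightarrow> U \<subseteq> V \<longrightarrow> n2 \<le> card V \<longrightarrow>
    (\<nexists>A. adjacency.multipartite E U (Suc (k - 1)) t A) \<longrightarrow>
    adjacency.ordered_cliques E U s \<le> (\<Prod>j<s. 1 - real j / real (k - 1)) * real (card U) ^ s + e * real (card V) ^ s"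
    using generalized_turan_multipartite[OF k1 s(2) k1' e, of t] ..
  \<comment> \<open>Below \<open>n0\<close> the trivial bound \<open>n * n ^ s\<close> is absorbed
    by \<open>C\<close>. From \<open>p * s / e\<close> on, Bernoulli's inequality gives
    \<open>(p - e) * n ^ s \<le> p * (n - 1) ^ s\<close>.\<close>
  define n0 where "n0 = max (max n1 n2) (max 1 (nat \<lceil>p * real s / e\<rceil>))"
  define C where "C = max (real n0) (fact r * real t)"
  have C: "0 \<le> C" "real n0 \<le> C" "fact r * real t \<le> C" by (auto simp: C_def)
  have "adjacency.ordered_cliques E V r \<le> p * real (card V) ^ r + C * real (card V) ^ s"
    if E: "adjacency E" and V: "finite V" "adjacency.cone_free E V k t" for E :: "'a \<Rightarrow> 'a \<Rightarrow> bool" and V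
    using V
  proof (induction "card V" arbitrary: V rule: less_induct)
    case less
    interpret adjacency E by fact
    define n where "n = real (card V)"
    consider "card V < n0" | "n0 \<le> card V" "\<exists>v\<in>V. real (card (nbrs V v)) < (a - \<epsilon>) * n"
      | "n0 \<le> card V" "\<not> (\<exists>v\<in>V. real (card (nbrs V v)) < (a - \<epsilon>) * n)"
      using leI[of "card V" n0] by blast
    then show ?case
    proof cases
      case 1
      have "ordered_cliques V r \<le> n * n ^ s" using ordered_cliques_le[OF less(2), of r] by (simp add: n_def s)
      also have "\<dots> \<le> C * n ^ s" using 1 C by (intro mult_right_mono) (auto simp: n_def)
      also have "\<dots> \<le> p * n ^ r + C * n ^ s" using p0 by (simp add: n_def)
      finally show ?thesis by (simp add: n_def)
    next
      case 2
      then obtain v where v: "v \<in> V" "real (card (nbrs V v)) < (a - \<epsilon>) * n" by auto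
      have n: "1 \<le> n" "p * real s / e \<le> n" using 2(1) unfolding n0_def n_def by linarith+
      have cV: "real (card (V - {v})) = n - 1" using v less(2) n by (simp add: n_def of_nat_diff)
      have "card (V - {v}) < card V" by (rule card_Diff1_less[OF less(2) v(1)])
      then have IH: "ordered_cliques (V - {v}) r \<le> p * (n - 1) ^ r + C * (n - 1) ^ s"
        using less(1)[of "V - {v}"] less(2) cone_free_mono[OF less(3), of "V - {v}"] cV by auto
      have "ordered_cliques (nbrs V v) s \<le> p' * real (card (nbrs V v)) ^ s + e * n ^ s"
        unfolding p'_def n_def
      proof (rule n2[rule_format, OF E less(2)])
        show "nbrs V v \<subseteq> V" by (auto simp: nbrs_def)
        show "n2 \<le> card V" using 2(1) by (simp add: n0_def)
        show "\<nexists>A. multipartite (nbrs V v) (Suc (k - 1)) t A" using less(3) v k2 by (simp add: cone_free_def)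
      qed
      also have "\<dots> \<le> p' * ((a - \<epsilon>) * n) ^ s + e * n ^ s"
        using v p'0 by (intro add_right_mono mult_left_mono power_mono) auto
      also have "\<dots> = (p' * (a - \<epsilon>) ^ s + e) * n ^ s" by (simp only: power_mult_distrib distrib_right mult.assoc)
      also have "p' * (a - \<epsilon>) ^ s + e = p - e" by (simp add: e_def field_simps)
      finally have nb: "ordered_cliques (nbrs V v) s \<le> (p - e) * n ^ s" .
      have "p * (real s / n) \<le> e" using n(2) e n(1) by (simp add: field_simps)
      then have "p - e \<le> p * (1 - real s / n)" by (simp add: algebra_simps)
      also have "\<dots> \<le> p * (1 - 1 / n) ^ s"
        using Bernoulli_inequality[of "- (1 / n)" s] n(1) p0 by (intro mult_left_mono) (auto simp: field_simps)
      finally have "(p - e) * n ^ s \<le> p * (1 - 1 / n) ^ s * n ^ s" using n by (intro mult_right_mono) auto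
      also have "\<dots> = p * ((1 - 1 / n) * n) ^ s" by (simp only: power_mult_distrib mult.assoc)
      also have "(1 - 1 / n) * n = n - 1" using n by (simp add: field_simps)
      finally have "(p - e) * n ^ s \<le> p * (n - 1) ^ s" .
      then have nb': "real r * ordered_cliques (nbrs V v) s \<le> real r * (p * (n - 1) ^ s)"
        using nb by (intro mult_left_mono) auto
      have "ordered_cliques V r = ordered_cliques (V - {v}) r + real r * ordered_cliques (nbrs V v) s"
        using ordered_cliques_remove_vertex[OF less(2) v(1), of s] by (simp only: s(1))
      also have "\<dots> \<le> p * ((n - 1) ^ Suc s + real (Suc s) * (n - 1) ^ s) + C * (n - 1) ^ s"
        using IH nb' unfolding s(1) by (simp add: algebra_simps)
      also have "\<dots> \<le> p * (n - 1 + 1) ^ Suc s + C * n ^ s"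
        using power_Suc_diff_ge[of "n - 1" s] n p0 C by (intro add_mono mult_left_mono power_mono) auto
      finally show ?thesis by (simp add: n_def s(1))
    next
      case 3
      have "n1 \<le> card V" using 3(1) by (simp add: n0_def)
      moreover have "\<forall>x\<in>V. (1 - 1 / real k - \<epsilon>) * real (card V) \<le> real (card (nbrs V x))"
        using 3(2) unfolding n_def a_def by (simp add: not_less)
      ultimately have "\<exists>c. (\<forall>w\<in>V. c w < k) \<and> (\<forall>w\<in>V. card {x \<in> V. E w x \<and> c x = c w} < t)"
        using n1[THEN spec, THEN spec, THEN mp, THEN mp, THEN mp, THEN mp, THEN mp, OF E less(2) _ less(3)] by blast
      then obtain c where c: "\<forall>w\<in>V. c w < k" "\<forall>w\<in>V. card {x \<in> V. E w x \<and> c x = c w} < t"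
        by (elim exE conjE)
      have "ordered_cliques V r \<le> p * n ^ r + fact r * real t * n ^ s"
        unfolding p_def n_def s_def
        by (rule ordered_cliques_coloured[OF less(2), where c = c]) (use k c in \<open>auto intro: less_imp_le\<close>)
      also have "\<dots> \<le> p * n ^ r + C * n ^ s" using C by (intro add_left_mono mult_right_mono) (auto simp: n_def)
      finally show ?thesis by (simp add: n_def)
    qed
  qed
  then show ?thesis using C(1) unfolding p_def s_def by (intro exI[of _ C] conjI allI impI)
qed

section \<open>From hypergraphs to graphs\<close>

text \<open>The pairs in \<open>P\<close> become light one after the other, so \<open>P\<close> is found as a maximal set of this kind.\<close>
lemma light_pairs:
  fixes H :: "'b set set"
  assumes V: "finite V" and H: "\<forall>e\<in>H. e \<subseteq> V"
  shows "\<exists>P. P \<subseteq> {p. p \<subseteq> V \<and> card p = 2} \<and>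
    card H \<le> card {e \<in> H. \<forall>p\<in>P. \<not> p \<subseteq> e} + card P * b \<and>
    (\<forall>q. q \<subseteq> V \<longrightarrow> card q = 2 \<longrightarrow> q \<notin> P \<longrightarrow> b < card {e \<in> {e \<in> H. \<forall>p\<in>P. \<not> p \<subseteq> e}. q \<subseteq> e})"
proof -
  have finH: "finite H" by (rule finite_subset[of _ "Pow V"]) (use V H in auto)
  define R where "R P = {e \<in> H. \<forall>p\<in>P. \<not> p \<subseteq> e}" for P
  let ?pairs = "{p. p \<subseteq> V \<and> card p = 2}"
  define \<P> where "\<P> = {P. P \<subseteq> ?pairs \<and> card H \<le> card (R P) + card P * b}"
  have fpairs: "finite ?pairs" using V by simp
  then have "finite \<P>" by (auto simp: \<P>_def intro: finite_subset[of _ "Pow ?pairs"])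
  moreover have "{} \<in> \<P>" by (auto simp: \<P>_def R_def)
  ultimately obtain P where P: "P \<in> \<P>" and max: "\<And>Q. Q \<in> \<P> \<Longrightarrow> P \<subseteq> Q \<Longrightarrow> P = Q"
    by (metis empty_iff finite_has_maximal)
  \<comment> \<open>Otherwise \<open>q\<close> could join \<open>P\<close>: it removes at most
    \<open>b\<close> sets from \<open>R P\<close> and raises the budget by \<open>b\<close>, against
    maximality.\<close>
  have "b < card {e \<in> R P. q \<subseteq> e}" if q: "q \<subseteq> V" "card q = 2" "q \<notin> P" for q
  proof (rule ccontr)
    assume "\<not> ?thesis"
    then have le: "card {e \<in> R P. q \<subseteq> e} \<le> b" by simp
    have finP: "finite P" using P fpairs by (auto simp: \<P>_def intro: finite_subset)
    have "R P = R (insert q P) \<union> {e \<in> R P. q \<subseteq> e}" by (auto simp: R_def)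
    then have "card (R P) \<le> card (R (insert q P)) + card {e \<in> R P. q \<subseteq> e}" by (metis card_Un_le)
    moreover have "card H \<le> card (R P) + card P * b" using P by (simp add: \<P>_def)
    ultimately have "card H \<le> card (R (insert q P)) + card (insert q P) * b"
      using le q finP by (simp add: algebra_simps)
    then have "insert q P \<in> \<P>" using P q by (auto simp: \<P>_def)
    then show False using max[of "insert q P"] q by blast
  qed
  then show ?thesis using P by (intro exI[of _ P]) (auto simp: \<P>_def R_def)
qed

lemma finite_edges: "r_graph r F \<Longrightarrow> finite (edges F)"
  by (rule finite_subset[of _ "Pow (verts F)"]) (auto simp: r_graph_def)

text \<open>The edges are served one at a time. An already used vertex outside the image of
  \<open>e\<close> forms a triple with that image, and a triple lies in at most
  \<open>card V ^ (r - 3)\<close> sets of size \<open>r\<close>; \<open>heavy\<close> exceeds this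
  times the number of used vertices, so some hyperedge avoids them all.\<close>

lemma disjoint_extensions:
  fixes f :: "'a \<Rightarrow> 'b"
  assumes F: "r_graph 2 F" and r: "3 \<le> r" and V: "finite V" and f: "inj_on f (verts F)" "f ` verts F \<subseteq> V"
    and H: "\<forall>h\<in>H. h \<subseteq> V \<and> card h = r"
    and heavy: "\<forall>e\<in>edges F. (card (verts F) + (r - 2) * card (edges F)) * card V ^ (r - 3) < card {h \<in> H. f ` e \<subseteq> h}"
    and D: "finite D" "D \<subseteq> edges F"
  shows "\<exists>A. \<forall>e\<in>D. A e \<in> H \<and> f ` e \<subseteq> A e \<and> (A e - f ` e) \<inter> f ` verts F = {} \<and>
    (\<forall>e'\<in>D. e \<noteq> e' \<longrightarrow> (A e - f ` e) \<inter> (A e' - f ` e') = {})"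
  using D
proof (induction D rule: finite_induct)
  case empty
  then show ?case by simp
next
  case (insert e D)
  then obtain A where A: "\<forall>e\<in>D. A e \<in> H \<and> f ` e \<subseteq> A e \<and> (A e - f ` e) \<inter> f ` verts F = {} \<and>
    (\<forall>e'\<in>D. e \<noteq> e' \<longrightarrow> (A e - f ` e) \<inter> (A e' - f ` e') = {})" by auto
  have finF: "finite (verts F)" using F by (simp add: r_graph_def)
  have cardf: "card (f ` e) = 2" "finite e" "e \<subseteq> verts F" if "e \<in> edges F" for e
  proof -
    show "e \<subseteq> verts F" using F that by (auto simp: r_graph_def)
    then show "finite e" using finF finite_subset by blast
    have "inj_on f e" using f(1) \<open>e \<subseteq> verts F\<close> by (rule inj_on_subset)
    then show "card (f ` e) = 2" using F that by (simp add: card_image r_graph_def)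
  qed
  have finA: "finite (A e')" if "e' \<in> D" for e' using A H V that finite_subset by metis
  define X where "X = f ` verts F \<union> (\<Union>e'\<in>D. A e' - f ` e')"
  have finX: "finite X" using finF finA insert.hyps by (auto simp: X_def)
  have "card X \<le> card (f ` verts F) + card (\<Union>e'\<in>D. A e' - f ` e')" unfolding X_def by (rule card_Un_le)
  also have "\<dots> \<le> card (verts F) + (\<Sum>e'\<in>D. card (A e' - f ` e'))"
    using finF by (intro add_mono card_image_le card_UN_le insert.hyps)
  also have "(\<Sum>e'\<in>D. card (A e' - f ` e')) = (\<Sum>e'\<in>D. r - 2)"
  proof (rule sum.cong[OF refl])
    fix e' assume e': "e' \<in> D"
    then have "e' \<in> edges F" using insert.prems by auto
    then show "card (A e' - f ` e') = r - 2"
      using A H e' cardf[of e'] by (subst card_Diff_subset) auto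
  qed
  also have "\<dots> = (r - 2) * card D" by simp
  also have "\<dots> \<le> (r - 2) * card (edges F)"
    using insert.prems finite_edges[OF F] by (intro mult_left_mono card_mono) auto
  finally have cX: "card X \<le> card (verts F) + (r - 2) * card (edges F)" by simp
  have e: "e \<in> edges F" using insert.prems by simp
  have "\<exists>h\<in>H. f ` e \<subseteq> h \<and> (h - f ` e) \<inter> X = {}"
  proof (rule ccontr)
    assume no: "\<not> ?thesis"
    define B where "B x = {h. h \<subseteq> V \<and> card h = r \<and> insert x (f ` e) \<subseteq> h}" for x
    have "{h \<in> H. f ` e \<subseteq> h} \<subseteq> (\<Union>x\<in>X - f ` e. B x)"
    proof
      fix h assume h: "h \<in> {h \<in> H. f ` e \<subseteq> h}"
      then have "(h - f ` e) \<inter> X \<noteq> {}" using no by simp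
      then obtain x where "x \<in> h" "x \<notin> f ` e" "x \<in> X" by auto
      then show "h \<in> (\<Union>x\<in>X - f ` e. B x)" using h H by (auto simp: B_def)
    qed
    then have "card {h \<in> H. f ` e \<subseteq> h} \<le> card (\<Union>x\<in>X - f ` e. B x)"
      using finX V by (intro card_mono) (auto simp: B_def)
    also have "\<dots> \<le> (\<Sum>x\<in>X - f ` e. card (B x))" using finX by (intro card_UN_le) auto
    also have "\<dots> \<le> (\<Sum>x\<in>X - f ` e. card V ^ (r - 3))"
    proof (rule sum_mono)
      fix x assume "x \<in> X - f ` e"
      then have "card (insert x (f ` e)) = 3" "finite (insert x (f ` e))" using cardf[OF e] by auto
      then show "card (B x) \<le> card V ^ (r - 3)"
        using card_supersets_le_power[OF V, of "insert x (f ` e)" r] unfolding B_def by metis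
    qed
    also have "\<dots> \<le> card X * card V ^ (r - 3)"
      using finX by (simp add: mult_right_mono card_mono)
    also have "\<dots> \<le> (card (verts F) + (r - 2) * card (edges F)) * card V ^ (r - 3)"
      using cX by (intro mult_right_mono) auto
    finally show False using heavy e by fastforce
  qed
  then obtain h where h: "h \<in> H" "f ` e \<subseteq> h" "(h - f ` e) \<inter> X = {}" by blast
  have hD: "(h - f ` e) \<inter> (A e' - f ` e') = {}" if "e' \<in> D" for e' using h(3) that by (auto simp: X_def)
  show ?case
  proof (rule exI[of _ "A(e := h)"], intro ballI)
    fix a assume "a \<in> insert e D"
    then consider "a = e" | "a \<in> D" "a \<noteq> e" by auto
    then show "(A(e := h)) a \<in> H \<and> f ` a \<subseteq> (A(e := h)) a \<and> ((A(e := h)) a - f ` a) \<inter> f ` verts F = {} \<and>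
       (\<forall>e'\<in>insert e D. a \<noteq> e' \<longrightarrow> ((A(e := h)) a - f ` a) \<inter> ((A(e := h)) e' - f ` e') = {})"
    proof cases
      case 1
      have "(h - f ` e) \<inter> f ` verts F = {}" using h(3) unfolding X_def by blast
      then show ?thesis using 1 h hD by auto
    next
      case 2
      have "(A a - f ` a) \<inter> (h - f ` e) = {}" using hD[OF 2(1)] by blast
      then show ?thesis using 2 A by simp
    qed
  qed
qed

text \<open>The hyperedge chosen for \<open>e\<close> has exactly \<open>r - 2\<close> vertices
  outside the image of \<open>e\<close>, and these receive the new vertices of
  \<open>e\<close>.\<close>

lemma contains_expansion:
  fixes f :: "'a \<Rightarrow> 'b"
  assumes F: "r_graph 2 F" and r: "3 \<le> r" and V: "finite V" and f: "inj_on f (verts F)" "f ` verts F \<subseteq> V"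
    and H: "\<forall>h\<in>H. h \<subseteq> V \<and> card h = r"
    and heavy: "\<forall>e\<in>edges F. (card (verts F) + (r - 2) * card (edges F)) * card V ^ (r - 3) < card {h \<in> H. f ` e \<subseteq> h}"
  shows "contains_copy (V, H) (expansion r F)"
proof -
  obtain A where A: "\<And>e. e \<in> edges F \<Longrightarrow> A e \<in> H" "\<And>e. e \<in> edges F \<Longrightarrow> f ` e \<subseteq> A e"
     "\<And>e. e \<in> edges F \<Longrightarrow> (A e - f ` e) \<inter> f ` verts F = {}"
     "\<And>e e'. e \<in> edges F \<Longrightarrow> e' \<in> edges F \<Longrightarrow> e \<noteq> e' \<Longrightarrow> (A e - f ` e) \<inter> (A e' - f ` e') = {}"
    using disjoint_extensions[OF F r V f H heavy finite_edges[OF F] subset_refl] by metis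
  have sub: "e \<subseteq> verts F" if "e \<in> edges F" for e using F that by (auto simp: r_graph_def)
  have "\<exists>b. bij_betw b {..<r - 2} (A e - f ` e)" if e: "e \<in> edges F" for e
  proof -
    have "inj_on f e" using f(1) sub[OF e] by (rule inj_on_subset)
    then have "card (f ` e) = 2" using F e by (simp add: card_image r_graph_def)
    moreover have "finite (f ` e)" using sub[OF e] F by (auto simp: r_graph_def intro: finite_subset)
    ultimately have c: "card (A e - f ` e) = r - 2" using A(1,2)[OF e] H by (simp add: card_Diff_subset)
    have "finite (A e - f ` e)" using A(1)[OF e] H V by (meson finite_Diff finite_subset)
    then show ?thesis using ex_bij_betw_nat_finite[of "A e - f ` e"] c by (simp add: atLeast0LessThan)
  qed
  then obtain b where b: "\<And>e. e \<in> edges F \<Longrightarrow> bij_betw (b e) {..<r - 2} (A e - f ` e)" by metis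
  define g where "g = case_sum f (\<lambda>(e, j). b e j)"
  have gl: "g (Inl v) = f v" and gr: "g (Inr (e, j)) = b e j" for v e j by (simp_all add: g_def)
  have bmem: "b e j \<in> A e - f ` e" if "e \<in> edges F" "j < r - 2" for e j
    using b[OF that(1)] that(2) by (auto simp: bij_betw_def)
  have "inj_on g (verts (expansion r F))"
  proof (rule inj_onI)
    fix x y assume xy: "x \<in> verts (expansion r F)" "y \<in> verts (expansion r F)" "g x = g y"
    have nlr: "f v \<noteq> b e j" if "v \<in> verts F" "e \<in> edges F" "j < r - 2" for v e j
    proof -
      have "b e j \<notin> f ` verts F" using bmem[OF that(2,3)] A(3)[OF that(2)] by blast
      then show ?thesis using that(1) by (metis imageI)
    qed
    have rr: "e = e' \<and> j = j'" if "e \<in> edges F" "j < r - 2" "e' \<in> edges F" "j' < r - 2" "b e j = b e' j'" for e j e' j'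
    proof -
      have "e = e'" using bmem[OF that(1,2)] bmem[OF that(3,4)] A(4)[OF that(1,3)] that(5) by auto
      then show ?thesis using b[OF that(1)] that by (auto simp: bij_betw_def inj_on_def)
    qed
    from xy(1,2) show "x = y"
      using xy(3) f(1) nlr rr
      by (auto simp: expansion_def gl gr dest: inj_onD) (metis nlr)+
  qed
  moreover have "g ` verts (expansion r F) \<subseteq> V"
  proof -
    have "b e j \<in> V" if "e \<in> edges F" "j < r - 2" for e j
      using bmem[OF that] A(1)[OF that(1)] H by auto
    then show ?thesis using f(2) by (auto simp: expansion_def gl gr)
  qed
  moreover have "g ` e \<in> H" if "e \<in> edges (expansion r F)" for e
  proof -
    from that have "\<exists>e0. e = Inl ` e0 \<union> Inr ` ({e0} \<times> {..<r - 2}) \<and> e0 \<in> edges F"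
      by (simp add: expansion_def)
    then obtain e0 where e0: "e0 \<in> edges F" "e = Inl ` e0 \<union> Inr ` ({e0} \<times> {..<r - 2})"
      by (elim exE conjE)
    have "g ` e = f ` e0 \<union> b e0 ` {..<r - 2}"
      unfolding e0(2) image_Un image_image gl by (auto simp: gr image_iff)
    also have "\<dots> = A e0" using b[OF e0(1)] A(2)[OF e0(1)] by (auto simp: bij_betw_def)
    finally show ?thesis using A(1)[OF e0(1)] by simp
  qed
  ultimately show ?thesis unfolding contains_copy_def by (intro exI[of _ g]) simp
qed

section \<open>Consequences of bounded and nonzero biex for colourings of F\<close>

text \<open>Giving the classes \<open>a\<close> and \<open>b\<close> one common colour, and
  renumbering, makes only the edges between these two classes monochromatic. Facts about a member of
  the decomposition family thereby become facts about a colouring with \<open>k\<close>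
  colours.\<close>

lemma merge_colours:
  assumes F: "r_graph 2 F" and c: "proper_colouring F (Suc k) c" and ab: "a < Suc k" "b < Suc k" "a \<noteq> b"
  shows "\<exists>c'. c' \<in> verts F \<rightarrow> {..<k} \<and> (\<forall>u v. {u, v} \<in> edges F \<longrightarrow> c' u = c' v \<longrightarrow> {c u, c v} = {a, b})"
proof -
  have "card ({..<Suc k} - {b}) = card {..<k}" using ab by simp
  then obtain h where h: "bij_betw h ({..<Suc k} - {b}) {..<k}"
    using finite_same_card_bij[of "{..<Suc k} - {b}" "{..<k}"] by auto
  define m where "m i = (if i = b then a else i)" for i
  have mem: "m (c v) \<in> {..<Suc k} - {b}" if "v \<in> verts F" for v
    using c that ab by (auto simp: m_def proper_colouring_def)
  show ?thesis
  proof (intro exI[of _ "\<lambda>v. h (m (c v))"] conjI allI impI)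
    show "(\<lambda>v. h (m (c v))) \<in> verts F \<rightarrow> {..<k}" using mem h by (auto simp: bij_betw_def)
    fix u v assume e: "{u, v} \<in> edges F" and eq: "h (m (c u)) = h (m (c v))"
    have uv: "u \<in> verts F" "v \<in> verts F" using e F by (auto simp: r_graph_def)
    have "m (c u) = m (c v)" using eq mem[OF uv(1)] mem[OF uv(2)] h by (metis bij_betw_def inj_onD)
    moreover have "c u \<noteq> c v" using c e by (auto simp: proper_colouring_def)
    ultimately show "{c u, c v} = {a, b}" by (auto simp: m_def split: if_splits)
  qed
qed

lemma no_smaller_colouring:
  assumes "chromatic_number F = Suc k"
  shows "\<not> proper_colouring F k c"
proof
  assume "proper_colouring F k c"
  then have "chromatic_number F \<le> k" unfolding chromatic_number_def by (intro Least_le) blast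
  then show False using assms by simp
qed

lemma finite_ex_set:
  "finite {card (edges G) | G :: nat hypergraph. r_graph r G \<and> verts G = {..<n} \<and> (\<forall>H\<in>\<F>. \<not> contains_copy G H)}"
proof (rule finite_subset)
  show "{card (edges G) | G :: nat hypergraph. r_graph r G \<and> verts G = {..<n} \<and> (\<forall>H\<in>\<F>. \<not> contains_copy G H)}
      \<subseteq> {..card (Pow {..<n})}"
    by (force simp: r_graph_def intro!: card_mono)
qed simp

lemma card_edges_le_ex:
  assumes "r_graph r G" "verts G = {..<n}" "\<forall>H\<in>\<F>. \<not> contains_copy G H"
  shows "card (edges G) \<le> ex r n \<F>"
  unfolding ex_def by (rule Max_ge[OF finite_ex_set]) (use assms in blast)

text \<open>The given \<open>G\<close> makes the set under \<open>Max\<close> nonempty, so that its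
  maximum is one of its members.\<close>

lemma ex_attained:
  assumes "r_graph r G" "verts G = {..<n}" "\<forall>H\<in>\<F>. \<not> contains_copy G H"
  shows "\<exists>G'. r_graph r G' \<and> verts G' = {..<n} \<and> (\<forall>H\<in>\<F>. \<not> contains_copy G' H) \<and> card (edges G') = ex r n \<F>"
proof -
  have "ex r n \<F> \<in> {card (edges G) | G :: nat hypergraph. r_graph r G \<and> verts G = {..<n} \<and> (\<forall>H\<in>\<F>. \<not> contains_copy G H)}"
    unfolding ex_def by (rule Max_in[OF finite_ex_set]) (use assms in blast)
  then show ?thesis by force
qed

text \<open>The set \<open>D\<close> omits exactly two of the \<open>Suc k\<close> colours; these
  are \<open>a\<close> and \<open>b\<close>.\<close>

lemma decomposition_family_colours:
  assumes chi: "chromatic_number F = Suc k" and k: "1 \<le> k" and M: "M \<in> decomposition_family F"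
  shows "\<exists>c a b. proper_colouring F (Suc k) c \<and> a < Suc k \<and> b < Suc k \<and> a \<noteq> b \<and>
    (\<forall>u v. {u, v} \<in> edges F \<longrightarrow> {c u, c v} = {a, b} \<longrightarrow> {u, v} \<in> edges M)"
proof -
  obtain c D where cD: "proper_colouring F (Suc k) c" "D \<subseteq> {..<Suc k}" "card D = k - 1"
    "M = delete_verts F {v \<in> verts F. c v \<in> D}"
    using M chi by (auto simp: decomposition_family_def)
  have "card ({..<Suc k} - D) = 2" using cD k by (simp add: card_Diff_subset finite_subset[of D])
  then obtain a b where ab: "{..<Suc k} - D = {a, b}" "a \<noteq> b" by (auto simp: card_2_iff)
  have "{u, v} \<in> edges M" if "{u, v} \<in> edges F" "{c u, c v} = {a, b}" for u v
  proof -
    have "c u \<notin> D" "c v \<notin> D" using that(2) ab(1) by blast+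
    then show ?thesis using that(1) by (simp add: cD(4) delete_verts_def)
  qed
  moreover have "a < Suc k" "b < Suc k" using ab by auto
  ultimately show ?thesis using cD(1) ab(2) by blast
qed

text \<open>Take for \<open>x0\<close> the vertex of \<open>M\<close> mapped to the centre of the
  star, or any vertex if \<open>M\<close> has no edges: it lies on every edge of \<open>M\<close>.
  After merging the two classes of \<open>M\<close>, only edges at \<open>x0\<close> are
  monochromatic.\<close>

lemma colouring_without_vertex:
  assumes F: "r_graph 2 F" and chi: "chromatic_number F = Suc k" and k: "1 \<le> k"
    and bi: "biex n F < n - 1"
  shows "\<exists>x0 c. c \<in> verts F \<rightarrow> {..<k} \<and> (\<forall>u v. {u, v} \<in> edges F \<longrightarrow> u \<noteq> x0 \<longrightarrow> v \<noteq> x0 \<longrightarrow> c u \<noteq> c v)"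
proof -
  define G :: "nat hypergraph" where "G = ({..<n}, (\<lambda>i. {0, i}) ` {1..<n})"
  have "inj_on (\<lambda>i. {0, i}) {1..<n}" by (auto simp: inj_on_def doubleton_eq_iff)
  then have "card (edges G) = n - 1" by (simp add: G_def card_image)
  then have "\<not> card (edges G) \<le> ex 2 n (decomposition_family F)" using bi by (simp add: biex_def)
  moreover have "r_graph 2 G" "verts G = {..<n}" by (auto simp: G_def r_graph_def)
  ultimately obtain M where M: "M \<in> decomposition_family F" "contains_copy G M"
    using card_edges_le_ex by blast
  then obtain f where f: "inj_on f (verts M)" "\<And>e. e \<in> edges M \<Longrightarrow> f ` e \<in> edges G"
    by (auto simp: contains_copy_def)
  have sub: "e \<subseteq> verts M" if "e \<in> edges M" for e
  proof -
    obtain X where "M = delete_verts F X" using M(1) by (auto simp: decomposition_family_def)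
    then have "e \<in> edges F" "e \<inter> X = {}" "verts M = verts F - X" using that by (auto simp: delete_verts_def)
    then show ?thesis using F by (fastforce simp: r_graph_def)
  qed
  have "\<exists>x0. \<forall>e\<in>edges M. x0 \<in> e"
  proof (cases "edges M = {}")
    case False
    have z: "\<exists>x\<in>e. f x = 0" if "e \<in> edges M" for e
    proof -
      have "0 \<in> f ` e" using f(2)[OF that] by (auto simp: G_def)
      then show ?thesis by auto
    qed
    obtain e0 where "e0 \<in> edges M" using False by auto
    then obtain x0 where x0: "x0 \<in> verts M" "f x0 = 0" using z sub by blast
    have "x0 \<in> e" if "e \<in> edges M" for e
    proof -
      have "\<exists>x\<in>e. f x = 0" by (rule z[OF that])
      then obtain x where "x \<in> e" "f x = 0" by blast
      then show ?thesis using x0 f(1) sub[OF that] by (metis inj_onD subsetD)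
    qed
    then show ?thesis by blast
  qed auto
  then obtain x0 where x0: "\<And>e. e \<in> edges M \<Longrightarrow> x0 \<in> e" by blast
  obtain c a b where c: "proper_colouring F (Suc k) c" "a < Suc k" "b < Suc k" "a \<noteq> b"
    "\<And>u v. {u, v} \<in> edges F \<Longrightarrow> {c u, c v} = {a, b} \<Longrightarrow> {u, v} \<in> edges M"
    using decomposition_family_colours[OF chi k M(1)] by metis
  obtain c' where c': "c' \<in> verts F \<rightarrow> {..<k}" "\<And>u v. {u, v} \<in> edges F \<Longrightarrow> c' u = c' v \<Longrightarrow> {c u, c v} = {a, b}"
    using merge_colours[OF F c(1-4)] by metis
  have "c' u \<noteq> c' v" if "{u, v} \<in> edges F" "u \<noteq> x0" "v \<noteq> x0" for u v
    using c'(2)[OF that(1)] c(5)[OF that(1)] x0 that by blast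
  then show ?thesis using c'(1) by blast
qed

text \<open>If \<open>e = {u, v}\<close> were the only monochromatic edge, moving \<open>u\<close>
  to the new colour \<open>k\<close> would make the colouring proper, with \<open>e\<close> as the
  only edge between the classes \<open>k\<close> and \<open>c u\<close>. The corresponding member of
  the decomposition family is one edge plus isolated vertices; it embeds in every graph with an edge
  on at least \<open>card (verts F)\<close> vertices, whereas \<open>1 \<le> biex n F\<close>
  provides such a graph avoiding it.\<close>

lemma not_colourable_without_edge:
  assumes F: "r_graph 2 F" and chi: "chromatic_number F = Suc k" and k: "1 \<le> k"
    and bi: "1 \<le> biex n F" and n: "card (verts F) \<le> n" and c: "c \<in> verts F \<rightarrow> {..<k}"
  shows "\<exists>u v. {u, v} \<in> edges F \<and> {u, v} \<noteq> e \<and> c u = c v"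
proof (rule ccontr)
  assume "\<not> ?thesis"
  then have proper: "\<And>x y. {x, y} \<in> edges F \<Longrightarrow> {x, y} \<noteq> e \<Longrightarrow> c x \<noteq> c y" by blast
  have finF: "finite (verts F)" using F by (simp add: r_graph_def)
  have "\<not> proper_colouring F k c" by (rule no_smaller_colouring[OF chi])
  then obtain u v where uv: "{u, v} \<in> edges F" "c u = c v" using c by (auto simp: proper_colouring_def)
  then have e: "e = {u, v}" using proper by blast
  have uvF: "u \<in> verts F" "v \<in> verts F" "u \<noteq> v" using uv F by (auto simp: r_graph_def)
  have ck: "c x < k" if "x \<in> verts F" for x using c that by auto
  define c2 where "c2 = c(u := k)"
  have c2u: "c2 x = k \<longleftrightarrow> x = u" if "x \<in> verts F" for x using ck[OF that] by (auto simp: c2_def)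
  have "proper_colouring F (Suc k) c2"
    unfolding proper_colouring_def
  proof (intro conjI allI impI)
    show "c2 \<in> verts F \<rightarrow> {..<Suc k}" using ck by (auto simp: c2_def less_Suc_eq)
    fix x y assume xy: "{x, y} \<in> edges F"
    then have V: "x \<in> verts F" "y \<in> verts F" "x \<noteq> y" using F by (auto simp: r_graph_def)
    show "c2 x \<noteq> c2 y"
    proof (cases "x = u \<or> y = u")
      case True
      then show ?thesis using c2u[OF V(1)] c2u[OF V(2)] V(3) by auto
    next
      case False
      then have "{x, y} \<noteq> e" using e by auto
      then show ?thesis using proper[OF xy] False by (simp add: c2_def)
    qed
  qed
  moreover define D where "D = {..<Suc k} - {k, c u}"
  moreover have "card D = Suc k - 2" using ck[OF uvF(1)] by (simp add: D_def card_Diff_subset)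
  moreover define M where "M = delete_verts F {x \<in> verts F. c2 x \<in> D}"
  ultimately have M: "M \<in> decomposition_family F"
    unfolding decomposition_family_def chi by blast
  have edgesM: "e' = e" if "e' \<in> edges M" for e'
  proof (rule ccontr)
    assume ne: "e' \<noteq> e"
    have e': "e' \<in> edges F" "e' \<inter> {x \<in> verts F. c2 x \<in> D} = {}" using that by (auto simp: M_def delete_verts_def)
    then obtain x y where xy: "e' = {x, y}" "x \<noteq> y" using F by (auto simp: r_graph_def card_2_iff)
    have V: "x \<in> verts F" "y \<in> verts F" using e' xy F by (auto simp: r_graph_def)
    have "c2 x \<notin> D" "c2 y \<notin> D" using e' xy V by auto
    moreover have "c2 x < Suc k" "c2 y < Suc k" using ck V by (auto simp: c2_def less_Suc_eq)
    ultimately have "c2 x \<in> {k, c u}" "c2 y \<in> {k, c u}" by (auto simp: D_def)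
    then have "c x = c u" "c y = c u" using c2u V by (auto simp: c2_def split: if_splits)
    then show False using proper[of x y] e' xy ne by simp
  qed
  \<comment> \<open>The edgeless graph is admissible because every member of the family has an edge;
    otherwise merging its two classes would colour \<open>F\<close> properly with \<open>k\<close>
    colours.\<close>
  have "\<exists>G. r_graph 2 G \<and> verts G = {..<n} \<and> (\<forall>H\<in>decomposition_family F. \<not> contains_copy G H) \<and>
    card (edges G) = ex 2 n (decomposition_family F)"
  proof (rule ex_attained[of 2 "({..<n}, {})"])
    show "\<forall>H\<in>decomposition_family F. \<not> contains_copy ({..<n}, {}) H"
    proof
      fix H assume H: "H \<in> decomposition_family F"
      obtain c a b where c: "proper_colouring F (Suc k) c" "a < Suc k" "b < Suc k" "a \<noteq> b"
        "\<And>u v. {u, v} \<in> edges F \<Longrightarrow> {c u, c v} = {a, b} \<Longrightarrow> {u, v} \<in> edges H"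
        using decomposition_family_colours[OF chi k H] by metis
      obtain c' where c': "c' \<in> verts F \<rightarrow> {..<k}" "\<And>u v. {u, v} \<in> edges F \<Longrightarrow> c' u = c' v \<Longrightarrow> {c u, c v} = {a, b}"
        using merge_colours[OF F c(1-4)] by metis
      have "\<not> proper_colouring F k c'" by (rule no_smaller_colouring[OF chi])
      then obtain u v where "{u, v} \<in> edges F" "c' u = c' v" using c'(1) by (auto simp: proper_colouring_def)
      then have "edges H \<noteq> {}" using c'(2) c(5) by blast
      then show "\<not> contains_copy ({..<n}, {}) H" by (auto simp: contains_copy_def)
    qed
  qed (auto simp: r_graph_def)
  then obtain G where G: "r_graph 2 G" "verts G = {..<n}" "\<not> contains_copy G M" "1 \<le> card (edges G)"
    using M bi unfolding biex_def by auto
  then obtain g where "g \<in> edges G" by (metis card.empty ex_in_conv not_one_le_zero)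
  then obtain x y where xy: "{x, y} \<in> edges G" "x \<noteq> y" "x < n" "y < n"
    using G(1,2) by (auto simp: r_graph_def card_2_iff)
  have "card (verts F - {u, v}) \<le> card ({..<n} - {x, y})"
    using uvF xy n finF by (simp add: card_Diff_subset)
  then obtain f where f: "f ` (verts F - {u, v}) \<subseteq> {..<n} - {x, y}" "inj_on f (verts F - {u, v})"
    using card_le_inj[of "verts F - {u, v}" "{..<n} - {x, y}"] finF by auto
  define f' where "f' = f(u := x, v := y)"
  have out: "f z \<in> {..<n} - {x, y}" if "z \<in> verts F" "z \<noteq> u" "z \<noteq> v" for z
    using f(1) that by (auto simp: image_subset_iff)
  have "contains_copy G M"
    unfolding contains_copy_def
  proof (intro exI[of _ f'] conjI ballI)
    have sub: "verts M \<subseteq> verts F" by (auto simp: M_def delete_verts_def)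
    have "inj_on f' (verts F)"
    proof (rule inj_onI)
      fix a b assume "a \<in> verts F" "b \<in> verts F" "f' a = f' b"
      then show "a = b" using out[of a] out[of b] xy(2) uvF(3) inj_onD[OF f(2), of a b]
        by (auto simp: f'_def split: if_splits)
    qed
    then show "inj_on f' (verts M)" using sub inj_on_subset by blast
    show "f' ` verts M \<subseteq> verts G" using sub out xy G(2) by (fastforce simp: f'_def)
    show "f' ` e' \<in> edges G" if "e' \<in> edges M" for e'
      using edgesM[OF that] e xy uvF by (simp add: f'_def insert_commute)
  qed
  then show False using G(3) by simp
qed

text \<open>Send \<open>x0\<close> to the apex and each colour class \<open>i\<close> into
  \<open>A i\<close>, which has room for all of \<open>verts F\<close>. Images in different parts
  differ because \<open>E\<close> is irreflexive.\<close>

lemma (in adjacency) embed_in_cone: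
  assumes F: "r_graph 2 F" and c: "c \<in> verts F \<rightarrow> {..<k}"
    and proper: "\<And>u v. {u, v} \<in> edges F \<Longrightarrow> u \<noteq> x0 \<Longrightarrow> v \<noteq> x0 \<Longrightarrow> c u \<noteq> c v"
    and cone: "\<not> cone_free V k (card (verts F))"
  shows "\<exists>f. inj_on f (verts F) \<and> f ` verts F \<subseteq> V \<and> (\<forall>u v. {u, v} \<in> edges F \<longrightarrow> E (f u) (f v))"
proof -
  obtain w A where w: "w \<in> V" and A: "multipartite (nbrs V w) k (card (verts F)) A"
    using cone by (auto simp: cone_free_def)
  have Ai: "A i \<subseteq> nbrs V w" "finite (A i)" "card (A i) = card (verts F)" if "i < k" for i
    using A that by (auto simp: multipartite_def)
  have AA: "E x y" if "i < k" "j < k" "i \<noteq> j" "x \<in> A i" "y \<in> A j" for i j x y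
    using A that by (auto simp: multipartite_def)
  have finF: "finite (verts F)" using F by (simp add: r_graph_def)
  have "\<forall>i<k. \<exists>b. b ` verts F \<subseteq> A i \<and> inj_on b (verts F)"
    using card_le_inj[OF finF] Ai by (metis order_refl)
  then obtain b where b: "\<And>i. i < k \<Longrightarrow> b i ` verts F \<subseteq> A i" "\<And>i. i < k \<Longrightarrow> inj_on (b i) (verts F)" by metis
  define f where "f v = (if v = x0 then w else b (c v) v)" for v
  have ck: "c v < k" if "v \<in> verts F" for v using c that by auto
  have fA: "f v \<in> A (c v)" if "v \<in> verts F" "v \<noteq> x0" for v
    using b(1)[OF ck[OF that(1)]] that by (auto simp: f_def)
  have Ew: "E w (f v)" "f v \<in> V" if "v \<in> verts F" "v \<noteq> x0" for v
    using fA[OF that] Ai(1)[OF ck[OF that(1)]] by (auto simp: nbrs_def)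
  show ?thesis
  proof (intro exI[of _ f] conjI allI impI)
    show "f ` verts F \<subseteq> V"
    proof
      fix y assume "y \<in> f ` verts F"
      then obtain v where v: "v \<in> verts F" "y = f v" by auto
      then show "y \<in> V" using Ew(2)[OF v(1)] w by (cases "v = x0") (auto simp: f_def)
    qed
    show "inj_on f (verts F)"
    proof (rule inj_onI)
      fix u v assume uv: "u \<in> verts F" "v \<in> verts F" "f u = f v"
      consider "u = x0" "v = x0" | "u = x0" "v \<noteq> x0" | "u \<noteq> x0" "v = x0" | "u \<noteq> x0" "v \<noteq> x0" "c u = c v"
        | "u \<noteq> x0" "v \<noteq> x0" "c u \<noteq> c v" by blast
      then show "u = v"
      proof cases
        case 2 then show ?thesis using Ew(1)[OF uv(2)] irrefl uv(3) by (auto simp: f_def)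
      next
        case 3 then show ?thesis using Ew(1)[OF uv(1)] irrefl uv(3) by (auto simp: f_def)
      next
        case 4 then show ?thesis using b(2)[OF ck[OF uv(1)]] uv by (auto simp: f_def dest: inj_onD)
      next
        case 5
        then have "E (f u) (f v)" using AA[OF ck[OF uv(1)] ck[OF uv(2)]] fA uv by blast
        then show ?thesis using uv(3) irrefl by simp
      qed simp
    qed
    fix u v assume e: "{u, v} \<in> edges F"
    then have uv: "u \<in> verts F" "v \<in> verts F" "u \<noteq> v" using F by (auto simp: r_graph_def)
    consider "u = x0" "v \<noteq> x0" | "u \<noteq> x0" "v = x0" | "u \<noteq> x0" "v \<noteq> x0" using uv by blast
    then show "E (f u) (f v)"
    proof cases
      case 1 then show ?thesis using Ew(1)[OF uv(2)] by (simp add: f_def)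
    next
      case 2 then show ?thesis using Ew(1)[OF uv(1)] sym by (simp add: f_def)
    next
      case 3 then show ?thesis using AA[OF ck[OF uv(1)] ck[OF uv(2)] proper[OF e 3]] fA uv by blast
    qed
  qed
qed

section \<open>Extending the Turan hypergraph\<close>

text \<open>The residues of the images of the core vertices colour \<open>F\<close>. By injectivity
  \<open>0\<close> is a new vertex of at most one edge \<open>e0\<close>, and \<open>crit\<close>
  gives a monochromatic edge other than \<open>e0\<close>. Its hyperedge repeats a residue, so it
  contains \<open>0\<close> and repeats a nonzero residue; then \<open>0\<close> is one of its new
  vertices, a contradiction. The hypothesis on \<open>H\<close> covers the Turan hypergraph as well
  as its enlargement.\<close>

lemma expansion_free:
  fixes F :: "'a hypergraph" and H :: "nat set set"
  assumes F: "r_graph 2 F" and k: "0 < k"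
    and crit: "\<And>c e. c \<in> verts F \<rightarrow> {..<k} \<Longrightarrow> \<exists>u v. {u, v} \<in> edges F \<and> {u, v} \<noteq> e \<and> c u = c v"
    and H: "\<And>h. h \<in> H \<Longrightarrow> inj_on (\<lambda>v. v mod k) h \<or> 0 \<in> h \<and> (\<forall>v\<in>h. v mod k = 0 \<longrightarrow> v = 0)"
  shows "\<not> contains_copy (V, H) (expansion r F)"
proof
  assume "contains_copy (V, H) (expansion r F)"
  then obtain f :: "'a + 'a set \<times> nat \<Rightarrow> nat" where f: "inj_on f (verts (expansion r F))"
    and fH: "\<And>e. e \<in> edges (expansion r F) \<Longrightarrow> f ` e \<in> H"
    by (auto simp: contains_copy_def)
  have new: "Inr (e, j) \<in> verts (expansion r F)" if "e \<in> edges F" "j < r - 2" for e j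
    using that by (auto simp: expansion_def)
  have "\<exists>e0. \<forall>e\<in>edges F. \<forall>j<r - 2. f (Inr (e, j)) = 0 \<longrightarrow> e = e0"
  proof (cases "\<exists>e0\<in>edges F. \<exists>j<r - 2. f (Inr (e0, j)) = 0")
    case True
    then obtain e0 j0 where e0: "e0 \<in> edges F" "j0 < r - 2" "f (Inr (e0, j0)) = 0" by blast
    have "e = e0" if "e \<in> edges F" "j < r - 2" "f (Inr (e, j)) = 0" for e j
      using inj_onD[OF f _ new[OF that(1,2)] new[OF e0(1,2)]] that(3) e0(3) by simp
    then show ?thesis by blast
  qed blast
  then obtain e0 where e0: "\<And>e j. e \<in> edges F \<Longrightarrow> j < r - 2 \<Longrightarrow> f (Inr (e, j)) = 0 \<Longrightarrow> e = e0" by blast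
  have "(\<lambda>v. f (Inl v) mod k) \<in> verts F \<rightarrow> {..<k}" using k by simp
  from crit[OF this, of e0] obtain u v where uv: "{u, v} \<in> edges F" "{u, v} \<noteq> e0"
    "f (Inl u) mod k = f (Inl v) mod k" by blast
  have V: "u \<in> verts F" "v \<in> verts F" "u \<noteq> v" using uv(1) F by (auto simp: r_graph_def)
  have ne: "f (Inl u) \<noteq> f (Inl v)"
  proof
    assume "f (Inl u) = f (Inl v)"
    then have "(Inl u :: 'a + 'a set \<times> nat) = Inl v" by (rule inj_onD[OF f]) (use V in \<open>auto simp: expansion_def\<close>)
    then show False using V(3) by simp
  qed
  define h where "h = f ` (Inl ` {u, v} \<union> Inr ` ({{u, v}} \<times> {..<r - 2}))"
  have "Inl ` {u, v} \<union> Inr ` ({{u, v}} \<times> {..<r - 2}) \<in> edges (expansion r F)"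
    unfolding expansion_def using uv(1) by (simp only: snd_conv) blast
  then have hH: "h \<in> H" unfolding h_def by (rule fH)
  have mem: "f (Inl u) \<in> h" "f (Inl v) \<in> h" by (auto simp: h_def)
  have "\<not> inj_on (\<lambda>v. v mod k) h" using mem ne uv(3) by (auto simp: inj_on_def)
  then have h0: "0 \<in> h" "\<And>x. x \<in> h \<Longrightarrow> x mod k = 0 \<Longrightarrow> x = 0" using H[OF hH] by auto
  have "f (Inl u) mod k \<noteq> 0" using h0(2) mem uv(3) ne by metis
  then have "f (Inl u) \<noteq> 0" "f (Inl v) \<noteq> 0" using uv(3) by (metis mod_0)+
  then obtain j where "j < r - 2" "f (Inr ({u, v}, j)) = 0" using h0(1) by (auto simp: h_def)
  then show False using e0 uv by blast
qed

lemma turan_edge_inj_on: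
  assumes "0 < k" "e \<in> edges (turan_hypergraph r n k)"
  shows "inj_on (\<lambda>v. v mod k) e"
proof (rule inj_onI)
  fix x y assume xy: "x \<in> e" "y \<in> e" "x mod k = y mod k"
  have "card {v \<in> e. v mod k = x mod k} \<le> 1" "finite e"
    using assms finite_subset[of e "{..<n}"] by (auto simp: turan_hypergraph_def)
  then show "x = y" using xy card_le_Suc0_iff_eq[of "{v \<in> e. v mod k = x mod k}"] by simp
qed

text \<open>Choose \<open>r\<close> residue classes and a multiplier below \<open>n div k\<close> in
  each. The vertices beyond the last full period are ignored, which costs only order
  \<open>n ^ (r - 1)\<close>.\<close>

lemma turan_number_ge:
  assumes k: "0 < k"
  shows "(k choose r) * (n div k) ^ r \<le> turan_number r n k"
proof -
  define m where "m = n div k"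
  define S where "S = Sigma {I. I \<subseteq> {..<k} \<and> card I = r} (\<lambda>I. I \<rightarrow>\<^sub>E {..<m})"
  define g where "g = (\<lambda>(I, \<phi>). (\<lambda>i. i + k * \<phi> i) ` I)"
  have finI: "finite I" if "I \<subseteq> {..<k}" for I using that finite_subset by blast
  have modk: "(i + k * q) mod k = i" if "i < k" for i q using that by simp
  have "card S = (\<Sum>I\<in>{I. I \<subseteq> {..<k} \<and> card I = r}. card (I \<rightarrow>\<^sub>E {..<m}))"
    unfolding S_def using finI by (intro card_SigmaI) (auto intro!: finite_PiE)
  also have "\<dots> = (\<Sum>I\<in>{I. I \<subseteq> {..<k} \<and> card I = r}. m ^ r)"
    using finI by (intro sum.cong refl) (auto simp: card_PiE)
  also have "\<dots> = (k choose r) * m ^ r" by (simp add: n_subsets)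
  finally have cS: "card S = (k choose r) * m ^ r" .
  have "card S \<le> card (edges (turan_hypergraph r n k))"
  proof (rule card_inj_on_le[where f = g])
    show "inj_on g S"
    proof (rule inj_onI)
      fix p q assume "p \<in> S" "q \<in> S" and eq: "g p = g q"
      then obtain I \<phi> J \<psi> where p: "p = (I, \<phi>)" "I \<subseteq> {..<k}" "\<phi> \<in> I \<rightarrow>\<^sub>E {..<m}"
        and q: "q = (J, \<psi>)" "J \<subseteq> {..<k}" "\<psi> \<in> J \<rightarrow>\<^sub>E {..<m}" by (auto simp: S_def)
      have IJ: "(\<lambda>i. i + k * \<phi> i) ` I = (\<lambda>i. i + k * \<psi> i) ` J" using eq p q by (simp add: g_def)
      have "I = (\<lambda>v. v mod k) ` (\<lambda>i. i + k * \<phi> i) ` I"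
        unfolding image_image using p(2) modk by force
      also have "\<dots> = (\<lambda>v. v mod k) ` (\<lambda>i. i + k * \<psi> i) ` J" using IJ by simp
      also have "\<dots> = J" unfolding image_image using q(2) modk by force
      finally have I: "I = J" .
      have "\<phi> i = \<psi> i" if i: "i \<in> I" for i
      proof -
        have "i + k * \<phi> i \<in> (\<lambda>i. i + k * \<psi> i) ` J" using IJ i by blast
        then obtain j where j: "j \<in> J" "i + k * \<phi> i = j + k * \<psi> j" by blast
        have "i < k" "j < k" using i j p(2) q(2) by auto
        then have "i = j" using j(2) modk by metis
        then show ?thesis using j(2) k by simp
      qed
      then have "\<phi> = \<psi>" using p(3) q(3) I by (metis PiE_ext)
      then show "p = q" using I p q by simp
    qed
    show "g ` S \<subseteq> edges (turan_hypergraph r n k)"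
    proof
      fix h assume "h \<in> g ` S"
      then obtain I \<phi> where I: "I \<subseteq> {..<k}" "card I = r" "\<phi> \<in> I \<rightarrow>\<^sub>E {..<m}" "h = (\<lambda>i. i + k * \<phi> i) ` I"
        by (auto simp: S_def g_def)
      have inj: "inj_on (\<lambda>i. i + k * \<phi> i) I"
        using I(1) modk by (intro inj_onI) (metis lessThan_iff subsetD)
      have "i + k * \<phi> i < n" if "i \<in> I" for i
      proof -
        have "i < k" "\<phi> i < m" using I that by auto
        then have "i + k * \<phi> i < k * Suc (\<phi> i)" by simp
        also have "\<dots> \<le> k * m" using \<open>\<phi> i < m\<close> by (intro mult_left_mono) auto
        also have "\<dots> \<le> n" by (simp add: m_def)
        finally show ?thesis .
      qed
      moreover have "card {v \<in> h. v mod k = i} \<le> 1" if "i < k" for i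
      proof -
        have "{v \<in> h. v mod k = i} \<subseteq> {i + k * \<phi> i}" using I(1,4) modk by auto
        then show ?thesis using card_mono[of "{i + k * \<phi> i}"] by fastforce
      qed
      ultimately show "h \<in> edges (turan_hypergraph r n k)"
        using I inj by (auto simp: turan_hypergraph_def card_image)
    qed
    show "finite (edges (turan_hypergraph r n k))"
      by (rule finite_subset[of _ "Pow {..<n}"]) (auto simp: turan_hypergraph_def)
  qed
  then show ?thesis using cS by (simp add: turan_number_def m_def)
qed

lemma ex_expansion_ge:
  assumes F: "r_graph 2 F" and r: "3 \<le> r" and k: "2 \<le> k"
    and crit: "\<And>c e. c \<in> verts F \<rightarrow> {..<k} \<Longrightarrow> \<exists>u v. {u, v} \<in> edges F \<and> {u, v} \<noteq> e \<and> c u = c v"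
  shows "turan_number r n k + (n div k choose (r - 1)) \<le> ex r n {expansion r F}"
proof -
  \<comment> \<open>The distinguished vertex is \<open>0\<close>; residue class 1 supplies the other
    \<open>r - 1\<close> vertices and differs from the class of \<open>0\<close> because
    \<open>2 \<le> k\<close>.\<close>
  define R where "R = {v \<in> {..<n}. v mod k = 1}"
  define X where "X = (if n = 0 then {} else insert 0 ` {S. S \<subseteq> R \<and> card S = r - 1})"
  define T where "T = edges (turan_hypergraph r n k)"
  have R: "finite R" "0 \<notin> R" "\<And>v. v \<in> R \<Longrightarrow> v < n \<and> v mod k = 1" by (auto simp: R_def)
  have finR: "finite S" if "S \<subseteq> R" for S using that R(1) finite_subset by blast
  have X: "\<exists>S\<subseteq>R. card S = r - 1 \<and> h = insert 0 S \<and> 0 < n" if "h \<in> X" for h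
    using that by (auto simp: X_def split: if_splits)
  have T: "h \<subseteq> {..<n}" "card h = r" if "h \<in> T" for h using that by (auto simp: T_def turan_hypergraph_def)
  have "r_graph r ({..<n}, T \<union> X)"
    unfolding r_graph_def
  proof (intro conjI ballI)
    fix h assume "h \<in> edges ({..<n}, T \<union> X)"
    then have "h \<in> T \<or> h \<in> X" by simp
    then show "h \<subseteq> verts ({..<n}, T \<union> X)" "card h = r"
    proof (atomize (full), elim disjE)
      assume "h \<in> X"
      then obtain S where S: "S \<subseteq> R" "card S = r - 1" "h = insert 0 S" "0 < n" using X by blast
      then have "0 \<notin> S" using R(2) by auto
      then have "card h = r" using S finR r by simp
      then show "h \<subseteq> verts ({..<n}, T \<union> X) \<and> card h = r" using S R(3) by auto
    qed (use T in auto)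
  qed auto
  moreover have "\<forall>H\<in>{expansion r F}. \<not> contains_copy ({..<n}, T \<union> X) H"
  proof
    fix H assume "H \<in> {expansion r F}"
    then have H: "H = expansion r F" by simp
    show "\<not> contains_copy ({..<n}, T \<union> X) H"
      unfolding H
    proof (rule expansion_free[OF F _ crit])
      fix h assume "h \<in> T \<union> X"
      then show "inj_on (\<lambda>v. v mod k) h \<or> 0 \<in> h \<and> (\<forall>v\<in>h. v mod k = 0 \<longrightarrow> v = 0)"
      proof
        assume "h \<in> T"
        then show ?thesis using turan_edge_inj_on[of k h r n] k by (simp add: T_def)
      next
        assume "h \<in> X"
        then obtain S where "S \<subseteq> R" "h = insert 0 S" using X by blast
        then show ?thesis using R(3) by fastforce
      qed
    qed (use k in auto)
  qed
  ultimately have le: "card (T \<union> X) \<le> ex r n {expansion r F}"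
    using card_edges_le_ex[of r "({..<n}, T \<union> X)" n "{expansion r F}"] by simp
  have finTX: "finite T" "finite X"
  proof -
    show "finite T" by (rule finite_subset[of _ "Pow {..<n}"]) (use T in auto)
    show "finite X" using R(1) by (simp add: X_def)
  qed
  \<comment> \<open>An added hyperedge has \<open>r - 1 \<ge> 2\<close> vertices in one residue
    class, a Turan hyperedge at most one.\<close>
  have disj: "T \<inter> X = {}"
  proof (rule ccontr)
    assume "T \<inter> X \<noteq> {}"
    then obtain h where h: "h \<in> T" "h \<in> X" by blast
    then obtain S where S: "S \<subseteq> R" "card S = r - 1" "h = insert 0 S" using X by blast
    have "inj_on (\<lambda>v. v mod k) S"
      using turan_edge_inj_on[of k h r n] h(1) k S(3) by (auto simp: T_def intro: inj_on_subset)
    then have "card S = card ((\<lambda>v. v mod k) ` S)" by (simp add: card_image)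
    also have "\<dots> \<le> card {1::nat}" using S(1) R(3) by (intro card_mono) auto
    finally show False using S(2) r by simp
  qed
  have "n div k \<le> card R" unfolding R_def using card_residue_class[of 1 k n] k by simp
  then have "(n div k choose (r - 1)) \<le> (card R choose (r - 1))" by (rule binomial_right_mono)
  also have "\<dots> \<le> card X"
  proof (cases "n = 0")
    case True
    then show ?thesis using r by (simp add: R_def binomial_eq_0)
  next
    case False
    have "inj_on (insert 0) {S. S \<subseteq> R \<and> card S = r - 1}"
      using R(2) by (intro inj_onI) (metis (no_types, lifting) Diff_insert_absorb mem_Collect_eq subsetD)
    then show ?thesis using False n_subsets[OF R(1), of "r - 1"] by (simp add: X_def card_image)
  qed
  finally show ?thesis using le card_Un_disjoint[OF finTX disj] by (simp add: turan_number_def T_def)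
qed

section \<open>The upper bound and the comparison with the Turan number\<close>

text \<open>Hyperedges without a light pair are \<open>r\<close>-cliques in the graph
  \<open>E\<close> of the other pairs. The cone size is \<open>card (verts F)\<close>, so a cone
  would contain \<open>F\<close> with all edges heavy, and hence an expansion.\<close>

lemma ex_expansion_le:
  assumes F: "r_graph 2 F" and r: "3 \<le> r" "r \<le> k" and V0: "0 < card (verts F)"
    and c: "c \<in> verts F \<rightarrow> {..<k}"
    and proper: "\<And>u v. {u, v} \<in> edges F \<Longrightarrow> u \<noteq> x0 \<Longrightarrow> v \<noteq> x0 \<Longrightarrow> c u \<noteq> c v"
  shows "\<exists>K\<ge>0. \<forall>n (G :: nat hypergraph). r_graph r G \<longrightarrow> verts G = {..<n} \<longrightarrow> \<not> contains_copy G (expansion r F) \<longrightarrow>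
    real (card (edges G)) \<le> real (k choose r) * (real n / real k) ^ r + K * real n ^ (r - 1)"
proof -
  have "2 \<le> r" "1 \<le> card (verts F)" using r V0 by auto
  from cone_free_clique_count[OF this(1) r(2) this(2)] obtain C where C: "0 \<le> C"
    "\<forall>(E :: nat \<Rightarrow> nat \<Rightarrow> bool) V. adjacency E \<longrightarrow> finite V \<longrightarrow> adjacency.cone_free E V k (card (verts F)) \<longrightarrow>
    adjacency.ordered_cliques E V r \<le> (\<Prod>j<r. 1 - real j / real k) * real (card V) ^ r + C * real (card V) ^ (r - 1)"
    by (elim exE conjE)
  \<comment> \<open>The number of vertices of the expansion, which is the constant that
    \<open>contains_expansion\<close> asks for.\<close>
  define M where "M = card (verts F) + (r - 2) * card (edges F)"
  have prod: "(\<Prod>j<r. 1 - real j / real k) = fact r * real (k choose r) / real k ^ r"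
  proof -
    have "(\<Prod>j<r. 1 - real j / real k) = (\<Prod>j<r. (real k - real j) / real k)"
      using r by (intro prod.cong) (auto simp: field_simps)
    also have "\<dots> = (\<Prod>j<r. real k - real j) / real k ^ r" by (simp add: prod_dividef)
    also have "(\<Prod>j<r. real k - real j) = fact r * real (k choose r)"
      by (simp add: binomial_gbinomial gbinomial_prod_rev atLeast0LessThan)
    finally show ?thesis .
  qed
  have "real (card (edges G)) \<le> real (k choose r) * (real n / real k) ^ r + (C + real M) * real n ^ (r - 1)"
    if G: "r_graph r G" "verts G = {..<n}" "\<not> contains_copy G (expansion r F)" for n and G :: "nat hypergraph"
  proof -
    have H: "\<forall>e\<in>edges G. e \<subseteq> {..<n} \<and> card e = r" using G by (auto simp: r_graph_def)
    then obtain P where P: "P \<subseteq> {p. p \<subseteq> {..<n} \<and> card p = 2}"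
      "card (edges G) \<le> card {e \<in> edges G. \<forall>p\<in>P. \<not> p \<subseteq> e} + card P * (M * n ^ (r - 3))"
      "\<And>q. q \<subseteq> {..<n} \<Longrightarrow> card q = 2 \<Longrightarrow> q \<notin> P \<Longrightarrow>
        M * n ^ (r - 3) < card {e \<in> {e \<in> edges G. \<forall>p\<in>P. \<not> p \<subseteq> e}. q \<subseteq> e}"
      using light_pairs[of "{..<n}" "edges G" "M * n ^ (r - 3)"] by auto
    define H' where "H' = {e \<in> edges G. \<forall>p\<in>P. \<not> p \<subseteq> e}"
    define E where "E x y \<longleftrightarrow> x \<noteq> y \<and> x < n \<and> y < n \<and> {x, y} \<notin> P" for x y
    interpret adjacency E by standard (auto simp: E_def insert_commute)
    have "cone_free {..<n} k (card (verts F))"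
    proof (rule ccontr)
      assume "\<not> cone_free {..<n} k (card (verts F))"
      from embed_in_cone[OF F c proper this] obtain f where f: "inj_on f (verts F)" "f ` verts F \<subseteq> {..<n}"
        "\<And>u v. {u, v} \<in> edges F \<Longrightarrow> E (f u) (f v)" by blast
      have "contains_copy ({..<n}, H') (expansion r F)"
      proof (rule contains_expansion[OF F r(1) _ f(1,2)])
        show "\<forall>e\<in>edges F. (card (verts F) + (r - 2) * card (edges F)) * card {..<n} ^ (r - 3) < card {h \<in> H'. f ` e \<subseteq> h}"
        proof
          fix e assume e: "e \<in> edges F"
          then have "card e = 2" using F by (auto simp: r_graph_def)
          then obtain u v where uv: "e = {u, v}" "u \<noteq> v" by (auto simp: card_2_iff)
          then have "E (f u) (f v)" using f(3) e by blast
          then show "(card (verts F) + (r - 2) * card (edges F)) * card {..<n} ^ (r - 3) < card {h \<in> H'. f ` e \<subseteq> h}"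
            using P(3)[of "{f u, f v}"] uv by (simp add: E_def M_def H'_def)
        qed
      qed (use H in \<open>auto simp: H'_def\<close>)
      then have "contains_copy G (expansion r F)" using G(2) by (auto simp: contains_copy_def H'_def)
      then show False using G(3) by simp
    qed
    then have cl: "ordered_cliques {..<n} r \<le> fact r * real (k choose r) / real k ^ r * real n ^ r + C * real n ^ (r - 1)"
      using C(2)[rule_format, OF adjacency_axioms, of "{..<n}"] prod by simp
    have "H' \<subseteq> cliques {..<n} r"
    proof
      fix h assume h: "h \<in> H'"
      then have hn: "h \<subseteq> {..<n}" "card h = r" using H by (auto simp: H'_def)
      moreover have "E x y" if "x \<in> h" "y \<in> h" "x \<noteq> y" for x y
        using h hn(1) that by (auto simp: E_def H'_def)
      ultimately show "h \<in> cliques {..<n} r" by (auto simp: cliques_def intro: finite_subset)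
    qed
    then have "card H' \<le> card (cliques {..<n} r)" by (intro card_mono finite_cliques) auto
    then have "fact r * real (card H') \<le> ordered_cliques {..<n} r" by (simp add: ordered_cliques_def)
    with cl have "fact r * real (card H') \<le> fact r * (real (k choose r) * (real n / real k) ^ r) + C * real n ^ (r - 1)"
      by (simp add: power_divide)
    also have "C * real n ^ (r - 1) \<le> fact r * (C * real n ^ (r - 1))"
      using C(1) mult_right_mono[of 1 "fact r" "C * real n ^ (r - 1)"] fact_ge_1[of r, where 'a = real] by simp
    finally have "fact r * real (card H') \<le> fact r * (real (k choose r) * (real n / real k) ^ r + C * real n ^ (r - 1))"
      by (simp add: distrib_left)
    then have cH: "real (card H') \<le> real (k choose r) * (real n / real k) ^ r + C * real n ^ (r - 1)" by simp
    \<comment> \<open>At most \<open>n ^ 2\<close> light pairs, each paying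
      \<open>M * n ^ (r - 3)\<close>, give the error \<open>M * n ^ (r - 1)\<close>.\<close>
    have "card P \<le> card {p. p \<subseteq> {..<n} \<and> card p = 2}" using P(1) by (intro card_mono) auto
    also have "\<dots> \<le> n ^ 2" using card_subsets_le_power[of "{..<n}" 2] by simp
    finally have "card P * (M * n ^ (r - 3)) \<le> n ^ 2 * (M * n ^ (r - 3))" by (rule mult_right_mono) simp
    also have "\<dots> = M * n ^ (2 + (r - 3))" by (simp only: power_add mult_ac)
    also have "2 + (r - 3) = r - 1" using r by simp
    finally have "card (edges G) \<le> card H' + M * n ^ (r - 1)" using P(2) unfolding H'_def by linarith
    then have "real (card (edges G)) \<le> real (card H' + M * n ^ (r - 1))" by (simp only: of_nat_le_iff)
    then show ?thesis using cH by (simp add: algebra_simps)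
  qed
  then show ?thesis using C(1) by (intro exI[of _ "C + real M"]) auto
qed

text \<open>Bernoulli's inequality for \<open>(1 - 1 / y) ^ Suc s\<close>; for
  \<open>y \<le> 1\<close> the left side is not positive. With \<open>y = n / k\<close> and
  \<open>z = n div k\<close> it bounds the effect of rounding.\<close>

lemma power_floor_ge:
  fixes y z :: real
  assumes "0 \<le> y" "0 \<le> z" "y - 1 \<le> z"
  shows "y ^ Suc s - real (Suc s) * y ^ s \<le> z ^ Suc s"
proof (cases "y \<le> 1")
  case True
  have "y ^ Suc s \<le> 1 * y ^ s" unfolding power_Suc using True assms by (intro mult_right_mono) auto
  also have "\<dots> \<le> real (Suc s) * y ^ s" using assms by (intro mult_right_mono) auto
  finally show ?thesis using assms by (smt (verit) zero_le_power)
next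
  case False
  have "y ^ Suc s - real (Suc s) * y ^ s = y ^ Suc s * (1 + real (Suc s) * (- 1 / y))"
    using False by (simp add: field_simps)
  also have "\<dots> \<le> y ^ Suc s * (1 + (- 1 / y)) ^ Suc s"
    using False by (intro mult_left_mono Bernoulli_inequality) (auto simp: field_simps)
  also have "\<dots> = (y * (1 + (- 1 / y))) ^ Suc s" by (simp only: power_mult_distrib)
  also have "y * (1 + (- 1 / y)) = y - 1" using False by (simp add: field_simps)
  also have "(y - 1) ^ Suc s \<le> z ^ Suc s" using False assms by (intro power_mono) auto
  finally show ?thesis .
qed

theorem proposition1p1:
  fixes F :: "'a hypergraph" and r k :: nat
  assumes "r_graph 2 F"
    and "r \<ge> 3"
    and "chromatic_number F = k + 1" and "k + 1 > r"
    and "(\<lambda>n. real (biex n F)) \<in> \<Theta>(\<lambda>n. 1)"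
  shows "\<exists>g :: nat \<Rightarrow> nat.
    (\<forall>n. ex r n {expansion r F} = turan_number r n k + g n) \<and>
    (\<lambda>n. real (g n)) \<in> \<Theta>(\<lambda>n. real n ^ (r - 1))"
proof -
  note F = assms(1) and r = assms(2)
  have chi: "chromatic_number F = Suc k" and k: "1 \<le> k" "2 \<le> k" "0 < k" and rk: "r \<le> k" using assms by auto
  obtain b where b: "\<forall>\<^sub>F n in sequentially. norm (real (biex n F)) \<le> b * norm (1 :: real)"
    using bigthetaD1[OF assms(5)] by (elim landau_o.bigE)
  obtain a where a: "0 < a" "\<forall>\<^sub>F n in sequentially. a * norm (1 :: real) \<le> norm (real (biex n F))"
    using bigthetaD2[OF assms(5)] by (elim landau_omega.bigE)
  have "\<forall>\<^sub>F n in sequentially. a * norm (1 :: real) \<le> norm (real (biex n F)) \<and> card (verts F) \<le> n"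
    by (intro eventually_conj a(2) eventually_ge_at_top)
  \<comment> \<open>A natural number that is at least a positive \<open>a\<close> is at least 1;
    \<open>n1\<close> is taken large enough to accommodate \<open>verts F\<close>.\<close>
  then obtain n1 where n1: "a \<le> real (biex n1 F)" "card (verts F) \<le> n1"
    by (auto dest: eventually_happens)
  have bi1: "1 \<le> biex n1 F" using n1 a(1) by (cases "biex n1 F") auto
  have crit: "\<exists>u v. {u, v} \<in> edges F \<and> {u, v} \<noteq> e \<and> c u = c v" if "c \<in> verts F \<rightarrow> {..<k}" for c e
    by (rule not_colourable_without_edge[OF F chi k(1) bi1 n1(2) that])
  \<comment> \<open>With \<open>biex\<close> at most \<open>b\<close>, an \<open>n\<close> of at
    least \<open>b + 2\<close> makes the star on \<open>n\<close> vertices too large.\<close>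
  have "\<forall>\<^sub>F n in sequentially. norm (real (biex n F)) \<le> b * norm (1 :: real) \<and> nat \<lceil>b\<rceil> + 2 \<le> n"
    by (intro eventually_conj b eventually_ge_at_top)
  then obtain n2 where n2: "real (biex n2 F) \<le> b" "nat \<lceil>b\<rceil> + 2 \<le> n2" by (auto dest: eventually_happens)
  then have "biex n2 F < n2 - 1" by linarith
  then obtain x0 c where c: "c \<in> verts F \<rightarrow> {..<k}"
    "\<And>u v. {u, v} \<in> edges F \<Longrightarrow> u \<noteq> x0 \<Longrightarrow> v \<noteq> x0 \<Longrightarrow> c u \<noteq> c v"
    using colouring_without_vertex[OF F chi k(1)] by blast
  have V0: "0 < card (verts F)"
  proof -
    obtain u v where "{u, v} \<in> edges F" using crit[OF c(1)] by blast
    then have "u \<in> verts F" "finite (verts F)" using F by (auto simp: r_graph_def)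
    then show ?thesis by (auto simp: card_gt_0_iff)
  qed
  have "\<exists>K\<ge>0. \<forall>n (G :: nat hypergraph). r_graph r G \<longrightarrow> verts G = {..<n} \<longrightarrow> \<not> contains_copy G (expansion r F) \<longrightarrow>
    real (card (edges G)) \<le> real (k choose r) * (real n / real k) ^ r + K * real n ^ (r - 1)"
    by (rule ex_expansion_le[OF F r rk V0 c(1)]) (rule c(2))
  then obtain K where K: "0 \<le> K" "\<forall>n (G :: nat hypergraph). r_graph r G \<longrightarrow> verts G = {..<n} \<longrightarrow> \<not> contains_copy G (expansion r F) \<longrightarrow>
    real (card (edges G)) \<le> real (k choose r) * (real n / real k) ^ r + K * real n ^ (r - 1)"
    by (elim exE conjE)
  \<comment> \<open>The truncated subtraction is exact by \<open>ge\<close>.\<close>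
  define g where "g n = ex r n {expansion r F} - turan_number r n k" for n
  have ge: "turan_number r n k + (n div k choose (r - 1)) \<le> ex r n {expansion r F}" for n
    by (rule ex_expansion_ge[OF F r k(2) crit])
  obtain s where s: "r = Suc s" "2 \<le> s" using r by (cases r) auto
  have upper: "real (g n) \<le> (K + real (k choose r) * real r) * real n ^ (r - 1)" for n
  proof -
    \<comment> \<open>Provides an admissible hypergraph, so that the extremal number is attained and
      \<open>K\<close> applies to it.\<close>
    have free: "\<not> contains_copy (turan_hypergraph r n k) (expansion r F)"
      unfolding turan_hypergraph_def
      by (rule expansion_free[OF F k(3) crit])
         (use turan_edge_inj_on[OF k(3)] in \<open>auto simp: turan_hypergraph_def\<close>)
    have "\<exists>G. r_graph r G \<and> verts G = {..<n} \<and> (\<forall>H\<in>{expansion r F}. \<not> contains_copy G H) \<and>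
        card (edges G) = ex r n {expansion r F}"
      by (rule ex_attained[of r "turan_hypergraph r n k"]) (use free in \<open>auto simp: turan_hypergraph_def r_graph_def\<close>)
    then have exle: "real (ex r n {expansion r F}) \<le> real (k choose r) * (real n / real k) ^ r + K * real n ^ (r - 1)"
      using K(2) by (metis insertI1)
    let ?y = "real n / real k"
    have "?y - 1 \<le> real (n div k)"
      using floor_divide_of_nat_eq[where ?'a = real, of n k] by linarith
    then have "?y ^ Suc s - real (Suc s) * ?y ^ s \<le> real (n div k) ^ Suc s"
      by (intro power_floor_ge) auto
    then have "real (k choose r) * (?y ^ r - real r * ?y ^ s) \<le> real (k choose r) * real (n div k) ^ r"
      unfolding s(1) by (intro mult_left_mono) auto
    also have "\<dots> = real ((k choose r) * (n div k) ^ r)" by simp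
    also have "\<dots> \<le> real (turan_number r n k)" unfolding of_nat_le_iff by (rule turan_number_ge[OF k(3)])
    finally have t: "real (k choose r) * ?y ^ r - real (k choose r) * real r * ?y ^ s \<le> real (turan_number r n k)"
      by (simp add: algebra_simps)
    have "?y \<le> real n" using k mult_right_mono[of 1 "real k" "real n"] by (simp add: field_simps)
    then have "?y ^ s \<le> real n ^ s" by (intro power_mono) auto
    then have "real (k choose r) * real r * ?y ^ s \<le> real (k choose r) * real r * real n ^ s"
      by (intro mult_left_mono) auto
    moreover have "real (g n) = real (ex r n {expansion r F}) - real (turan_number r n k)"
      using ge[of n] by (simp add: g_def of_nat_diff)
    ultimately show ?thesis using exle t by (simp add: s(1) algebra_simps)
  qed
  \<comment> \<open>From \<open>k * s \<le> n\<close> follow \<open>s \<le> n div k\<close>, where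
    the binomial coefficient is at least \<open>(n div k / s) ^ s\<close>, and
    \<open>1 \<le> n div k\<close>, which gives \<open>n / k \<le> 2 * (n div k)\<close> and thus
    the factor 2 in the constant.\<close>
  have lower: "(1 / (2 * real k * real s)) ^ s * real n ^ s \<le> real (g n)" if n: "k * s \<le> n" for n
  proof -
    have "s \<le> n div k" using n k(3) by (simp add: less_eq_div_iff_mult_less_eq mult.commute)
    have "k \<le> n" using n s(2) k by (metis dual_order.trans mult_le_mono2 nat_mult_1_right one_le_numeral)
    then have "1 \<le> n div k" using k(3) by (simp add: div_greater_zero_iff Suc_le_eq)
    moreover have "real n / real k \<le> real (n div k) + 1" using floor_divide_of_nat_eq[where ?'a = real, of n k] by linarith
    ultimately have "real n / real k \<le> 2 * real (n div k)" by linarith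
    then have "real n / real k / 2 / real s \<le> real (n div k) / real s" by (intro divide_right_mono) auto
    then have "1 / (2 * real k * real s) * real n \<le> real (n div k) / real s" by (simp add: mult_ac)
    then have "(1 / (2 * real k * real s) * real n) ^ s \<le> (real (n div k) / real s) ^ s"
      by (intro power_mono) auto
    also have "\<dots> \<le> real (n div k choose s)" using \<open>s \<le> n div k\<close> by (rule binomial_ge_n_over_k_pow_k)
    also have "\<dots> \<le> real (g n)" using ge[of n] by (simp add: g_def s(1))
    finally show ?thesis by (simp only: power_mult_distrib)
  qed
  have "(\<lambda>n. real (g n)) \<in> O(\<lambda>n. real n ^ (r - 1))"
  proof (rule landau_o.bigI)
    have "0 < k choose r" using rk by (simp add: zero_less_binomial)
    then show "0 < K + real (k choose r) * real r" using K(1) r by (intro add_nonneg_pos mult_pos_pos) auto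
    show "\<forall>\<^sub>F n in sequentially. norm (real (g n)) \<le> (K + real (k choose r) * real r) * norm (real n ^ (r - 1))"
      using upper by (intro always_eventually) simp
  qed
  moreover have "(\<lambda>n. real (g n)) \<in> \<Omega>(\<lambda>n. real n ^ (r - 1))"
  proof (rule landau_omega.bigI[where c = "(1 / (2 * real k * real s)) ^ s"])
    show "0 < (1 / (2 * real k * real s)) ^ s" using k s by simp
    show "\<forall>\<^sub>F n in sequentially. (1 / (2 * real k * real s)) ^ s * norm (real n ^ (r - 1)) \<le> norm (real (g n))"
      by (rule eventually_mono[OF eventually_ge_at_top[of "k * s"]]) (use lower in \<open>simp add: s(1)\<close>)
  qed
  ultimately have "(\<lambda>n. real (g n)) \<in> \<Theta>(\<lambda>n. real n ^ (r - 1))" by (rule bigthetaI)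
  moreover have "\<forall>n. ex r n {expansion r F} = turan_number r n k + g n"
  proof
    fix n show "ex r n {expansion r F} = turan_number r n k + g n" using ge[of n] by (simp add: g_def)
  qed
  ultimately show ?thesis by (intro exI[of _ g]) simp
qed

end
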